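(* Let $(R,\mathfrak m)$ be a Cohen-Macaulay local ring and let $M\in\Omega\mathrm{CM}(R)$. Then $$r(R\ltimes M)=\begin{cases} r_R(M) & \text{if } R \text{ is a direct summand of } M,\\ r(R)+r_R(M) & \text{otherwise.}\end{cases}$$
   Context: All rings are commutative. For a ring $R$ and an $R$-module $M$, the idealization $R\ltimes M$ is the ring with additive group $R\oplus M$ and multiplication $(a,x)(b,y)=(ab,ay+bx)$. If $(R,\mathfrak m)$ is local, $R\ltimes M$ is local with maximal ideal $\mathfrak m\times M$. For a Cohen-Macaulay (Noetherian) local ring $(R,\mathfrak m)$ of dimension $d\ge 0$, a maximal Cohen-Macaulay (MCM) $R$-module is a finitely generated $R$-module $M$ with $\operatorname{depth}_R M=d$ (in this case $R\ltimes M$ is again a Cohen-Macaulay local ring of dimension $d$). The Cohen-Macaulay type of $M$ is $r_R(M)=\ell_R(\operatorname{Ext}^d_R(R/\mathfrak m,M))$, where $\ell_R$ denotes length, and $r(R)=r_R(R)$. $\Omega\mathrm{CM}(R)$ denotes the class of MCM $R$-modules $M$ for which there is an exact sequence $0\to M\to F\to N\to 0$ of $R$-modules with $F$ a finitely generated free $R$-module and $N$ an MCM $R$-module (i.e. the not necessarily minimal first syzygy modules of MCM $R$-modules). *)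

theory Defs
  imports "HOL-Algebra.Module" "HOL-Algebra.Ring_Divisibility" "HOL-Library.Extended_Nat"
begin

text \<open>
  Rings are HOL-Algebra records. An \<open>R\<close>-module is a record satisfying \<^locale>\<open>module\<close>; that
  record extends a ring record, but its fields \<^const>\<open>mult\<close> and \<^const>\<open>one\<close> play no role.
\<close>

section \<open>Basic module theory\<close>

definition reg_module :: "('a, 'c) ring_scheme \<Rightarrow> ('a, 'a) module" where
  "reg_module R = \<lparr>carrier = carrier R, monoid.mult = monoid.mult R, one = one R,
     ring.zero = \<zero>\<^bsub>R\<^esub>, add = (\<oplus>\<^bsub>R\<^esub>), smult = monoid.mult R\<rparr>"

definition quot_module :: "('a, 'b, 'd) module_scheme \<Rightarrow> 'b set \<Rightarrow> ('a, 'b set) module" where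
  "quot_module M N = \<lparr>carrier = a_rcosets\<^bsub>M\<^esub> N, monoid.mult = undefined, one = undefined,
     ring.zero = N, add = set_add M,
     smult = (\<lambda>a Y. \<Union>x\<in>Y. N +>\<^bsub>M\<^esub> (a \<odot>\<^bsub>M\<^esub> x))\<rparr>"

definition module_hom ::
    "('a, 'c) ring_scheme \<Rightarrow> ('a, 'b, 'd) module_scheme \<Rightarrow> ('a, 'e, 'f) module_scheme \<Rightarrow> ('b \<Rightarrow> 'e) \<Rightarrow> bool"
  where
  "module_hom R M N f \<longleftrightarrow>
     f \<in> carrier M \<rightarrow> carrier N \<and>
     (\<forall>x\<in>carrier M. \<forall>y\<in>carrier M. f (x \<oplus>\<^bsub>M\<^esub> y) = f x \<oplus>\<^bsub>N\<^esub> f y) \<and>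
     (\<forall>a\<in>carrier R. \<forall>x\<in>carrier M. f (a \<odot>\<^bsub>M\<^esub> x) = a \<odot>\<^bsub>N\<^esub> f x)"

definition module_iso ::
    "('a, 'c) ring_scheme \<Rightarrow> ('a, 'b, 'd) module_scheme \<Rightarrow> ('a, 'e, 'f) module_scheme \<Rightarrow> bool"
  where
  "module_iso R M N \<longleftrightarrow> (\<exists>f. module_hom R M N f \<and> bij_betw f (carrier M) (carrier N))"

definition module_span ::
    "('a, 'c) ring_scheme \<Rightarrow> ('a, 'b, 'd) module_scheme \<Rightarrow> 'b set \<Rightarrow> 'b set" where
  "module_span R M S = \<Inter>{N. submodule N R M \<and> S \<subseteq> N}"

definition fin_gen_module :: "('a, 'c) ring_scheme \<Rightarrow> ('a, 'b, 'd) module_scheme \<Rightarrow> bool" where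
  "fin_gen_module R M \<longleftrightarrow> (\<exists>S \<subseteq> carrier M. finite S \<and> module_span R M S = carrier M)"

text \<open>\<open>R\<^sup>n\<close>: vectors are functions on \<^typ>\<open>nat\<close> that vanish from index \<open>n\<close> on.\<close>

definition free_module :: "('a, 'c) ring_scheme \<Rightarrow> nat \<Rightarrow> ('a, nat \<Rightarrow> 'a) module" where
  "free_module R n =
     \<lparr>carrier = {v. (\<forall>i<n. v i \<in> carrier R) \<and> (\<forall>i\<ge>n. v i = \<zero>\<^bsub>R\<^esub>)},
      monoid.mult = undefined, one = undefined,
      ring.zero = (\<lambda>i. \<zero>\<^bsub>R\<^esub>),
      add = (\<lambda>v w i. v i \<oplus>\<^bsub>R\<^esub> w i),
      smult = (\<lambda>a v i. a \<otimes>\<^bsub>R\<^esub> v i)\<rparr>"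

definition direct_summand ::
    "('a, 'c) ring_scheme \<Rightarrow> ('a, 'b, 'd) module_scheme \<Rightarrow> ('a, 'e, 'f) module_scheme \<Rightarrow> bool"
  where \<comment> \<open>up to isomorphism, the first module is a direct summand of the second\<close>
  "direct_summand R L M \<longleftrightarrow>
     (\<exists>A B. submodule A R M \<and> submodule B R M \<and>
        A <+>\<^bsub>M\<^esub> B = carrier M \<and> A \<inter> B = {\<zero>\<^bsub>M\<^esub>} \<and>
        module_iso R L (M\<lparr>carrier := A\<rparr>))"

definition short_exact ::
    "('a, 'c) ring_scheme \<Rightarrow> ('a, 'b, 'd) module_scheme \<Rightarrow> ('b \<Rightarrow> 'e) \<Rightarrow> ('a, 'e, 'f) module_scheme \<Rightarrow>
     ('e \<Rightarrow> 'g) \<Rightarrow> ('a, 'g, 'h) module_scheme \<Rightarrow> bool" where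
  "short_exact R M f F g N \<longleftrightarrow>
     module_hom R M F f \<and> module_hom R F N g \<and>
     inj_on f (carrier M) \<and> f ` carrier M = a_kernel F N g \<and> g ` carrier F = carrier N"

definition module_length :: "('a, 'c) ring_scheme \<Rightarrow> ('a, 'b, 'd) module_scheme \<Rightarrow> enat" where
  "module_length R M =
     Sup {enat n | n. \<exists>C. (\<forall>i\<le>n. submodule (C i) R M) \<and> (\<forall>i<n. C i \<subset> C (Suc i))}"

section \<open>Local rings, dimension and depth\<close>

definition local_ring :: "('a, 'c) ring_scheme \<Rightarrow> bool" where
  "local_ring R \<longleftrightarrow> cring R \<and> (\<exists>!I. maximalideal I R)"

definition max_ideal :: "('a, 'c) ring_scheme \<Rightarrow> 'a set" where
  "max_ideal R = (THE I. maximalideal I R)"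

definition residue_field :: "('a, 'c) ring_scheme \<Rightarrow> ('a, 'a set) module" where
  \<comment> \<open>as a module over the given ring\<close>
  "residue_field R = quot_module (reg_module R) (max_ideal R)"

definition krull_dim :: "('a, 'c) ring_scheme \<Rightarrow> enat" where
  "krull_dim R =
     Sup {enat n | n. \<exists>P. (\<forall>i\<le>n. primeideal (P i) R) \<and> (\<forall>i<n. P i \<subset> P (Suc i))}"

text \<open>The submodule \<open>(S)M\<close> for a set \<open>S\<close> of ring elements.\<close>

definition set_smult ::
    "('a, 'c) ring_scheme \<Rightarrow> ('a, 'b, 'd) module_scheme \<Rightarrow> 'a set \<Rightarrow> 'b set" where
  "set_smult R M S = module_span R M {a \<odot>\<^bsub>M\<^esub> x | a x. a \<in> S \<and> x \<in> carrier M}"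

definition nonzerodivisor_on :: "('a, 'b, 'd) module_scheme \<Rightarrow> 'a \<Rightarrow> bool" where
  "nonzerodivisor_on M a \<longleftrightarrow> (\<forall>x\<in>carrier M. a \<odot>\<^bsub>M\<^esub> x = \<zero>\<^bsub>M\<^esub> \<longrightarrow> x = \<zero>\<^bsub>M\<^esub>)"

definition regular_sequence ::
    "('a, 'c) ring_scheme \<Rightarrow> ('a, 'b, 'd) module_scheme \<Rightarrow> 'a list \<Rightarrow> bool" where
  "regular_sequence R M xs \<longleftrightarrow>
     set xs \<subseteq> carrier R \<and>
     (\<forall>i<length xs.
        nonzerodivisor_on (quot_module M (set_smult R M (set (take i xs)))) (xs ! i)) \<and>
     set_smult R M (set xs) \<noteq> carrier M"

text \<open>
  Depth over a local ring. The zero module has infinite depth, as usual; in particular it is not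
  maximal Cohen-Macaulay below.
\<close>

definition depth :: "('a, 'c) ring_scheme \<Rightarrow> ('a, 'b, 'd) module_scheme \<Rightarrow> enat" where
  "depth R M =
     (if carrier M = {\<zero>\<^bsub>M\<^esub>} then \<infinity>
      else Sup {enat (length xs) | xs. set xs \<subseteq> max_ideal R \<and> regular_sequence R M xs})"

definition CM_local_ring :: "('a, 'c) ring_scheme \<Rightarrow> bool" where
  "CM_local_ring R \<longleftrightarrow>
     local_ring R \<and> noetherian_ring R \<and> depth R (reg_module R) = krull_dim R"

definition MCM :: "('a, 'c) ring_scheme \<Rightarrow> ('a, 'b, 'd) module_scheme \<Rightarrow> bool" where
  "MCM R M \<longleftrightarrow> module R M \<and> fin_gen_module R M \<and> depth R M = krull_dim R"

text \<open>
  Up to isomorphism the free module is \<open>R\<^sup>n\<close>. The module \<open>N\<close> may be sought among modules with elements in \<^typ>\<open>(nat \<Rightarrow> 'a) set\<close>: in any exact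
  sequence \<open>0 \<rightarrow> M \<rightarrow> R\<^sup>n \<rightarrow> N \<rightarrow> 0\<close>, the module \<open>N\<close> is isomorphic to a module of cosets in \<open>R\<^sup>n\<close>.
\<close>

definition Omega_CM :: "('a, 'c) ring_scheme \<Rightarrow> ('a, 'b, 'd) module_scheme \<Rightarrow> bool" where
  "Omega_CM R M \<longleftrightarrow>
     MCM R M \<and>
     (\<exists>n f g (N :: ('a, (nat \<Rightarrow> 'a) set) module).
        MCM R N \<and> short_exact R M f (free_module R n) g N)"

section \<open>Ext and the Cohen-Macaulay type\<close>

text \<open>
  A resolution \<open>\<dots> \<rightarrow> R\<^bsup>n 1\<^esup> \<rightarrow> R\<^bsup>n 0\<^esup> \<rightarrow> A \<rightarrow> 0\<close> by free modules of finite rank, with differentials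
  \<open>d i : R\<^bsup>n (i+1)\<^esup> \<rightarrow> R\<^bsup>n i\<^esup>\<close> and augmentation \<open>e\<close>. It exists whenever \<open>R\<close> is Noetherian and \<open>A\<close> is
  finitely generated.
\<close>

definition free_resolution ::
    "('a, 'c) ring_scheme \<Rightarrow> ('a, 'b, 'd) module_scheme \<Rightarrow>
     (nat \<Rightarrow> nat) \<Rightarrow> (nat \<Rightarrow> (nat \<Rightarrow> 'a) \<Rightarrow> (nat \<Rightarrow> 'a)) \<Rightarrow> ((nat \<Rightarrow> 'a) \<Rightarrow> 'b) \<Rightarrow> bool" where
  "free_resolution R A n d e \<longleftrightarrow>
     module_hom R (free_module R (n 0)) A e \<and>
     e ` carrier (free_module R (n 0)) = carrier A \<and>
     (\<forall>i. module_hom R (free_module R (n (Suc i))) (free_module R (n i)) (d i)) \<and>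
     d 0 ` carrier (free_module R (n 1)) = a_kernel (free_module R (n 0)) A e \<and>
     (\<forall>i. d (Suc i) ` carrier (free_module R (n (Suc (Suc i)))) =
          a_kernel (free_module R (n (Suc i))) (free_module R (n i)) (d i))"

text \<open>Homomorphisms are extensional (undefined off the carrier), so that equal maps are equal.\<close>

definition Hom_module ::
    "('a, 'c) ring_scheme \<Rightarrow> ('a, 'b, 'd) module_scheme \<Rightarrow> ('a, 'e, 'f) module_scheme \<Rightarrow> ('a, 'b \<Rightarrow> 'e) module"
  where
  "Hom_module R A M =
     \<lparr>carrier = {f. module_hom R A M f \<and> f \<in> extensional (carrier A)},
      monoid.mult = undefined, one = undefined,
      ring.zero = (\<lambda>x\<in>carrier A. \<zero>\<^bsub>M\<^esub>),
      add = (\<lambda>f g. \<lambda>x\<in>carrier A. f x \<oplus>\<^bsub>M\<^esub> g x),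
      smult = (\<lambda>a f. \<lambda>x\<in>carrier A. a \<odot>\<^bsub>M\<^esub> f x)\<rparr>"

definition ext_cochains ::
    "('a, 'c) ring_scheme \<Rightarrow> (nat \<Rightarrow> nat) \<Rightarrow> ('a, 'b, 'd) module_scheme \<Rightarrow> nat \<Rightarrow>
     ('a, (nat \<Rightarrow> 'a) \<Rightarrow> 'b) module" where
  "ext_cochains R n M i = Hom_module R (free_module R (n i)) M"

definition ext_diff ::
    "('a, 'c) ring_scheme \<Rightarrow> (nat \<Rightarrow> nat) \<Rightarrow> (nat \<Rightarrow> (nat \<Rightarrow> 'a) \<Rightarrow> (nat \<Rightarrow> 'a)) \<Rightarrow> nat \<Rightarrow>
     ((nat \<Rightarrow> 'a) \<Rightarrow> 'b) \<Rightarrow> ((nat \<Rightarrow> 'a) \<Rightarrow> 'b)" where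
  "ext_diff R n d i f = (\<lambda>v\<in>carrier (free_module R (n (Suc i))). f (d i v))"

definition ext_cocycles ::
    "('a, 'c) ring_scheme \<Rightarrow> (nat \<Rightarrow> nat) \<Rightarrow> (nat \<Rightarrow> (nat \<Rightarrow> 'a) \<Rightarrow> (nat \<Rightarrow> 'a)) \<Rightarrow>
     ('a, 'b, 'd) module_scheme \<Rightarrow> nat \<Rightarrow> ((nat \<Rightarrow> 'a) \<Rightarrow> 'b) set" where
  "ext_cocycles R n d M i =
     a_kernel (ext_cochains R n M i) (ext_cochains R n M (Suc i)) (ext_diff R n d i)"

fun ext_coboundaries ::
    "('a, 'c) ring_scheme \<Rightarrow> (nat \<Rightarrow> nat) \<Rightarrow> (nat \<Rightarrow> (nat \<Rightarrow> 'a) \<Rightarrow> (nat \<Rightarrow> 'a)) \<Rightarrow>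
     ('a, 'b, 'd) module_scheme \<Rightarrow> nat \<Rightarrow> ((nat \<Rightarrow> 'a) \<Rightarrow> 'b) set" where
  "ext_coboundaries R n d M 0 = {\<zero>\<^bsub>ext_cochains R n M 0\<^esub>}"
| "ext_coboundaries R n d M (Suc i) = ext_diff R n d i ` carrier (ext_cochains R n M i)"

text \<open>
  \<open>Ext\<^sup>i\<^sub>R(A, M)\<close> for finitely generated \<open>A\<close> over a Noetherian ring \<open>R\<close>, computed from an arbitrarily
  chosen resolution of \<open>A\<close>; a different choice gives an isomorphic module.
\<close>

definition Ext_module ::
    "('a, 'c) ring_scheme \<Rightarrow> nat \<Rightarrow> ('a, 'b, 'd) module_scheme \<Rightarrow> ('a, 'e, 'f) module_scheme \<Rightarrow>
     ('a, ((nat \<Rightarrow> 'a) \<Rightarrow> 'e) set) module" where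
  "Ext_module R i A M =
     (case (SOME (n, d, e). free_resolution R A n d e) of (n, d, e) \<Rightarrow>
        quot_module ((ext_cochains R n M i)\<lparr>carrier := ext_cocycles R n d M i\<rparr>)
          (ext_coboundaries R n d M i))"

text \<open>The Krull dimension of a Noetherian local ring is finite, so \<^const>\<open>the_enat\<close> loses nothing.\<close>

definition CM_type :: "('a, 'c) ring_scheme \<Rightarrow> ('a, 'b, 'd) module_scheme \<Rightarrow> enat" where
  "CM_type R M = module_length R (Ext_module R (the_enat (krull_dim R)) (residue_field R) M)"

definition CM_type_ring :: "('a, 'c) ring_scheme \<Rightarrow> enat" where
  "CM_type_ring R = CM_type R (reg_module R)"

section \<open>Idealization\<close>

definition idealization ::
    "('a, 'c) ring_scheme \<Rightarrow> ('a, 'b, 'd) module_scheme \<Rightarrow> ('a \<times> 'b) ring" where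
  "idealization R M =
     \<lparr>carrier = carrier R \<times> carrier M,
      monoid.mult = (\<lambda>(a, x) (b, y). (a \<otimes>\<^bsub>R\<^esub> b, a \<odot>\<^bsub>M\<^esub> y \<oplus>\<^bsub>M\<^esub> b \<odot>\<^bsub>M\<^esub> x)),
      one = (\<one>\<^bsub>R\<^esub>, \<zero>\<^bsub>M\<^esub>),
      ring.zero = (\<zero>\<^bsub>R\<^esub>, \<zero>\<^bsub>M\<^esub>),
      add = (\<lambda>(a, x) (b, y). (a \<oplus>\<^bsub>R\<^esub> b, x \<oplus>\<^bsub>M\<^esub> y))\<rparr>"

end

theory Submission
  imports Defs
begin

text \<open>
  Let \<open>0 \<rightarrow> M \<rightarrow> F \<rightarrow> X \<rightarrow> 0\<close> be exact with \<open>F\<close> free and \<open>X\<close> maximal Cohen-Macaulay, and write \<open>S\<close> for the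
  idealization of \<open>M\<close>. By prime avoidance there is a sequence \<open>x\<close> in \<open>\<mm>\<close> of length \<open>dim R\<close> that is
  regular on \<open>R\<close> and \<open>X\<close>, hence on \<open>F\<close>, \<open>M\<close> and \<open>S\<close>, and by Rees' lemma the types of \<open>R\<close>, \<open>M\<close> and \<open>S\<close> are
  the lengths of the socles of these modules modulo \<open>x\<close>. With \<open>J = xR\<close>, the socle of \<open>S/xS\<close> consists of
  the classes of the pairs \<open>(a, y)\<close> with \<open>a \<in> (J : \<mm>)\<close>, \<open>aM \<subseteq> JM\<close> and \<open>y \<in> (JM : \<mm>)\<close>. If \<open>R\<close> is a direct
  summand of \<open>M\<close>, then \<open>aM \<subseteq> JM\<close> forces \<open>a \<in> J\<close>. Otherwise no coordinate of \<open>M \<rightarrow> F\<close> takes a unit as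
  a value, so \<open>M \<subseteq> \<mm>F\<close> and \<open>(J : \<mm>)M \<subseteq> JF \<inter> M = JM\<close>, the equality because \<open>x\<close> is regular on \<open>X\<close>; the
  condition \<open>aM \<subseteq> JM\<close> is then vacuous and the two lengths add up.
\<close>

section \<open>Modules in carrier form\<close>

text \<open>\<open>Ext_module\<close> uses an arbitrarily chosen resolution, so minimality or an
  explicit complex cannot be exploited: Rees' lemma is proved by dimension shifting for every free
  resolution of R/m. Its engine is that multiplication by x in m, being zero on R/m, is
  null-homotopic on the resolution. Depth gives R and X a regular sequence each, while the argument
  needs a single one for both. Vanishing of Ext below dim R is the invariant that forgets the
  sequence. It survives passage modulo a nonzerodivisor at the cost of one degree, and its degree
  zero part says that m lies in no associated prime; prime avoidance on the product of the two
  quotients therefore produces the next common element. Over S the sequence consists of the pairs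
  (x, 0), which act on both components separately, and dim S = dim R because the primes of S are the
  products P x M. The S-length splits into R-lengths because the admissible first components a
  satisfy aM \<subseteq> JM: products of intermediate submodules are then ideals of S.\<close>

lemma reg_module_simps [simp]:
  "carrier (reg_module R) = carrier R" "zero (reg_module R) = zero R"
  "add (reg_module R) = add R" "smult (reg_module R) = mult R"
  by (simp_all add: reg_module_def)

lemma reg_module_minus: "a \<ominus>\<^bsub>reg_module R\<^esub> b = a \<ominus>\<^bsub>R\<^esub> b"
  by (simp add: a_minus_def a_inv_def m_inv_def)

lemma module_reg_module:
  assumes "cring R" shows "module R (reg_module R)"
proof -
  interpret cring R by fact
  show ?thesis
  proof (rule moduleI)
    show "abelian_group (reg_module R)"
      by (rule abelian_groupI) (auto simp: a_ac intro: l_neg)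
  qed (auto simp: assms l_distr r_distr m_assoc)
qed

lemma (in abelian_group) minus_zero_right [simp]: "a \<in> carrier G \<Longrightarrow> a \<ominus> \<zero> = a"
  using r_neg[of \<zero>] by (simp add: minus_eq del: add.inv_eq_1_iff)

text \<open>Negation is scaling by \<open>\<ominus> \<one>\<close>, so only sums and scalar
  multiples remain to be checked.\<close>

lemma (in module) submoduleI':
  assumes "H \<subseteq> carrier M" and "\<zero>\<^bsub>M\<^esub> \<in> H"
    and "\<And>a b. \<lbrakk>a \<in> H; b \<in> H\<rbrakk> \<Longrightarrow> a \<oplus>\<^bsub>M\<^esub> b \<in> H"
    and sm: "\<And>a x. \<lbrakk>a \<in> carrier R; x \<in> H\<rbrakk> \<Longrightarrow> a \<odot>\<^bsub>M\<^esub> x \<in> H"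
  shows "submodule H R M"
proof (rule submoduleI)
  fix a assume "a \<in> H"
  then show "\<ominus>\<^bsub>M\<^esub> a \<in> H"
    using sm[of "\<ominus> \<one>" a] assms(1) by (auto simp: smult_l_minus)
qed (use assms in auto)

lemma (in module) submodule_zero [simp]: "submodule N R M \<Longrightarrow> \<zero>\<^bsub>M\<^esub> \<in> N"
  using subgroup.one_closed[OF submodule.axioms(1)] by fastforce

lemma (in module) submodule_minus:
  "\<lbrakk>submodule N R M; a \<in> N; b \<in> N\<rbrakk> \<Longrightarrow> a \<ominus>\<^bsub>M\<^esub> b \<in> N"
  by (metis M.minus_eq submoduleE(5,6))

lemma (in module) zero_submodule: "submodule {\<zero>\<^bsub>M\<^esub>} R M"
  by (rule submoduleI') auto

lemma submodule_reg_module_iff: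
  assumes "cring R"
  shows "submodule I R (reg_module R) \<longleftrightarrow> ideal I R"
proof
  interpret R: cring R by fact
  interpret module R "reg_module R" by (rule module_reg_module) fact
  show "ideal I R" if I: "submodule I R (reg_module R)"
  proof (rule idealI)
    \<comment> \<open>\<open>a_inv\<close> is built from carrier, addition and zero alone, and the
      two records share these.\<close>
    have "a_inv (reg_module R) = a_inv R"
      by (simp add: a_inv_def m_inv_def fun_eq_iff)
    then show "subgroup I (add_monoid R)"
      using submoduleE[OF I] by (intro R.add.subgroupI) (auto simp flip: a_inv_def)
    show "x \<otimes>\<^bsub>R\<^esub> a \<in> I" "a \<otimes>\<^bsub>R\<^esub> x \<in> I" if "a \<in> I" "x \<in> carrier R" for a x
      using submoduleE(1,4)[OF I] that R.m_comm[of a x] by auto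
  qed (rule R.ring_axioms)
  show "submodule I R (reg_module R)" if "ideal I R"
  proof -
    interpret I: ideal I R by fact
    show ?thesis by (rule submoduleI') (use I.a_subset in \<open>auto simp: I.I_l_closed\<close>)
  qed
qed

subsection \<open>Congruence modulo a submodule\<close>

text \<open>A module \<open>M/N\<close> is represented by the pair \<open>(M, N)\<close>, so that the type of its elements does not
  change when one passes to quotients repeatedly.\<close>

definition cong_mod :: "('a, 'b, 'd) module_scheme \<Rightarrow> 'b set \<Rightarrow> 'b \<Rightarrow> 'b \<Rightarrow> bool" where
  "cong_mod M N x y \<longleftrightarrow> x \<in> carrier M \<and> y \<in> carrier M \<and> x \<ominus>\<^bsub>M\<^esub> y \<in> N"

context module
begin

lemma cong_mod_closed:
  assumes "cong_mod M N x y" shows "x \<in> carrier M" "y \<in> carrier M"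
  using assms by (auto simp: cong_mod_def)

lemma cong_mod_refl: "\<lbrakk>submodule N R M; x \<in> carrier M\<rbrakk> \<Longrightarrow> cong_mod M N x x"
  by (simp add: cong_mod_def M.minus_eq M.r_neg)

lemma cong_mod_sym:
  assumes "submodule N R M" "cong_mod M N x y" shows "cong_mod M N y x"
proof -
  have "\<ominus>\<^bsub>M\<^esub> (x \<ominus>\<^bsub>M\<^esub> y) = y \<ominus>\<^bsub>M\<^esub> x"
    using assms by (simp add: cong_mod_def M.minus_eq M.minus_add M.a_comm)
  then show ?thesis using assms submoduleE(6)[OF assms(1)] by (metis cong_mod_def)
qed

lemma cong_mod_trans:
  assumes "submodule N R M" "cong_mod M N x y" "cong_mod M N y z"
  shows "cong_mod M N x z"
proof -
  have c: "x \<in> carrier M" "y \<in> carrier M" "z \<in> carrier M"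
    using assms by (auto simp: cong_mod_def)
  have "(x \<ominus>\<^bsub>M\<^esub> y) \<oplus>\<^bsub>M\<^esub> (y \<ominus>\<^bsub>M\<^esub> z) = x \<ominus>\<^bsub>M\<^esub> z"
    using c by (simp add: M.minus_eq M.a_assoc M.r_neg1)
  then show ?thesis using assms c submoduleE(5)[OF assms(1)] by (metis cong_mod_def)
qed

lemma cong_mod_add:
  assumes "submodule N R M" "cong_mod M N x y" "cong_mod M N x' y'"
  shows "cong_mod M N (x \<oplus>\<^bsub>M\<^esub> x') (y \<oplus>\<^bsub>M\<^esub> y')"
proof -
  have c: "x \<in> carrier M" "y \<in> carrier M" "x' \<in> carrier M" "y' \<in> carrier M"
    using assms by (auto simp: cong_mod_def)
  have "(x \<ominus>\<^bsub>M\<^esub> y) \<oplus>\<^bsub>M\<^esub> (x' \<ominus>\<^bsub>M\<^esub> y') = (x \<oplus>\<^bsub>M\<^esub> x') \<ominus>\<^bsub>M\<^esub> (y \<oplus>\<^bsub>M\<^esub> y')"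
    using c by (simp add: M.minus_eq M.minus_add M.a_ac)
  then show ?thesis using assms c submoduleE(5)[OF assms(1)] by (metis cong_mod_def M.a_closed)
qed

lemma cong_mod_smult:
  assumes "submodule N R M" "cong_mod M N x y" "a \<in> carrier R"
  shows "cong_mod M N (a \<odot>\<^bsub>M\<^esub> x) (a \<odot>\<^bsub>M\<^esub> y)"
proof -
  have "a \<odot>\<^bsub>M\<^esub> (x \<ominus>\<^bsub>M\<^esub> y) = a \<odot>\<^bsub>M\<^esub> x \<ominus>\<^bsub>M\<^esub> a \<odot>\<^bsub>M\<^esub> y"
    using assms by (simp add: cong_mod_def M.minus_eq smult_r_distr smult_r_minus)
  then show ?thesis
    using assms submoduleE(4)[OF assms(1)] by (metis cong_mod_def smult_closed)
qed

lemma cong_mod_zero_iff: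
  assumes "submodule N R M"
  shows "cong_mod M N x \<zero>\<^bsub>M\<^esub> \<longleftrightarrow> x \<in> N"
  using submoduleE(1)[OF assms] by (auto simp: cong_mod_def)

lemma cong_mod_mem_iff:
  assumes "submodule N R M" "cong_mod M N x y"
  shows "x \<in> N \<longleftrightarrow> y \<in> N"
  using cong_mod_zero_iff[OF assms(1)] cong_mod_trans[OF assms(1)] cong_mod_sym[OF assms(1)] assms(2)
  by metis

lemma cong_mod_mono:
  "\<lbrakk>cong_mod M N x y; N \<subseteq> N'\<rbrakk> \<Longrightarrow> cong_mod M N' x y"
  by (auto simp: cong_mod_def)

lemma smult_minus_right:
  "\<lbrakk>a \<in> carrier R; x \<in> carrier M; y \<in> carrier M\<rbrakk> \<Longrightarrow> a \<odot>\<^bsub>M\<^esub> (x \<ominus>\<^bsub>M\<^esub> y) = a \<odot>\<^bsub>M\<^esub> x \<ominus>\<^bsub>M\<^esub> a \<odot>\<^bsub>M\<^esub> y"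
  by (simp add: M.minus_eq smult_r_distr smult_r_minus)

lemma smult_left_commute:
  "\<lbrakk>a \<in> carrier R; b \<in> carrier R; x \<in> carrier M\<rbrakk> \<Longrightarrow> a \<odot>\<^bsub>M\<^esub> (b \<odot>\<^bsub>M\<^esub> x) = b \<odot>\<^bsub>M\<^esub> (a \<odot>\<^bsub>M\<^esub> x)"
  by (metis R.m_comm smult_assoc1)

lemma submodule_cancel_left:
  assumes N: "submodule N R M" "x \<in> N" "y \<in> carrier M" shows "x \<oplus>\<^bsub>M\<^esub> y \<in> N \<longleftrightarrow> y \<in> N"
proof -
  have "cong_mod M N (x \<oplus>\<^bsub>M\<^esub> y) (\<zero>\<^bsub>M\<^esub> \<oplus>\<^bsub>M\<^esub> y)"
    using assms by (intro cong_mod_add cong_mod_refl) (auto simp: cong_mod_zero_iff)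
  then show ?thesis using cong_mod_mem_iff[OF N(1)] assms by simp
qed

end

subsection \<open>Adjoining multiples and colon submodules\<close>

text \<open>This is N + aM, the preimage in M of a(M/N); the pair of M and
  \<open>adjoin_mult M N a\<close> stands for the quotient of M/N by a. Folding over a list x yields
  N + xM.\<close>

definition adjoin_mult :: "('a, 'b, 'd) module_scheme \<Rightarrow> 'b set \<Rightarrow> 'a \<Rightarrow> 'b set" where
  "adjoin_mult M N a = {y \<oplus>\<^bsub>M\<^esub> a \<odot>\<^bsub>M\<^esub> x | x y. x \<in> carrier M \<and> y \<in> N}"

definition nzd_mod :: "('a, 'b, 'd) module_scheme \<Rightarrow> 'b set \<Rightarrow> 'a \<Rightarrow> bool" where
  "nzd_mod M N a \<longleftrightarrow> (\<forall>x\<in>carrier M. a \<odot>\<^bsub>M\<^esub> x \<in> N \<longrightarrow> x \<in> N)"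

text \<open>For I the maximal ideal, the quotient of this submodule by N is the socle of M/N, that
  is Hom(R/m, M/N).\<close>

definition colon_mod :: "('a, 'b, 'd) module_scheme \<Rightarrow> 'b set \<Rightarrow> 'a set \<Rightarrow> 'b set" where
  "colon_mod M N I = {x \<in> carrier M. \<forall>a\<in>I. a \<odot>\<^bsub>M\<^esub> x \<in> N}"

context module
begin

text \<open>Reads membership as divisibility by a in M/N, the form that combines with the congruence
  rules.\<close>

lemma adjoin_mult_iff:
  assumes "submodule N R M" "a \<in> carrier R"
  shows "z \<in> adjoin_mult M N a \<longleftrightarrow> (\<exists>x\<in>carrier M. cong_mod M N z (a \<odot>\<^bsub>M\<^esub> x))"
proof
  assume "z \<in> adjoin_mult M N a"
  then obtain x y where xy: "x \<in> carrier M" "y \<in> N" "z = y \<oplus>\<^bsub>M\<^esub> a \<odot>\<^bsub>M\<^esub> x"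
    by (auto simp: adjoin_mult_def)
  have "cong_mod M N (y \<oplus>\<^bsub>M\<^esub> a \<odot>\<^bsub>M\<^esub> x) (\<zero>\<^bsub>M\<^esub> \<oplus>\<^bsub>M\<^esub> a \<odot>\<^bsub>M\<^esub> x)"
    using assms xy by (intro cong_mod_add cong_mod_refl) (auto simp: cong_mod_zero_iff)
  then show "\<exists>x\<in>carrier M. cong_mod M N z (a \<odot>\<^bsub>M\<^esub> x)"
    using xy assms by (intro bexI[of _ x]) auto
next
  assume "\<exists>x\<in>carrier M. cong_mod M N z (a \<odot>\<^bsub>M\<^esub> x)"
  then obtain x where x: "x \<in> carrier M" "cong_mod M N z (a \<odot>\<^bsub>M\<^esub> x)" by blast
  then have "z = (z \<ominus>\<^bsub>M\<^esub> a \<odot>\<^bsub>M\<^esub> x) \<oplus>\<^bsub>M\<^esub> a \<odot>\<^bsub>M\<^esub> x"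
    using assms by (simp add: cong_mod_def M.minus_eq M.a_assoc M.l_neg)
  then show "z \<in> adjoin_mult M N a"
    using x unfolding adjoin_mult_def cong_mod_def by blast
qed

lemma adjoin_mult_submodule:
  assumes N: "submodule N R M" and a: "a \<in> carrier R"
  shows "submodule (adjoin_mult M N a) R M"
proof (rule submoduleI')
  show "adjoin_mult M N a \<subseteq> carrier M"
    using submoduleE(1)[OF N] a by (auto simp: adjoin_mult_def)
  show "\<zero>\<^bsub>M\<^esub> \<in> adjoin_mult M N a"
    unfolding adjoin_mult_iff[OF N a] using N a
    by (intro bexI[of _ "\<zero>\<^bsub>M\<^esub>"]) (auto intro: cong_mod_refl)
next
  fix x y assume "x \<in> adjoin_mult M N a" "y \<in> adjoin_mult M N a"
  then obtain u v where uv: "u \<in> carrier M" "v \<in> carrier M"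
    "cong_mod M N x (a \<odot>\<^bsub>M\<^esub> u)" "cong_mod M N y (a \<odot>\<^bsub>M\<^esub> v)"
    unfolding adjoin_mult_iff[OF N a] by blast
  then have "cong_mod M N (x \<oplus>\<^bsub>M\<^esub> y) (a \<odot>\<^bsub>M\<^esub> (u \<oplus>\<^bsub>M\<^esub> v))"
    using a by (auto simp: smult_r_distr intro: cong_mod_add[OF N])
  then show "x \<oplus>\<^bsub>M\<^esub> y \<in> adjoin_mult M N a"
    unfolding adjoin_mult_iff[OF N a] using uv by blast
next
  fix r x assume r: "r \<in> carrier R" and "x \<in> adjoin_mult M N a"
  then obtain u where u: "u \<in> carrier M" "cong_mod M N x (a \<odot>\<^bsub>M\<^esub> u)"
    unfolding adjoin_mult_iff[OF N a] by blast
  then have "cong_mod M N (r \<odot>\<^bsub>M\<^esub> x) (a \<odot>\<^bsub>M\<^esub> (r \<odot>\<^bsub>M\<^esub> u))"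
    using cong_mod_smult[OF N u(2) r] r a by (simp add: smult_left_commute)
  then show "r \<odot>\<^bsub>M\<^esub> x \<in> adjoin_mult M N a"
    unfolding adjoin_mult_iff[OF N a] using u r by blast
qed

lemma adjoin_mult_superset:
  assumes N: "submodule N R M" and a: "a \<in> carrier R"
  shows "N \<subseteq> adjoin_mult M N a"
proof
  fix x assume "x \<in> N"
  then show "x \<in> adjoin_mult M N a"
    unfolding adjoin_mult_iff[OF N a] using N a submoduleE(1)[OF N]
    by (intro bexI[of _ "\<zero>\<^bsub>M\<^esub>"]) (auto simp: cong_mod_zero_iff)
qed

lemma smult_mem_adjoin_mult:
  assumes N: "submodule N R M" and a: "a \<in> carrier R" "x \<in> carrier M"
  shows "a \<odot>\<^bsub>M\<^esub> x \<in> adjoin_mult M N a"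
  unfolding adjoin_mult_iff[OF N a(1)] using assms by (auto intro: cong_mod_refl)

lemma nzd_mod_cong:
  assumes "submodule N R M" "a \<in> carrier R" "nzd_mod M N a"
    and "x \<in> carrier M" "y \<in> carrier M" "cong_mod M N (a \<odot>\<^bsub>M\<^esub> x) (a \<odot>\<^bsub>M\<^esub> y)"
  shows "cong_mod M N x y"
  using assms by (auto simp: cong_mod_def nzd_mod_def smult_minus_right)

lemma colon_mod_submodule:
  assumes N: "submodule N R M" and I: "I \<subseteq> carrier R"
  shows "submodule (colon_mod M N I) R M"
proof (rule submoduleI')
  fix r x assume *: "r \<in> carrier R" "x \<in> colon_mod M N I"
  have "a \<odot>\<^bsub>M\<^esub> (r \<odot>\<^bsub>M\<^esub> x) \<in> N" if "a \<in> I" for a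
    using * that I submoduleE(4)[OF N, of r "a \<odot>\<^bsub>M\<^esub> x"]
    by (auto simp: colon_mod_def smult_left_commute subset_iff)
  then show "r \<odot>\<^bsub>M\<^esub> x \<in> colon_mod M N I" using * by (auto simp: colon_mod_def)
qed (use N I in \<open>auto simp: colon_mod_def smult_r_distr subset_iff submoduleE(5)[OF N]\<close>)

lemma colon_mod_superset:
  assumes N: "submodule N R M" and I: "I \<subseteq> carrier R"
  shows "N \<subseteq> colon_mod M N I"
  using submoduleE(1,4)[OF N] I by (auto simp: colon_mod_def)

end

subsection \<open>Homomorphisms\<close>

lemma module_hom_closed: "\<lbrakk>module_hom R A B f; x \<in> carrier A\<rbrakk> \<Longrightarrow> f x \<in> carrier B"
  and module_hom_add:
    "\<lbrakk>module_hom R A B f; x \<in> carrier A; y \<in> carrier A\<rbrakk> \<Longrightarrow> f (x \<oplus>\<^bsub>A\<^esub> y) = f x \<oplus>\<^bsub>B\<^esub> f y"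
  and module_hom_smult:
    "\<lbrakk>module_hom R A B f; a \<in> carrier R; x \<in> carrier A\<rbrakk> \<Longrightarrow> f (a \<odot>\<^bsub>A\<^esub> x) = a \<odot>\<^bsub>B\<^esub> f x"
  by (auto simp: module_hom_def)

lemma module_homI:
  assumes "\<And>x. x \<in> carrier A \<Longrightarrow> f x \<in> carrier B"
    and "\<And>x y. \<lbrakk>x \<in> carrier A; y \<in> carrier A\<rbrakk> \<Longrightarrow> f (x \<oplus>\<^bsub>A\<^esub> y) = f x \<oplus>\<^bsub>B\<^esub> f y"
    and "\<And>a x. \<lbrakk>a \<in> carrier R; x \<in> carrier A\<rbrakk> \<Longrightarrow> f (a \<odot>\<^bsub>A\<^esub> x) = a \<odot>\<^bsub>B\<^esub> f x"
  shows "module_hom R A B f"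
  using assms by (auto simp: module_hom_def)

lemma module_hom_zero:
  assumes "module R A" "module R B" "module_hom R A B f"
  shows "f \<zero>\<^bsub>A\<^esub> = \<zero>\<^bsub>B\<^esub>"
proof -
  interpret A: module R A by fact
  interpret B: module R B by fact
  have "f (\<zero>\<^bsub>R\<^esub> \<odot>\<^bsub>A\<^esub> \<zero>\<^bsub>A\<^esub>) = \<zero>\<^bsub>R\<^esub> \<odot>\<^bsub>B\<^esub> f \<zero>\<^bsub>A\<^esub>"
    using assms(3) by (intro module_hom_smult) auto
  then show ?thesis using module_hom_closed[OF assms(3)] by simp
qed

lemma module_hom_minus:
  assumes "module R A" "module R B" "module_hom R A B f" "x \<in> carrier A" "y \<in> carrier A"
  shows "f (x \<ominus>\<^bsub>A\<^esub> y) = f x \<ominus>\<^bsub>B\<^esub> f y"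
proof -
  interpret A: module R A by fact
  interpret B: module R B by fact
  have c: "f x \<in> carrier B" "f y \<in> carrier B" "f (x \<ominus>\<^bsub>A\<^esub> y) \<in> carrier B"
    using assms by (auto intro: module_hom_closed)
  have "f ((x \<ominus>\<^bsub>A\<^esub> y) \<oplus>\<^bsub>A\<^esub> y) = f (x \<ominus>\<^bsub>A\<^esub> y) \<oplus>\<^bsub>B\<^esub> f y"
    using assms by (intro module_hom_add) auto
  moreover have "(x \<ominus>\<^bsub>A\<^esub> y) \<oplus>\<^bsub>A\<^esub> y = x" using assms by (simp add: A.M.minus_eq A.M.a_assoc A.M.l_neg)
  ultimately show ?thesis using c by (simp add: B.M.minus_eq B.M.a_assoc B.M.r_neg)
qed

lemma module_hom_compose:
  "\<lbrakk>module_hom R A B f; module_hom R B C g\<rbrakk> \<Longrightarrow> module_hom R A C (\<lambda>x. g (f x))"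
  by (auto simp: module_hom_def Pi_def)

lemma module_hom_vimage:
  assumes A: "module R A" and B: "module R B" and f: "module_hom R A B f" and N: "submodule N R B"
  shows "submodule {x \<in> carrier A. f x \<in> N} R A"
proof -
  interpret A: module R A by fact
  interpret B: module R B by fact
  show ?thesis
    by (rule A.submoduleI')
       (use module_hom_zero[OF A B f] f N B.submoduleE[OF N] in
         \<open>auto simp: module_hom_add module_hom_smult\<close>)
qed

lemma module_hom_image:
  assumes A: "module R A" and B: "module R B" and f: "module_hom R A B f" and N: "submodule N R A"
  shows "submodule (f ` N) R B"
proof -
  interpret A: module R A by fact
  interpret B: module R B by fact
  note N' = A.submoduleE[OF N]
  show ?thesis
  proof (rule B.submoduleI')
    show "\<zero>\<^bsub>B\<^esub> \<in> f ` N" using module_hom_zero[OF A B f] A.submodule_zero[OF N] by (metis imageI)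
    show "f ` N \<subseteq> carrier B" using N' module_hom_closed[OF f] by auto
    show "a \<oplus>\<^bsub>B\<^esub> b \<in> f ` N" if ab: "a \<in> f ` N" "b \<in> f ` N" for a b
    proof -
      obtain x y where "x \<in> N" "y \<in> N" "a = f x" "b = f y" using ab by blast
      then have "a \<oplus>\<^bsub>B\<^esub> b = f (x \<oplus>\<^bsub>A\<^esub> y)" "x \<oplus>\<^bsub>A\<^esub> y \<in> N"
        using N' module_hom_add[OF f] by (auto simp: subset_iff)
      then show ?thesis by blast
    qed
    show "a \<odot>\<^bsub>B\<^esub> b \<in> f ` N" if ab: "a \<in> carrier R" "b \<in> f ` N" for a b
    proof -
      obtain y where "y \<in> N" "b = f y" using ab by blast
      then have "a \<odot>\<^bsub>B\<^esub> b = f (a \<odot>\<^bsub>A\<^esub> y)" "a \<odot>\<^bsub>A\<^esub> y \<in> N"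
        using N' module_hom_smult[OF f ab(1)] ab by auto
      then show ?thesis by blast
    qed
  qed
qed

subsection \<open>Free modules\<close>

lemma free_module_simps:
  "v \<in> carrier (free_module R n) \<longleftrightarrow> (\<forall>i<n. v i \<in> carrier R) \<and> (\<forall>i\<ge>n. v i = \<zero>\<^bsub>R\<^esub>)"
  "zero (free_module R n) = (\<lambda>i. \<zero>\<^bsub>R\<^esub>)"
  "v \<oplus>\<^bsub>free_module R n\<^esub> w = (\<lambda>i. v i \<oplus>\<^bsub>R\<^esub> w i)"
  "a \<odot>\<^bsub>free_module R n\<^esub> v = (\<lambda>i. a \<otimes>\<^bsub>R\<^esub> v i)"
  by (simp_all add: free_module_def)

context
  notes free_module_simps [simp]
begin

lemma free_module_nth_closed:
  "\<lbrakk>cring R; v \<in> carrier (free_module R n)\<rbrakk> \<Longrightarrow> v i \<in> carrier R"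
  by (cases "i < n") (auto simp: cring.cring_simprules)

lemma module_free_module:
  assumes "cring R" shows "module R (free_module R n)"
proof -
  interpret cring R by fact
  note nth = free_module_nth_closed[OF assms, where n = n]
  show ?thesis
  proof (rule moduleI)
    show "abelian_group (free_module R n)"
    proof (rule abelian_groupI, goal_cases)
      case (3 x y z) then show ?case using nth by (auto simp del: free_module_simps(1) simp: a_assoc)
    next
      case (4 x y) then show ?case using nth by (auto simp del: free_module_simps(1) simp: a_comm)
    next
      case (5 x) then show ?case using nth by (auto simp del: free_module_simps(1))
    next
      case (6 x) then show ?case using nth[of x]
        by (intro bexI[of _ "\<lambda>i. \<ominus>\<^bsub>R\<^esub> x i"])
           (auto simp del: free_module_simps(1) simp: l_neg fun_eq_iff,
            auto simp: l_neg)
    qed auto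
  qed (use nth in \<open>auto simp del: free_module_simps(1) simp: l_distr r_distr m_assoc assms fun_eq_iff\<close>,
       auto)
qed

text \<open>The rank does not occur: vectors vanish beyond it, so one function serves as the basis
  vector of index j in every free module of rank above j.\<close>

definition free_unit :: "('a, 'c) ring_scheme \<Rightarrow> nat \<Rightarrow> nat \<Rightarrow> 'a" where
  "free_unit R j = (\<lambda>i. if i = j then \<one>\<^bsub>R\<^esub> else \<zero>\<^bsub>R\<^esub>)"

lemma free_unit_closed: "\<lbrakk>cring R; j < n\<rbrakk> \<Longrightarrow> free_unit R j \<in> carrier (free_module R n)"
  by (auto simp: free_unit_def cring.cring_simprules)

text \<open>A vector supported on the first k + 1 indices is one supported on the first k plus a
  multiple of \<open>free_unit R k\<close>, so induction on the support exhausts the free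
  module.\<close>

lemma free_module_induct:
  assumes R: "cring R" and A: "submodule A R (free_module R n)"
    and unit: "\<And>j. j < n \<Longrightarrow> free_unit R j \<in> A"
  shows "A = carrier (free_module R n)"
proof -
  interpret cring R by fact
  interpret F: module R "free_module R n" by (rule module_free_module) fact
  have "v \<in> A" if "k \<le> n" "v \<in> carrier (free_module R n)" "\<forall>i\<ge>k. v i = \<zero>\<^bsub>R\<^esub>" for k v
    using that
  proof (induction k arbitrary: v)
    case 0
    then have "v = \<zero>\<^bsub>free_module R n\<^esub>" by (auto simp: fun_eq_iff)
    then show ?case using A F.submodule_zero by metis
  next
    case (Suc k)
    have vk: "v i \<in> carrier R" for i using Suc.prems R free_module_nth_closed by metis
    have "v(k := \<zero>\<^bsub>R\<^esub>) \<in> A"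
      by (rule Suc.IH) (use Suc.prems in \<open>auto simp: le_Suc_eq not_less_eq_eq\<close>)
    moreover have "v k \<odot>\<^bsub>free_module R n\<^esub> free_unit R k \<in> A"
      using unit[of k] F.submoduleE(4)[OF A vk[of k]] Suc.prems(1) by auto
    moreover have "v = v(k := \<zero>\<^bsub>R\<^esub>) \<oplus>\<^bsub>free_module R n\<^esub> v k \<odot>\<^bsub>free_module R n\<^esub> free_unit R k"
      using vk by (auto simp: free_unit_def fun_eq_iff)
    ultimately show ?case using F.submoduleE(5)[OF A] by metis
  qed
  from this[of n] show ?thesis using F.submoduleE(1)[OF A] by auto
qed

text \<open>Induction on the rank. Clearing the last coordinate turns a vector of rank
  \<open>Suc n\<close> into one of rank n without a change of type, so the map for n applies and the
  multiple of \<open>p n\<close> is added.\<close>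

lemma free_module_hom_exists:
  assumes P: "module R P" and p: "\<And>j. j < n \<Longrightarrow> p j \<in> carrier P"
  shows "\<exists>f. module_hom R (free_module R n) P f \<and> (\<forall>j<n. f (free_unit R j) = p j)"
  using p
proof (induction n)
  case 0
  interpret module R P by fact
  show ?case by (intro exI[of _ "\<lambda>_. \<zero>\<^bsub>P\<^esub>"]) (auto simp: module_hom_def)
next
  case (Suc n)
  interpret P: module R P by fact
  have pn: "p n \<in> carrier P" using Suc.prems by simp
  obtain f where f: "module_hom R (free_module R n) P f" "\<forall>j<n. f (free_unit R j) = p j"
    using Suc by (meson less_SucI)
  let ?t = "\<lambda>v. v(n := \<zero>\<^bsub>R\<^esub>)"
  let ?g = "\<lambda>v. f (?t v) \<oplus>\<^bsub>P\<^esub> v n \<odot>\<^bsub>P\<^esub> p n"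
  have t: "?t v \<in> carrier (free_module R n)" if "v \<in> carrier (free_module R (Suc n))" for v
    using that by (auto simp: Suc_le_eq nat_less_le)
  have fc: "f (?t v) \<in> carrier P" if "v \<in> carrier (free_module R (Suc n))" for v
    using t[OF that] module_hom_closed[OF f(1)] by blast
  have "module_hom R (free_module R (Suc n)) P ?g"
  proof (rule module_homI)
    fix v w assume vw: "v \<in> carrier (free_module R (Suc n))" "w \<in> carrier (free_module R (Suc n))"
    have "?t (v \<oplus>\<^bsub>free_module R (Suc n)\<^esub> w) = ?t v \<oplus>\<^bsub>free_module R n\<^esub> ?t w" by (auto simp: fun_eq_iff)
    then have "f (?t (v \<oplus>\<^bsub>free_module R (Suc n)\<^esub> w)) = f (?t v) \<oplus>\<^bsub>P\<^esub> f (?t w)"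
      using module_hom_add[OF f(1) t[OF vw(1)] t[OF vw(2)]] by simp
    then show "?g (v \<oplus>\<^bsub>free_module R (Suc n)\<^esub> w) = ?g v \<oplus>\<^bsub>P\<^esub> ?g w"
      using fc[OF vw(1)] fc[OF vw(2)] vw pn by (simp add: P.smult_l_distr P.M.a_ac)
  next
    fix a v assume vw: "a \<in> carrier R" "v \<in> carrier (free_module R (Suc n))"
    have "?t (a \<odot>\<^bsub>free_module R (Suc n)\<^esub> v) = a \<odot>\<^bsub>free_module R n\<^esub> ?t v"
      using vw by (auto simp: fun_eq_iff)
    then have "f (?t (a \<odot>\<^bsub>free_module R (Suc n)\<^esub> v)) = a \<odot>\<^bsub>P\<^esub> f (?t v)"
      using module_hom_smult[OF f(1) vw(1) t[OF vw(2)]] by simp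
    then show "?g (a \<odot>\<^bsub>free_module R (Suc n)\<^esub> v) = a \<odot>\<^bsub>P\<^esub> ?g v"
      using fc[OF vw(2)] vw pn by (simp add: P.smult_r_distr P.smult_assoc1)
  qed (use fc pn in auto)
  moreover have "?g (free_unit R j) = p j" if "j < Suc n" for j
  proof (cases "j = n")
    case True
    then have "?t (free_unit R j) = \<zero>\<^bsub>free_module R n\<^esub>" by (auto simp: free_unit_def fun_eq_iff)
    then show ?thesis
      using True pn module_hom_zero[OF module_free_module P f(1)] P.cring_axioms
      by (simp add: free_unit_def)
  next
    case False
    then have "?t (free_unit R j) = free_unit R j" "j < n"
      using that by (auto simp: free_unit_def fun_eq_iff)
    then show ?thesis using f(2) pn Suc.prems[of j] False by (auto simp: free_unit_def)
  qed
  ultimately show ?case by blast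
qed

text \<open>Projectivity in relational form: Q is a linear relation that is total on the free
  module. Values chosen on the basis extend linearly, and linearity of Q carries the relation to all
  vectors. Null homotopies, lifted cocycles and the lifted augmentation all arise this way.\<close>

lemma free_module_hom_choice:
  assumes P: "module R P"
    and ex: "\<And>v. v \<in> carrier (free_module R n) \<Longrightarrow> \<exists>p\<in>carrier P. Q v p"
    and add: "\<And>v w p q. \<lbrakk>v \<in> carrier (free_module R n); w \<in> carrier (free_module R n);
      p \<in> carrier P; q \<in> carrier P; Q v p; Q w q\<rbrakk> \<Longrightarrow> Q (v \<oplus>\<^bsub>free_module R n\<^esub> w) (p \<oplus>\<^bsub>P\<^esub> q)"
    and smult: "\<And>a v p. \<lbrakk>a \<in> carrier R; v \<in> carrier (free_module R n); p \<in> carrier P; Q v p\<rbrakk>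
      \<Longrightarrow> Q (a \<odot>\<^bsub>free_module R n\<^esub> v) (a \<odot>\<^bsub>P\<^esub> p)"
  shows "\<exists>f. module_hom R (free_module R n) P f \<and> (\<forall>v\<in>carrier (free_module R n). Q v (f v))"
proof -
  interpret P: module R P by fact
  interpret F: module R "free_module R n" by (rule module_free_module) (rule P.cring_axioms)
  note unit = free_unit_closed[OF P.cring_axioms, of _ n]
  have "\<forall>j. \<exists>p. j < n \<longrightarrow> p \<in> carrier P \<and> Q (free_unit R j) p"
    using ex[OF unit] by blast
  then obtain p where p: "\<And>j. j < n \<Longrightarrow> p j \<in> carrier P \<and> Q (free_unit R j) (p j)"
    by metis
  obtain f where f: "module_hom R (free_module R n) P f" "\<And>j. j < n \<Longrightarrow> f (free_unit R j) = p j"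
    using free_module_hom_exists[OF P, of n p] p by blast
  note fc = module_hom_closed[OF f(1)]
  let ?A = "{v \<in> carrier (free_module R n). Q v (f v)}"
  have "?A = carrier (free_module R n)"
  proof (rule free_module_induct[OF P.cring_axioms])
    show "submodule ?A R (free_module R n)"
    proof (rule F.submoduleI')
      \<comment> \<open>Totality supplies some q related to the zero vector; scaling by zero makes
        the pair (0, 0) related.\<close>
      obtain q where q: "q \<in> carrier P" "Q \<zero>\<^bsub>free_module R n\<^esub> q" using ex[of "\<zero>\<^bsub>free_module R n\<^esub>"] by auto
      have "\<zero>\<^bsub>R\<^esub> \<odot>\<^bsub>free_module R n\<^esub> \<zero>\<^bsub>free_module R n\<^esub> = \<zero>\<^bsub>free_module R n\<^esub>"
        by (auto simp: fun_eq_iff)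
      then have "Q \<zero>\<^bsub>free_module R n\<^esub> \<zero>\<^bsub>P\<^esub>"
        using smult[of "\<zero>\<^bsub>R\<^esub>" "\<zero>\<^bsub>free_module R n\<^esub>" q] q by auto
      then show "\<zero>\<^bsub>free_module R n\<^esub> \<in> ?A"
        using module_hom_zero[OF F.module_axioms P f(1)] by auto
    next
      fix v w assume "v \<in> ?A" "w \<in> ?A"
      then show "v \<oplus>\<^bsub>free_module R n\<^esub> w \<in> ?A"
        using add[of v w "f v" "f w"] fc module_hom_add[OF f(1), of v w] F.M.a_closed[of v w]
        by (auto simp del: free_module_simps)
    next
      fix a v assume "a \<in> carrier R" "v \<in> ?A"
      then show "a \<odot>\<^bsub>free_module R n\<^esub> v \<in> ?A"
        using smult[of a v "f v"] fc module_hom_smult[OF f(1), of a v] F.smult_closed[of a v]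
        by (auto simp del: free_module_simps)
    qed auto
    show "free_unit R j \<in> ?A" if "j < n" for j
      using unit p f(2) that by (auto simp del: free_module_simps)
  qed
  then show ?thesis using f(1) by blast
qed

end

section \<open>Length\<close>

subsection \<open>Chains of sets\<close>

text \<open>Module length has this shape for submodules and Krull dimension for primes; the
  comparison lemmas are proved once, for arbitrary families.\<close>

definition chain_len :: "'x set set \<Rightarrow> enat" where
  "chain_len \<S> = Sup {enat n | n. \<exists>C. (\<forall>i\<le>n. C i \<in> \<S>) \<and> (\<forall>i<n. C i \<subset> C (Suc i))}"

lemma module_length_eq: "module_length R M = chain_len {N. submodule N R M}"
  by (simp add: module_length_def chain_len_def)

text \<open>A supremum that is at least n = m + 1 exceeds m, so some chain is longer than m and an
  initial segment of it has length n. Nonemptiness provides the chain of length 0.\<close>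

lemma enat_le_chain_len:
  assumes "\<S> \<noteq> {}"
  shows "enat n \<le> chain_len \<S> \<longleftrightarrow> (\<exists>C. (\<forall>i\<le>n. C i \<in> \<S>) \<and> (\<forall>i<n. C i \<subset> C (Suc i)))"
proof
  assume n: "enat n \<le> chain_len \<S>"
  show "\<exists>C. (\<forall>i\<le>n. C i \<in> \<S>) \<and> (\<forall>i<n. C i \<subset> C (Suc i))"
  proof (cases n)
    case 0
    then show ?thesis using assms by (intro exI[of _ "\<lambda>_. SOME A. A \<in> \<S>"]) (auto simp: some_in_eq)
  next
    case (Suc m)
    then have "enat m < chain_len \<S>" using n by (metis Suc_ile_eq)
    then obtain k C where C: "enat m < enat k" "\<forall>i\<le>k. C i \<in> \<S>" "\<forall>i<k. C i \<subset> C (Suc i)"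
      unfolding chain_len_def less_Sup_iff by blast
    then show ?thesis using Suc by (intro exI[of _ C]) auto
  qed
qed (auto simp: chain_len_def intro!: Sup_upper)

lemma chain_len_mono:
  assumes "\<And>A. A \<in> \<S> \<Longrightarrow> \<Phi> A \<in> \<T>"
    and "\<And>A B. \<lbrakk>A \<in> \<S>; B \<in> \<S>; A \<subset> B\<rbrakk> \<Longrightarrow> \<Phi> A \<subset> \<Phi> B"
  shows "chain_len \<S> \<le> chain_len \<T>"
  unfolding chain_len_def
proof (rule Sup_subset_mono, safe)
  fix n C assume "\<forall>i\<le>n. C i \<in> \<S>" "\<forall>i<n. C i \<subset> C (Suc i)"
  then show "\<exists>m. enat n = enat m \<and> (\<exists>C. (\<forall>i\<le>m. C i \<in> \<T>) \<and> (\<forall>i<m. C i \<subset> C (Suc i)))"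
    using assms by (intro exI[of _ n] conjI exI[of _ "\<lambda>i. \<Phi> (C i)"]) (auto simp del: psubset_eq)
qed

text \<open>The length of a chain is at most the number of its strict steps under \<open>p\<close> plus those under \<open>q\<close>.\<close>

lemma chain_len_add:
  fixes \<C> :: "'x set set" and \<A> :: "'y set set" and \<B> :: "'z set set"
  assumes ne: "\<A> \<noteq> {}" "\<B> \<noteq> {}"
    and p: "\<And>C. C \<in> \<C> \<Longrightarrow> p C \<in> \<A>" and q: "\<And>C. C \<in> \<C> \<Longrightarrow> q C \<in> \<B>"
    and mono: "\<And>C D. \<lbrakk>C \<in> \<C>; D \<in> \<C>; C \<subset> D\<rbrakk> \<Longrightarrow> p C \<subseteq> p D \<and> q C \<subseteq> q D \<and> (p C \<noteq> p D \<or> q C \<noteq> q D)"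
    and J: "\<And>A B. \<lbrakk>A \<in> \<A>; B \<in> \<B>\<rbrakk> \<Longrightarrow> J A B \<in> \<C>"
    and J1: "\<And>A A' B. \<lbrakk>A \<in> \<A>; A' \<in> \<A>; B \<in> \<B>; A \<subset> A'\<rbrakk> \<Longrightarrow> J A B \<subset> J A' B"
    and J2: "\<And>A B B'. \<lbrakk>A \<in> \<A>; B \<in> \<B>; B' \<in> \<B>; B \<subset> B'\<rbrakk> \<Longrightarrow> J A B \<subset> J A B'"
  shows "chain_len \<C> = chain_len \<A> + chain_len \<B>"
proof (rule antisym)
  \<comment> \<open>The top of the chain is recorded, since a chain is prolonged by comparing the
    next set with its top.\<close>
  define ch :: "'y set \<Rightarrow> nat \<Rightarrow> bool" where
    "ch X n \<longleftrightarrow> (\<exists>C. (\<forall>i\<le>n. C i \<in> \<A>) \<and> (\<forall>i<n. C i \<subset> C (Suc i)) \<and> C n = X)" for X n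
  define dh :: "'z set \<Rightarrow> nat \<Rightarrow> bool" where
    "dh X n \<longleftrightarrow> (\<exists>C. (\<forall>i\<le>n. C i \<in> \<B>) \<and> (\<forall>i<n. C i \<subset> C (Suc i)) \<and> C n = X)" for X n
  have ch_Suc: "ch Y (Suc n)" if XY: "ch X n" "X \<subset> Y" "Y \<in> \<A>" for X Y n
  proof -
    obtain C where "\<forall>i\<le>n. C i \<in> \<A>" "\<forall>i<n. C i \<subset> C (Suc i)" "C n = X"
      using XY unfolding ch_def by blast
    then show ?thesis unfolding ch_def using XY
      by (intro exI[of _ "C(Suc n := Y)"]) (auto simp: le_Suc_eq less_Suc_eq simp del: psubset_eq)
  qed
  have dh_Suc: "dh Y (Suc n)" if XY: "dh X n" "X \<subset> Y" "Y \<in> \<B>" for X Y n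
  proof -
    obtain C where "\<forall>i\<le>n. C i \<in> \<B>" "\<forall>i<n. C i \<subset> C (Suc i)" "C n = X"
      using XY unfolding dh_def by blast
    then show ?thesis unfolding dh_def using XY
      by (intro exI[of _ "C(Suc n := Y)"]) (auto simp: le_Suc_eq less_Suc_eq simp del: psubset_eq)
  qed
  \<comment> \<open>Each strict step of C is strict under p or under q, so at least one of the
    counters a and b increases.\<close>
  have key: "\<exists>a b. n \<le> a + b \<and> ch (p (C n)) a \<and> dh (q (C n)) b"
    if "\<forall>i\<le>n. C i \<in> \<C>" "\<forall>i<n. C i \<subset> C (Suc i)" for n C
    using that
  proof (induction n)
    case 0
    then have "ch (p (C 0)) 0" "dh (q (C 0)) 0"
      unfolding ch_def dh_def using p q by (auto intro: exI[of _ "\<lambda>_. p (C 0)"] exI[of _ "\<lambda>_. q (C 0)"])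
    then show ?case by blast
  next
    case (Suc n)
    then obtain a b where ab: "n \<le> a + b" "ch (p (C n)) a" "dh (q (C n)) b" by force
    have C: "C n \<in> \<C>" "C (Suc n) \<in> \<C>" "C n \<subset> C (Suc n)" using Suc.prems by auto
    show ?case
    proof (cases "p (C n) = p (C (Suc n))")
      case True
      then have "q (C n) \<subset> q (C (Suc n))" using mono[OF C] by blast
      then have "dh (q (C (Suc n))) (Suc b)" using dh_Suc ab q C by blast
      then show ?thesis using ab True by (intro exI[of _ a] exI[of _ "Suc b"]) auto
    next
      case False
      then have "p (C n) \<subset> p (C (Suc n))" using mono[OF C] by blast
      then have c: "ch (p (C (Suc n))) (Suc a)" using ch_Suc ab p C by blast
      show ?thesis
      proof (cases "q (C n) = q (C (Suc n))")
        case True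
        then show ?thesis using ab c by (intro exI[of _ "Suc a"] exI[of _ b]) auto
      next
        case False
        then have "q (C n) \<subset> q (C (Suc n))" using mono[OF C] by blast
        then have "dh (q (C (Suc n))) (Suc b)" using dh_Suc ab q C by blast
        then show ?thesis using ab c by (intro exI[of _ "Suc a"] exI[of _ "Suc b"]) auto
      qed
    qed
  qed
  show "chain_len \<C> \<le> chain_len \<A> + chain_len \<B>"
    unfolding chain_len_def[of \<C>]
  proof (rule Sup_least, safe)
    fix n C assume "\<forall>i\<le>n. C i \<in> \<C>" "\<forall>i<n. C i \<subset> C (Suc i)"
    from key[OF this] obtain a b where ab: "n \<le> a + b" "ch (p (C n)) a" "dh (q (C n)) b" by blast
    have "enat a \<le> chain_len \<A>" "enat b \<le> chain_len \<B>"
      using ab unfolding enat_le_chain_len[OF ne(1)] enat_le_chain_len[OF ne(2)] ch_def dh_def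
      by blast+
    then have "enat (a + b) \<le> chain_len \<A> + chain_len \<B>"
      unfolding plus_enat_simps(1)[symmetric] by (rule add_mono)
    then show "enat n \<le> chain_len \<A> + chain_len \<B>" using ab(1) by (meson enat_ord_simps(1) order_trans)
  qed
  \<comment> \<open>The chains are run one after the other: A rises while B rests at its bottom, and
    afterwards B rises while A rests at its top.\<close>
  have join: "enat (a + b) \<le> chain_len \<C>" if le: "enat a \<le> chain_len \<A>" "enat b \<le> chain_len \<B>" for a b
  proof -
    obtain A B where A: "\<forall>i\<le>a. A i \<in> \<A>" "\<forall>i<a. A i \<subset> A (Suc i)"
      and B: "\<forall>i\<le>b. B i \<in> \<B>" "\<forall>i<b. B i \<subset> B (Suc i)"
      using le unfolding enat_le_chain_len[OF ne(1)] enat_le_chain_len[OF ne(2)] by blast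
    define D where "D i = (if i \<le> a then J (A i) (B 0) else J (A a) (B (i - a)))" for i
    have "D i \<in> \<C>" if "i \<le> a + b" for i
      unfolding D_def using that A B J by auto
    moreover have "D i \<subset> D (Suc i)" if i: "i < a + b" for i
    proof -
      consider "i < a" | "i = a" | "i > a" by linarith
      then show ?thesis
      proof cases
        case 1
        then show ?thesis unfolding D_def using A B J1[of "A i" "A (Suc i)" "B 0"]
          by (simp del: psubset_eq)
      next
        case 2
        then show ?thesis unfolding D_def using A B i J2[of "A a" "B 0" "B 1"]
          by (simp del: psubset_eq)
      next
        case 3
        then have "Suc i - a = Suc (i - a)" by simp
        then show ?thesis unfolding D_def using A B i 3 J2[of "A a" "B (i - a)" "B (Suc (i - a))"]
          by (simp del: psubset_eq)
      qed
    qed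
    ultimately show ?thesis unfolding chain_len_def by (intro Sup_upper) blast
  qed
  show "chain_len \<A> + chain_len \<B> \<le> chain_len \<C>"
  proof (cases "chain_len \<A> = \<infinity> \<or> chain_len \<B> = \<infinity>")
    case True
    \<comment> \<open>If one length is infinite, chains of every length k exist in that family and
      are joined with a chain of length 0 in the other.\<close>
    have "enat k \<le> chain_len \<C>" for k
      using True join[of k 0] join[of 0 k] by (auto simp: zero_enat_def[symmetric])
    then have "chain_len \<C> = \<infinity>"
      by (metis Suc_n_not_le_n enat_ord_simps(1) not_infinity_eq)
    then show ?thesis by simp
  next
    case False
    then obtain a b where "chain_len \<A> = enat a" "chain_len \<B> = enat b" by auto
    then show ?thesis using join[of a b] by simp
  qed
qed

subsection \<open>Lengths of subquotients\<close>

text \<open>By the correspondence theorem this is the length of Z/B; the quotient itself, with its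
  coset-valued carrier, is avoided.\<close>

definition sub_len :: "('a, 'c) ring_scheme \<Rightarrow> ('a, 'b, 'd) module_scheme \<Rightarrow> 'b set \<Rightarrow> 'b set \<Rightarrow> enat" where
  "sub_len R M Z B = chain_len {N. submodule N R M \<and> B \<subseteq> N \<and> N \<subseteq> Z}"

text \<open>The relation \<open>Q\<close> is a linear correspondence inducing an isomorphism \<open>Z/B \<cong> Z'/B'\<close>.\<close>

lemma sub_len_le_correspondence:
  assumes M: "module R M" and M': "module R M'"
    and Z: "submodule Z R M" "submodule Z' R M'" and B: "submodule B' R M'"
    and B': "B' \<subseteq> Z'"
    and add: "\<And>x y x' y'. \<lbrakk>x \<in> Z; y \<in> Z; x' \<in> Z'; y' \<in> Z'; Q x x'; Q y y'\<rbrakk> \<Longrightarrow> Q (x \<oplus>\<^bsub>M\<^esub> y) (x' \<oplus>\<^bsub>M'\<^esub> y')"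
    and smult: "\<And>a x x'. \<lbrakk>a \<in> carrier R; x \<in> Z; x' \<in> Z'; Q x x'\<rbrakk> \<Longrightarrow> Q (a \<odot>\<^bsub>M\<^esub> x) (a \<odot>\<^bsub>M'\<^esub> x')"
    and total: "\<And>x. x \<in> Z \<Longrightarrow> \<exists>x'\<in>Z'. Q x x'"
    and surj: "\<And>x'. x' \<in> Z' \<Longrightarrow> \<exists>x\<in>Z. Q x x'"
    and iff: "\<And>x x'. \<lbrakk>x \<in> Z; x' \<in> Z'; Q x x'\<rbrakk> \<Longrightarrow> x \<in> B \<longleftrightarrow> x' \<in> B'"
  shows "sub_len R M Z B \<le> sub_len R M' Z' B'"
  unfolding sub_len_def
proof (rule chain_len_mono[where \<Phi> = "\<lambda>N. {x' \<in> Z'. \<exists>x\<in>N. Q x x'}"], goal_cases)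
  case (1 N)
  interpret M: module R M by fact
  interpret M': module R M' by fact
  from 1 have N: "submodule N R M" "B \<subseteq> N" "N \<subseteq> Z" by auto
  let ?N = "{x' \<in> Z'. \<exists>x\<in>N. Q x x'}"
  have B'N: "B' \<subseteq> ?N" using surj iff N B' by blast
  moreover have "submodule ?N R M'"
  proof (rule M'.submoduleI')
    show "?N \<subseteq> carrier M'" using M'.submoduleE(1)[OF Z(2)] by blast
    show "\<zero>\<^bsub>M'\<^esub> \<in> ?N" using B'N M'.submodule_zero[OF B] by blast
  next
    fix a b assume "a \<in> ?N" "b \<in> ?N"
    then obtain x y where xy: "a \<in> Z'" "b \<in> Z'" "x \<in> N" "y \<in> N" "Q x a" "Q y b" by blast
    then have "Q (x \<oplus>\<^bsub>M\<^esub> y) (a \<oplus>\<^bsub>M'\<^esub> b)" using add N(3) by blast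
    then show "a \<oplus>\<^bsub>M'\<^esub> b \<in> ?N"
      using xy M.submoduleE(5)[OF N(1) xy(3,4)] M'.submoduleE(5)[OF Z(2) xy(1,2)] by blast
  next
    fix r a assume r: "r \<in> carrier R" and "a \<in> ?N"
    then obtain x where xy: "a \<in> Z'" "x \<in> N" "Q x a" by blast
    then have "Q (r \<odot>\<^bsub>M\<^esub> x) (r \<odot>\<^bsub>M'\<^esub> a)" using smult N(3) r by blast
    then show "r \<odot>\<^bsub>M'\<^esub> a \<in> ?N"
      using xy M.submoduleE(4)[OF N(1) r xy(2)] M'.submoduleE(4)[OF Z(2) r xy(1)] by blast
  qed
  ultimately show ?case by blast
next
  case (2 N N')
  interpret M: module R M by fact
  interpret M': module R M' by fact
  from 2 have N: "submodule N R M" "B \<subseteq> N" "N \<subseteq> Z" "N \<subset> N'" "N' \<subseteq> Z" by auto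
  then obtain y where y: "y \<in> N'" "y \<notin> N" by blast
  then obtain y' where y': "y' \<in> Z'" "Q y y'" using N total by blast
  \<comment> \<open>If some x in N were also related to y', then y - x would be related to zero and
    lie in B; as B is inside N, y would lie in N.\<close>
  have "\<not> Q x y'" if "x \<in> N" for x
  proof
    assume Q: "Q x y'"
    have mem: "x \<in> Z" "y \<in> Z" "x \<in> carrier M" "y \<in> carrier M" "y' \<in> carrier M'"
      using that y N y' M.submoduleE(1)[OF Z(1)] M'.submoduleE(1)[OF Z(2)] by auto
    let ?u = "\<ominus>\<^bsub>R\<^esub> \<one>\<^bsub>R\<^esub>"
    have u: "?u \<in> carrier R" by simp
    have "Q (y \<oplus>\<^bsub>M\<^esub> ?u \<odot>\<^bsub>M\<^esub> x) (y' \<oplus>\<^bsub>M'\<^esub> ?u \<odot>\<^bsub>M'\<^esub> y')"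
      using add[OF mem(2) _ y'(1) _ y'(2) smult[OF u mem(1) y'(1) Q]]
        M.submoduleE(4)[OF Z(1) u mem(1)] M'.submoduleE(4)[OF Z(2) u y'(1)] by blast
    moreover have "y' \<oplus>\<^bsub>M'\<^esub> ?u \<odot>\<^bsub>M'\<^esub> y' = \<zero>\<^bsub>M'\<^esub>"
      using mem by (simp add: M'.smult_l_minus M'.M.r_neg)
    moreover have "y \<oplus>\<^bsub>M\<^esub> ?u \<odot>\<^bsub>M\<^esub> x = y \<ominus>\<^bsub>M\<^esub> x"
      using mem by (simp add: M.smult_l_minus M.M.minus_eq)
    ultimately have "Q (y \<ominus>\<^bsub>M\<^esub> x) \<zero>\<^bsub>M'\<^esub>" by simp
    then have "y \<ominus>\<^bsub>M\<^esub> x \<in> B"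
      using iff M.submodule_minus[OF Z(1) mem(2,1)] M'.submodule_zero[OF B] B' by blast
    then have "cong_mod M N y x" using N mem by (auto simp: cong_mod_def)
    then show False using M.cong_mod_mem_iff[OF N(1)] that y by blast
  qed
  then have "y' \<in> {x' \<in> Z'. \<exists>x\<in>N'. Q x x'}" "y' \<notin> {x' \<in> Z'. \<exists>x\<in>N. Q x x'}" using y y' by auto
  then show ?case using N by blast
qed

lemma sub_len_correspondence:
  assumes "module R M" "module R M'" "submodule Z R M" "submodule Z' R M'"
    and "submodule B R M" "submodule B' R M'" "B \<subseteq> Z" "B' \<subseteq> Z'"
    and "\<And>x y x' y'. \<lbrakk>x \<in> Z; y \<in> Z; x' \<in> Z'; y' \<in> Z'; Q x x'; Q y y'\<rbrakk> \<Longrightarrow> Q (x \<oplus>\<^bsub>M\<^esub> y) (x' \<oplus>\<^bsub>M'\<^esub> y')"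
    and "\<And>a x x'. \<lbrakk>a \<in> carrier R; x \<in> Z; x' \<in> Z'; Q x x'\<rbrakk> \<Longrightarrow> Q (a \<odot>\<^bsub>M\<^esub> x) (a \<odot>\<^bsub>M'\<^esub> x')"
    and "\<And>x. x \<in> Z \<Longrightarrow> \<exists>x'\<in>Z'. Q x x'"
    and "\<And>x'. x' \<in> Z' \<Longrightarrow> \<exists>x\<in>Z. Q x x'"
    and "\<And>x x'. \<lbrakk>x \<in> Z; x' \<in> Z'; Q x x'\<rbrakk> \<Longrightarrow> x \<in> B \<longleftrightarrow> x' \<in> B'"
  shows "sub_len R M Z B = sub_len R M' Z' B'"
proof (rule antisym)
  show "sub_len R M Z B \<le> sub_len R M' Z' B'"
    by (rule sub_len_le_correspondence[where Q = Q]) (use assms in auto)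
  show "sub_len R M' Z' B' \<le> sub_len R M Z B"
    by (rule sub_len_le_correspondence[where Q = "\<lambda>x y. Q y x"]) (use assms in auto)
qed

subsection \<open>Quotient modules\<close>

context module
begin

context
  fixes N assumes N: "submodule N R M"
begin

lemma abelian_subgroup_submodule: "abelian_subgroup N M"
  by (rule abelian_subgroupI3)
    (use N submodule.axioms(1) M.abelian_group_axioms in \<open>auto simp: additive_subgroup_def\<close>)

lemma mem_coset_iff:
  assumes x: "x \<in> carrier M" shows "y \<in> N +>\<^bsub>M\<^esub> x \<longleftrightarrow> cong_mod M N y x"
proof -
  interpret N: abelian_subgroup N M by (rule abelian_subgroup_submodule)
  show ?thesis
    using N.a_rcos_module[OF x, of y] N.a_elemrcos_carrier[OF x, of y] x
    by (auto simp: cong_mod_def M.minus_eq)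
qed

lemma coset_eq_iff:
  assumes "x \<in> carrier M" "y \<in> carrier M" shows "N +>\<^bsub>M\<^esub> x = N +>\<^bsub>M\<^esub> y \<longleftrightarrow> cong_mod M N x y"
proof
  show "cong_mod M N x y" if "N +>\<^bsub>M\<^esub> x = N +>\<^bsub>M\<^esub> y"
    using that mem_coset_iff assms cong_mod_refl[OF N] by metis
  show "N +>\<^bsub>M\<^esub> x = N +>\<^bsub>M\<^esub> y" if "cong_mod M N x y"
    using that mem_coset_iff assms cong_mod_trans[OF N] cong_mod_sym[OF N] by blast
qed

lemma coset_eq_submodule_iff:
  assumes "x \<in> carrier M" shows "N +>\<^bsub>M\<^esub> x = N \<longleftrightarrow> x \<in> N"
proof -
  have "N +>\<^bsub>M\<^esub> \<zero>\<^bsub>M\<^esub> = N" using submoduleE(1)[OF N] by simp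
  then show ?thesis using coset_eq_iff[OF assms M.zero_closed] cong_mod_zero_iff[OF N] by simp
qed

lemma coset_add:
  assumes "x \<in> carrier M" "y \<in> carrier M"
  shows "(N +>\<^bsub>M\<^esub> x) <+>\<^bsub>M\<^esub> (N +>\<^bsub>M\<^esub> y) = N +>\<^bsub>M\<^esub> (x \<oplus>\<^bsub>M\<^esub> y)"
proof -
  interpret N: abelian_subgroup N M by (rule abelian_subgroup_submodule)
  show ?thesis using N.a_rcos_sum assms by blast
qed

text \<open>Scaling respects congruence modulo N, so all cosets in the union coincide; the union in
  \<open>quot_module\<close> only avoids choosing a representative.\<close>

lemma coset_smult:
  assumes "a \<in> carrier R" "x \<in> carrier M"
  shows "(\<Union>y\<in>N +>\<^bsub>M\<^esub> x. N +>\<^bsub>M\<^esub> (a \<odot>\<^bsub>M\<^esub> y)) = N +>\<^bsub>M\<^esub> (a \<odot>\<^bsub>M\<^esub> x)"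
proof -
  have "N +>\<^bsub>M\<^esub> (a \<odot>\<^bsub>M\<^esub> y) = N +>\<^bsub>M\<^esub> (a \<odot>\<^bsub>M\<^esub> x)" if "y \<in> N +>\<^bsub>M\<^esub> x" for y
    using that assms cong_mod_smult[OF N]
    by (auto simp: mem_coset_iff coset_eq_iff cong_mod_closed)
  moreover have "x \<in> N +>\<^bsub>M\<^esub> x" using assms cong_mod_refl[OF N] by (simp add: mem_coset_iff)
  ultimately show ?thesis by blast
qed

lemma quot_module_simps:
  "carrier (quot_module M N) = (\<lambda>x. N +>\<^bsub>M\<^esub> x) ` carrier M"
  "\<zero>\<^bsub>quot_module M N\<^esub> = N"
  "\<lbrakk>x \<in> carrier M; y \<in> carrier M\<rbrakk> \<Longrightarrow>
    (N +>\<^bsub>M\<^esub> x) \<oplus>\<^bsub>quot_module M N\<^esub> (N +>\<^bsub>M\<^esub> y) = N +>\<^bsub>M\<^esub> (x \<oplus>\<^bsub>M\<^esub> y)"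
  "\<lbrakk>a \<in> carrier R; x \<in> carrier M\<rbrakk> \<Longrightarrow>
    a \<odot>\<^bsub>quot_module M N\<^esub> (N +>\<^bsub>M\<^esub> x) = N +>\<^bsub>M\<^esub> (a \<odot>\<^bsub>M\<^esub> x)"
  using coset_add coset_smult by (auto simp: quot_module_def A_RCOSETS_def' a_r_coset_def')

lemma module_quot_module: "module R (quot_module M N)"
proof (rule moduleI)
  note q = quot_module_simps
  have zero: "N = N +>\<^bsub>M\<^esub> \<zero>\<^bsub>M\<^esub>" using submoduleE(1)[OF N] by simp
  show "abelian_group (quot_module M N)"
  proof (rule abelian_groupI, goal_cases)
    case 2 then show ?case using q(1) zero by (auto simp: q(2))
  next
    case (5 x)
    then obtain u where u: "u \<in> carrier M" "x = N +>\<^bsub>M\<^esub> u" by (auto simp: q(1))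
    have "(N +>\<^bsub>M\<^esub> \<zero>\<^bsub>M\<^esub>) \<oplus>\<^bsub>quot_module M N\<^esub> x = x"
      using u q(3)[of "\<zero>\<^bsub>M\<^esub>" u] by simp
    then show ?case by (simp add: q(2) flip: zero)
  next
    case (6 x)
    then obtain u where u: "u \<in> carrier M" "x = N +>\<^bsub>M\<^esub> u" by (auto simp: q(1))
    then have "(N +>\<^bsub>M\<^esub> (\<ominus>\<^bsub>M\<^esub> u)) \<oplus>\<^bsub>quot_module M N\<^esub> x = N +>\<^bsub>M\<^esub> \<zero>\<^bsub>M\<^esub>"
      by (simp add: q(3) M.l_neg)
    then show ?case using u by (auto simp: q(1,2) simp flip: zero)
  qed (auto simp: q M.a_ac)
qed (auto simp: quot_module_simps R.cring_axioms smult_l_distr smult_r_distr smult_assoc1)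

lemma quot_module_hom: "module_hom R M (quot_module M N) (\<lambda>x. N +>\<^bsub>M\<^esub> x)"
  by (rule module_homI) (auto simp: quot_module_simps)

lemma nonzerodivisor_on_quot_module:
  "a \<in> carrier R \<Longrightarrow> nonzerodivisor_on (quot_module M N) a \<longleftrightarrow> nzd_mod M N a"
  unfolding nonzerodivisor_on_def nzd_mod_def
  by (auto simp: quot_module_simps coset_eq_submodule_iff)

text \<open>Preimages and images under the projection are strictly monotone between the submodules
  of M/N and those of M containing N. Strictness of images uses that a submodule containing N is a
  union of cosets.\<close>

lemma module_length_quot_module:
  "module_length R (quot_module M N) = chain_len {C. submodule C R M \<and> N \<subseteq> C}"
  unfolding module_length_eq
proof (rule antisym)
  let ?q = "\<lambda>x. N +>\<^bsub>M\<^esub> x"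
  note hom = module_axioms module_quot_module quot_module_hom
  interpret Q: module R "quot_module M N" by (rule module_quot_module)
  show "chain_len {C. submodule C R (quot_module M N)} \<le> chain_len {C. submodule C R M \<and> N \<subseteq> C}"
  proof (rule chain_len_mono[where \<Phi> = "\<lambda>C. {x \<in> carrier M. ?q x \<in> C}"], goal_cases)
    case (1 C)
    then have C: "submodule C R (quot_module M N)" by simp
    have "N \<subseteq> {x \<in> carrier M. ?q x \<in> C}"
    proof
      fix x assume x: "x \<in> N"
      then have "x \<in> carrier M" using submoduleE(1)[OF N] by blast
      then show "x \<in> {x \<in> carrier M. ?q x \<in> C}"
        using coset_eq_submodule_iff[of x] x Q.submodule_zero[OF C] by (simp add: quot_module_simps)
    qed
    then show ?case using module_hom_vimage[OF hom C] by simp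
  next
    case (2 C D)
    then obtain X where X: "X \<in> D" "X \<notin> C" by blast
    then have "X \<in> carrier (quot_module M N)" using 2 Q.submoduleE(1)[of D] by blast
    then obtain x where "x \<in> carrier M" "X = ?q x" by (auto simp: quot_module_simps(1))
    then show ?case using X 2 by blast
  qed
  show "chain_len {C. submodule C R M \<and> N \<subseteq> C} \<le> chain_len {C. submodule C R (quot_module M N)}"
  proof (rule chain_len_mono[where \<Phi> = "\<lambda>C. ?q ` C"], goal_cases)
    case (1 C)
    then show ?case using module_hom_image[OF hom] by blast
  next
    case (2 C D)
    then have C: "submodule C R M" "N \<subseteq> C" and D: "submodule D R M" "C \<subset> D" by auto
    then obtain x where x: "x \<in> D" "x \<notin> C" by blast
    have "?q x \<notin> ?q ` C"
    proof
      assume "?q x \<in> ?q ` C"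
      then obtain y where y: "y \<in> C" "?q x = ?q y" by blast
      then have "cong_mod M N x y"
        using coset_eq_iff[of x y] submoduleE(1)[OF C(1)] submoduleE(1)[OF D(1)] x by blast
      then show False
        using cong_mod_mem_iff[OF C(1) cong_mod_mono[OF _ C(2)]] x y by blast
    qed
    then show ?case using x D by blast
  qed
qed

end

lemma submodule_restrict_iff:
  assumes Z: "submodule Z R M"
  shows "submodule C R (M\<lparr>carrier := Z\<rparr>) \<longleftrightarrow> submodule C R M \<and> C \<subseteq> Z"
proof -
  interpret Z: module R "M\<lparr>carrier := Z\<rparr>"
    by (rule submodule.submodule_is_module) (fact Z, rule module_axioms)
  show ?thesis
  proof
    assume C: "submodule C R (M\<lparr>carrier := Z\<rparr>)"
    have "submodule C R M"
      by (rule submoduleI')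
        (use Z.submoduleE[OF C] Z.submodule_zero[OF C] submoduleE(1)[OF Z] in auto)
    then show "submodule C R M \<and> C \<subseteq> Z" using Z.submoduleE(1)[OF C] by simp
  next
    assume "submodule C R M \<and> C \<subseteq> Z"
    then have C: "submodule C R M" "C \<subseteq> Z" by auto
    show "submodule C R (M\<lparr>carrier := Z\<rparr>)"
      by (rule Z.submoduleI') (use C submoduleE[OF C(1)] submodule_zero[OF C(1)] in auto)
  qed
qed

text \<open>The quotient of a restricted record is the shape in which cohomology occurs in
  \<open>Ext_module\<close>; here it is replaced by intermediate submodules of the ambient
  module.\<close>

lemma module_length_subquotient:
  assumes Z: "submodule Z R M" and B: "submodule B R M" "B \<subseteq> Z"
  shows "module_length R (quot_module (M\<lparr>carrier := Z\<rparr>) B) = sub_len R M Z B"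
proof -
  interpret Z: module R "M\<lparr>carrier := Z\<rparr>"
    by (rule submodule.submodule_is_module) (fact Z, rule module_axioms)
  have "submodule B R (M\<lparr>carrier := Z\<rparr>)" using Z B by (simp add: submodule_restrict_iff)
  then show ?thesis
    unfolding sub_len_def Z.module_length_quot_module[OF \<open>submodule B R (M\<lparr>carrier := Z\<rparr>)\<close>]
    by (intro arg_cong[where f = chain_len]) (auto simp: submodule_restrict_iff[OF Z])
qed

end

subsection \<open>Modules of homomorphisms\<close>

lemma module_Hom_module:
  assumes A: "module R A" and P: "module R P"
  shows "module R (Hom_module R A P)"
proof -
  interpret A: module R A by fact
  interpret P: module R P by fact
  let ?H = "Hom_module R A P"
  have mem: "f \<in> carrier ?H \<longleftrightarrow> module_hom R A P f \<and> f \<in> extensional (carrier A)" for f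
    by (simp add: Hom_module_def)
  have cl: "f x \<in> carrier P" if "f \<in> carrier ?H" "x \<in> carrier A" for f x
    using that module_hom_closed by (auto simp: mem)
  have add: "(f \<oplus>\<^bsub>?H\<^esub> g) = (\<lambda>x\<in>carrier A. f x \<oplus>\<^bsub>P\<^esub> g x)" for f g by (simp add: Hom_module_def)
  have smult: "(a \<odot>\<^bsub>?H\<^esub> f) = (\<lambda>x\<in>carrier A. a \<odot>\<^bsub>P\<^esub> f x)" for a f by (simp add: Hom_module_def)
  have zero: "\<zero>\<^bsub>?H\<^esub> = (\<lambda>x\<in>carrier A. \<zero>\<^bsub>P\<^esub>)" by (simp add: Hom_module_def)
  have ext: "f = g" if "f \<in> carrier ?H" "g \<in> carrier ?H" "\<And>x. x \<in> carrier A \<Longrightarrow> f x = g x" for f g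
    using that by (auto simp: mem intro: extensionalityI)
  have c1: "f \<oplus>\<^bsub>?H\<^esub> g \<in> carrier ?H" if "f \<in> carrier ?H" "g \<in> carrier ?H" for f g
    unfolding mem add
    using that cl[OF that(1)] cl[OF that(2)]
    by (auto simp: mem module_hom_add module_hom_smult P.M.a_ac P.smult_r_distr
        intro!: module_homI)
  have c2: "a \<odot>\<^bsub>?H\<^esub> f \<in> carrier ?H" if "a \<in> carrier R" "f \<in> carrier ?H" for a f
    unfolding mem smult
    using that cl[OF that(2)]
    by (auto simp: mem module_hom_add module_hom_smult P.M.a_ac P.smult_r_distr
        P.smult_left_commute intro!: module_homI)
  have c0: "\<zero>\<^bsub>?H\<^esub> \<in> carrier ?H"
    unfolding mem zero by (auto intro!: module_homI)
  have restr: "x \<in> carrier A \<Longrightarrow> (f \<oplus>\<^bsub>?H\<^esub> g) x = f x \<oplus>\<^bsub>P\<^esub> g x"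
    "x \<in> carrier A \<Longrightarrow> (a \<odot>\<^bsub>?H\<^esub> f) x = a \<odot>\<^bsub>P\<^esub> f x" "x \<in> carrier A \<Longrightarrow> \<zero>\<^bsub>?H\<^esub> x = \<zero>\<^bsub>P\<^esub>" for f g a x
    by (simp_all add: add smult zero)
  show ?thesis
  proof (rule moduleI)
    show "abelian_group ?H"
    proof (rule abelian_groupI, goal_cases)
      case (3 f g h) then show ?case by (intro ext) (auto simp: c1 restr cl P.M.a_assoc)
    next
      case (4 f g) then show ?case by (intro ext) (auto simp: c1 restr cl P.M.a_comm)
    next
      case (5 f) then show ?case by (intro ext) (auto simp: c0 c1 restr cl)
    next
      case (6 f)
      have "\<ominus>\<^bsub>R\<^esub> \<one>\<^bsub>R\<^esub> \<odot>\<^bsub>?H\<^esub> f \<oplus>\<^bsub>?H\<^esub> f = \<zero>\<^bsub>?H\<^esub>"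
        using 6 c2[of "\<ominus>\<^bsub>R\<^esub> \<one>\<^bsub>R\<^esub>" f]
        by (intro ext) (auto simp: c0 c1 restr cl P.smult_l_minus P.M.l_neg)
      then show ?case using 6 c2[of "\<ominus>\<^bsub>R\<^esub> \<one>\<^bsub>R\<^esub>" f] by auto
    qed (auto intro: c0 c1)
  qed (auto intro!: ext simp: c1 c2 restr cl P.smult_l_distr P.smult_r_distr P.smult_assoc1
        A.R.cring_axioms)
qed

lemma Hom_module_simps:
  "f \<in> carrier (Hom_module R A P) \<longleftrightarrow> module_hom R A P f \<and> f \<in> extensional (carrier A)"
  "x \<in> carrier A \<Longrightarrow> (f \<oplus>\<^bsub>Hom_module R A P\<^esub> g) x = f x \<oplus>\<^bsub>P\<^esub> g x"
  "x \<in> carrier A \<Longrightarrow> (a \<odot>\<^bsub>Hom_module R A P\<^esub> f) x = a \<odot>\<^bsub>P\<^esub> f x"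
  "x \<in> carrier A \<Longrightarrow> \<zero>\<^bsub>Hom_module R A P\<^esub> x = \<zero>\<^bsub>P\<^esub>"
  by (simp_all add: Hom_module_def)

lemma Hom_module_restrict:
  assumes A: "module R A" and f: "module_hom R A P f"
  shows "restrict f (carrier A) \<in> carrier (Hom_module R A P)"
proof -
  interpret A: module R A by fact
  show ?thesis
    using f by (auto simp: Hom_module_simps module_hom_def)
qed

section \<open>Cohomology of a resolution of the residue field\<close>

text \<open>Since free modules are projective, the cocycles and coboundaries with values in \<open>P/N\<close> are
  represented by cochains with values in \<open>P\<close>.\<close>

definition cocycles_mod ::
    "('a, 'c) ring_scheme \<Rightarrow> (nat \<Rightarrow> nat) \<Rightarrow> (nat \<Rightarrow> (nat \<Rightarrow> 'a) \<Rightarrow> (nat \<Rightarrow> 'a)) \<Rightarrow>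
     ('a, 'b, 'd) module_scheme \<Rightarrow> nat \<Rightarrow> 'b set \<Rightarrow> ((nat \<Rightarrow> 'a) \<Rightarrow> 'b) set" where
  "cocycles_mod R n d P i N =
     {f \<in> carrier (ext_cochains R n P i). \<forall>v\<in>carrier (free_module R (n (Suc i))). f (d i v) \<in> N}"

definition coboundaries_mod ::
    "('a, 'c) ring_scheme \<Rightarrow> (nat \<Rightarrow> nat) \<Rightarrow> (nat \<Rightarrow> (nat \<Rightarrow> 'a) \<Rightarrow> (nat \<Rightarrow> 'a)) \<Rightarrow>
     ('a, 'b, 'd) module_scheme \<Rightarrow> nat \<Rightarrow> 'b set \<Rightarrow> ((nat \<Rightarrow> 'a) \<Rightarrow> 'b) set" where
  "coboundaries_mod R n d P i N =
     {f \<in> carrier (ext_cochains R n P i). \<exists>h\<in>ext_coboundaries R n d P i.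
        \<forall>v\<in>carrier (free_module R (n i)). cong_mod P N (f v) (h v)}"

text \<open>When the data resolve R/m, this says Ext^i(R/m, P/N) = 0 in all degrees below t; for a
  submodule N the opposite inclusion is automatic.\<close>

definition ext_vanishes ::
    "('a, 'c) ring_scheme \<Rightarrow> (nat \<Rightarrow> nat) \<Rightarrow> (nat \<Rightarrow> (nat \<Rightarrow> 'a) \<Rightarrow> (nat \<Rightarrow> 'a)) \<Rightarrow>
     ('a, 'b, 'd) module_scheme \<Rightarrow> nat \<Rightarrow> 'b set \<Rightarrow> bool" where
  "ext_vanishes R n d P t N \<longleftrightarrow> (\<forall>i<t. cocycles_mod R n d P i N \<subseteq> coboundaries_mod R n d P i N)"

text \<open>A resolution of R/m with the augmentation lifted to a map \<epsilon> into R itself: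
  exactness at index 0 becomes a condition on \<open>\<epsilon> v \<in> m\<close>, and
  \<open>v\<^sub>0\<close> lifts the class of 1. Thus no cosets occur in the cohomological
  part.\<close>

locale residue_resolution =
  fixes R :: "('a, 'c) ring_scheme" and m :: "'a set" and n :: "nat \<Rightarrow> nat"
    and d :: "nat \<Rightarrow> (nat \<Rightarrow> 'a) \<Rightarrow> nat \<Rightarrow> 'a" and \<epsilon> :: "(nat \<Rightarrow> 'a) \<Rightarrow> 'a" and v\<^sub>0 :: "nat \<Rightarrow> 'a"
  assumes R_cring: "cring R" and m_ideal: "ideal m R"
    and d_hom: "\<And>i. module_hom R (free_module R (n (Suc i))) (free_module R (n i)) (d i)"
    and d_exact: "\<And>i v. v \<in> carrier (free_module R (n (Suc i))) \<Longrightarrow>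
      d i v = \<zero>\<^bsub>free_module R (n i)\<^esub> \<longleftrightarrow> v \<in> d (Suc i) ` carrier (free_module R (n (Suc (Suc i))))"
    and eps_hom: "module_hom R (free_module R (n 0)) (reg_module R) \<epsilon>"
    and eps_exact: "\<And>v. v \<in> carrier (free_module R (n 0)) \<Longrightarrow>
      \<epsilon> v \<in> m \<longleftrightarrow> v \<in> d 0 ` carrier (free_module R (n (Suc 0)))"
    and v0_closed: "v\<^sub>0 \<in> carrier (free_module R (n 0))"
    and eps_v0: "\<one>\<^bsub>R\<^esub> \<ominus>\<^bsub>R\<^esub> \<epsilon> v\<^sub>0 \<in> m"
begin

abbreviation F :: "nat \<Rightarrow> ('a, nat \<Rightarrow> 'a) module" where "F i \<equiv> free_module R (n i)"

sublocale R: cring R by (rule R_cring)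
sublocale m: ideal m R by (rule m_ideal)

lemma module_F: "module R (F i)"
  by (rule module_free_module) (rule R_cring)

lemma d_closed [simp]: "v \<in> carrier (F (Suc i)) \<Longrightarrow> d i v \<in> carrier (F i)"
  by (rule module_hom_closed[OF d_hom])

lemma d_d: "v \<in> carrier (F (Suc (Suc i))) \<Longrightarrow> d i (d (Suc i) v) = \<zero>\<^bsub>F i\<^esub>"
  using d_exact[of "d (Suc i) v" i] by simp

lemma eps_closed [simp]: "v \<in> carrier (F 0) \<Longrightarrow> \<epsilon> v \<in> carrier R"
  using module_hom_closed[OF eps_hom] by simp

text \<open>Multiplication by x is zero on R/m, so as a chain map of the resolution it is homotopic
  to zero; s is the homotopy. This is what makes x annihilate Ext(R/m, -).\<close>

lemma null_homotopy:
  assumes x: "x \<in> m"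
  obtains s where "\<And>i. module_hom R (F i) (F (Suc i)) (s i)"
    and "\<And>v. v \<in> carrier (F 0) \<Longrightarrow> d 0 (s 0 v) = x \<odot>\<^bsub>F 0\<^esub> v"
    and "\<And>i v. v \<in> carrier (F (Suc i)) \<Longrightarrow>
      d (Suc i) (s (Suc i) v) \<oplus>\<^bsub>F (Suc i)\<^esub> s i (d i v) = x \<odot>\<^bsub>F (Suc i)\<^esub> v"
proof -
  have xR: "x \<in> carrier R" using x m.a_subset by blast
  \<comment> \<open>The last clause of P is what the next step consumes: it makes xv - s(dv) a
    cycle, hence a boundary. It is reproduced from the homotopy identity Q because d d = 0.\<close>
  define P where "P i s \<longleftrightarrow> module_hom R (F i) (F (Suc i)) s \<and>
    (i = 0 \<longrightarrow> (\<forall>v\<in>carrier (F 0). d 0 (s v) = x \<odot>\<^bsub>F 0\<^esub> v)) \<and>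
    (\<forall>v\<in>carrier (F (Suc i)). d i (s (d i v)) = x \<odot>\<^bsub>F i\<^esub> d i v)" for i s
  define Q where "Q i s s' \<longleftrightarrow> (\<forall>v\<in>carrier (F (Suc i)).
    d (Suc i) (s' v) \<oplus>\<^bsub>F (Suc i)\<^esub> s (d i v) = x \<odot>\<^bsub>F (Suc i)\<^esub> v)" for i s s'
  have "\<exists>s. \<forall>i. P i (s i) \<and> Q i (s i) (s (Suc i))"
  proof (rule dependent_nat_choice)
    interpret F0: module R "F 0" by (rule module_F)
    interpret F1: module R "F (Suc 0)" by (rule module_F)
    have "\<exists>s. module_hom R (F 0) (F (Suc 0)) s \<and> (\<forall>v\<in>carrier (F 0). d 0 (s v) = x \<odot>\<^bsub>F 0\<^esub> v)"
    proof (rule free_module_hom_choice, rule module_F, goal_cases)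
      case (1 v)
      have "\<epsilon> (x \<odot>\<^bsub>F 0\<^esub> v) \<in> m"
        using module_hom_smult[OF eps_hom xR 1] 1 x by (simp add: m.I_r_closed)
      then have "x \<odot>\<^bsub>F 0\<^esub> v \<in> d 0 ` carrier (F (Suc 0))"
        using eps_exact[of "x \<odot>\<^bsub>F 0\<^esub> v"] xR 1 F0.smult_closed by simp
      then show ?case by force
    next
      case (2 v w p q)
      then show ?case using xR by (simp add: module_hom_add[OF d_hom] F0.smult_r_distr)
    next
      case (3 a v p)
      then show ?case using xR by (simp add: module_hom_smult[OF d_hom] F0.smult_left_commute)
    qed
    then show "\<exists>s. P 0 s" unfolding P_def using d_closed by auto
  next
    fix s i assume P: "P i s"
    interpret F0: module R "F i" by (rule module_F)
    interpret F1: module R "F (Suc i)" by (rule module_F)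
    interpret F2: module R "F (Suc (Suc i))" by (rule module_F)
    have s: "module_hom R (F i) (F (Suc i)) s" using P unfolding P_def by blast
    have sc: "s v \<in> carrier (F (Suc i))" if "v \<in> carrier (F i)" for v
      using module_hom_closed[OF s that] .
    have "\<exists>s'. module_hom R (F (Suc i)) (F (Suc (Suc i))) s' \<and> (\<forall>v\<in>carrier (F (Suc i)).
      d (Suc i) (s' v) \<oplus>\<^bsub>F (Suc i)\<^esub> s (d i v) = x \<odot>\<^bsub>F (Suc i)\<^esub> v)"
    proof (rule free_module_hom_choice, rule module_F, goal_cases)
      case (1 v)
      let ?w = "x \<odot>\<^bsub>F (Suc i)\<^esub> v \<ominus>\<^bsub>F (Suc i)\<^esub> s (d i v)"
      have w: "?w \<in> carrier (F (Suc i))" using 1 xR sc by simp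
      have "d i ?w = d i (x \<odot>\<^bsub>F (Suc i)\<^esub> v) \<ominus>\<^bsub>F i\<^esub> d i (s (d i v))"
        using 1 xR sc by (intro module_hom_minus[OF module_F module_F d_hom]) auto
      also have "d i (x \<odot>\<^bsub>F (Suc i)\<^esub> v) = d i (s (d i v))"
        using P 1 module_hom_smult[OF d_hom xR 1] unfolding P_def by simp
      finally have "d i ?w = \<zero>\<^bsub>F i\<^esub>"
        using 1 sc by (simp add: F0.M.minus_eq F0.M.r_neg)
      then obtain u where u: "u \<in> carrier (F (Suc (Suc i)))" "?w = d (Suc i) u"
        using d_exact[OF w] by blast
      have "?w \<oplus>\<^bsub>F (Suc i)\<^esub> s (d i v) = x \<odot>\<^bsub>F (Suc i)\<^esub> v"
        using 1 xR sc by (simp add: F1.M.minus_eq F1.M.a_assoc F1.M.l_neg)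
      then show ?case using u by auto
    next
      case (2 v w p q)
      have "d (Suc i) (p \<oplus>\<^bsub>F (Suc (Suc i))\<^esub> q) \<oplus>\<^bsub>F (Suc i)\<^esub> s (d i (v \<oplus>\<^bsub>F (Suc i)\<^esub> w)) =
        (d (Suc i) p \<oplus>\<^bsub>F (Suc i)\<^esub> s (d i v)) \<oplus>\<^bsub>F (Suc i)\<^esub> (d (Suc i) q \<oplus>\<^bsub>F (Suc i)\<^esub> s (d i w))"
        using 2(1-4) sc
        by (simp add: module_hom_add[OF d_hom] module_hom_add[OF s] F1.M.a_ac)
      then show ?case using 2 xR by (simp add: F1.smult_r_distr)
    next
      case (3 a v p)
      have "d (Suc i) (a \<odot>\<^bsub>F (Suc (Suc i))\<^esub> p) \<oplus>\<^bsub>F (Suc i)\<^esub> s (d i (a \<odot>\<^bsub>F (Suc i)\<^esub> v)) =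
        a \<odot>\<^bsub>F (Suc i)\<^esub> (d (Suc i) p \<oplus>\<^bsub>F (Suc i)\<^esub> s (d i v))"
        using 3(1-3) sc
        by (simp add: module_hom_smult[OF d_hom] module_hom_smult[OF s] F1.smult_r_distr)
      then show ?case using 3 xR by (simp add: F1.smult_left_commute)
    qed
    then obtain s' where s': "module_hom R (F (Suc i)) (F (Suc (Suc i))) s'" "Q i s s'"
      unfolding Q_def by blast
    have "d (Suc i) (s' (d (Suc i) v)) = x \<odot>\<^bsub>F (Suc i)\<^esub> d (Suc i) v"
      if v: "v \<in> carrier (F (Suc (Suc i)))" for v
    proof -
      have dv: "d (Suc i) v \<in> carrier (F (Suc i))" using v by simp
      have "s (d i (d (Suc i) v)) = \<zero>\<^bsub>F (Suc i)\<^esub>"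
        using d_d[OF v] module_hom_zero[OF module_F module_F s] by simp
      moreover have "d (Suc i) (s' (d (Suc i) v)) \<in> carrier (F (Suc i))"
        using module_hom_closed[OF s'(1) dv] by simp
      ultimately show ?thesis using s'(2) dv unfolding Q_def by force
    qed
    then show "\<exists>s'. P (Suc i) s' \<and> Q i s s'" using s' unfolding P_def by blast
  qed
  then show ?thesis using that unfolding P_def Q_def by metis
qed

section \<open>Cochains, cocycles and coboundaries with values in a module modulo a
  submodule\<close>

context
  fixes P :: "('a, 'b, 'd) module_scheme"
  assumes P: "module R P"
begin

interpretation P: module R P by (rule P)

abbreviation "H \<equiv> ext_cochains R n P"

lemma module_H: "module R (H i)"
  unfolding ext_cochains_def by (rule module_Hom_module[OF module_F P])

lemma H_mem: "f \<in> carrier (H i) \<longleftrightarrow> module_hom R (F i) P f \<and> f \<in> extensional (carrier (F i))"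
  and H_eval: "v \<in> carrier (F i) \<Longrightarrow> (f \<oplus>\<^bsub>H i\<^esub> g) v = f v \<oplus>\<^bsub>P\<^esub> g v"
    "v \<in> carrier (F i) \<Longrightarrow> (a \<odot>\<^bsub>H i\<^esub> f) v = a \<odot>\<^bsub>P\<^esub> f v"
    "v \<in> carrier (F i) \<Longrightarrow> \<zero>\<^bsub>H i\<^esub> v = \<zero>\<^bsub>P\<^esub>"
  by (simp_all add: ext_cochains_def Hom_module_simps)

lemma H_hom: "f \<in> carrier (H i) \<Longrightarrow> module_hom R (F i) P f"
  by (simp add: H_mem)

lemma H_closed: "\<lbrakk>f \<in> carrier (H i); v \<in> carrier (F i)\<rbrakk> \<Longrightarrow> f v \<in> carrier P"
  using module_hom_closed[OF H_hom] .

lemma H_zero: "f \<in> carrier (H i) \<Longrightarrow> f \<zero>\<^bsub>F i\<^esub> = \<zero>\<^bsub>P\<^esub>"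
  using module_hom_zero[OF module_F P H_hom] .

lemma H_restrict: "module_hom R (F i) P f \<Longrightarrow> restrict f (carrier (F i)) \<in> carrier (H i)"
  unfolding ext_cochains_def by (rule Hom_module_restrict[OF module_F])

lemma H_ext: "\<lbrakk>f \<in> carrier (H i); g \<in> carrier (H i); \<And>v. v \<in> carrier (F i) \<Longrightarrow> f v = g v\<rbrakk> \<Longrightarrow> f = g"
  by (auto simp: H_mem intro: extensionalityI)

lemma H_pullback:
  "g \<in> carrier (H i) \<Longrightarrow> (\<lambda>v\<in>carrier (F (Suc i)). g (d i v)) \<in> carrier (H (Suc i))"
  by (rule H_restrict) (rule module_hom_compose[OF d_hom H_hom])

lemma ext_coboundaries_submodule: "submodule (ext_coboundaries R n d P i) R (H i)"
proof -
  interpret Hi: module R "H i" by (rule module_H)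
  show ?thesis
  proof (cases i)
    case 0
    then show ?thesis using Hi.zero_submodule by simp
  next
    case (Suc j)
    interpret Hj: module R "H j" by (rule module_H)
    interpret Fi: module R "F i" by (rule module_F)
    have "module_hom R (H j) (H i) (ext_diff R n d j)"
      unfolding Suc ext_diff_def
      by (rule module_homI)
        (auto intro!: H_ext[of _ "Suc j"] H_pullback Hi.M.a_closed[unfolded Suc]
          Hi.smult_closed[unfolded Suc] simp: H_eval)
    from module_hom_image[OF module_H module_H this Hj.carrier_is_submodule]
    show ?thesis using Suc by simp
  qed
qed

lemma ext_coboundaries_closed: "h \<in> ext_coboundaries R n d P i \<Longrightarrow> h \<in> carrier (H i)"
  using module.submoduleE(1)[OF module_H ext_coboundaries_submodule] by blast

lemma ext_coboundaries_d:
  assumes "h \<in> ext_coboundaries R n d P i" "v \<in> carrier (F (Suc i))"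
  shows "h (d i v) = \<zero>\<^bsub>P\<^esub>"
proof (cases i)
  case 0
  then show ?thesis using assms d_closed H_eval(3) by simp
next
  case (Suc j)
  then obtain g where "g \<in> carrier (H j)" "h = (\<lambda>v\<in>carrier (F (Suc j)). g (d j v))"
    using assms by (auto simp: ext_diff_def)
  then show ?thesis using assms Suc by (simp add: d_d H_zero)
qed

lemma cocycles_mod_mem:
  "f \<in> cocycles_mod R n d P i N \<longleftrightarrow>
    f \<in> carrier (H i) \<and> (\<forall>v\<in>carrier (F (Suc i)). f (d i v) \<in> N)"
  by (simp add: cocycles_mod_def)

lemma coboundaries_mod_mem:
  "f \<in> coboundaries_mod R n d P i N \<longleftrightarrow> f \<in> carrier (H i) \<and>
    (\<exists>h\<in>ext_coboundaries R n d P i. \<forall>v\<in>carrier (F i). cong_mod P N (f v) (h v))"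
  by (simp add: coboundaries_mod_def)

lemma cocycles_mod_submodule:
  assumes N: "submodule N R P" shows "submodule (cocycles_mod R n d P i N) R (H i)"
proof -
  interpret Hi: module R "H i" by (rule module_H)
  show ?thesis
    by (rule Hi.submoduleI')
      (auto simp: cocycles_mod_mem H_eval P.submodule_zero[OF N] intro: P.submoduleE[OF N])
qed

lemma coboundaries_mod_submodule:
  assumes N: "submodule N R P" shows "submodule (coboundaries_mod R n d P i N) R (H i)"
proof -
  interpret Hi: module R "H i" by (rule module_H)
  note E = ext_coboundaries_submodule[of i]
  show ?thesis
  proof (rule Hi.submoduleI')
    show "\<zero>\<^bsub>H i\<^esub> \<in> coboundaries_mod R n d P i N"
      unfolding coboundaries_mod_mem using Hi.submodule_zero[OF E]
      by (auto intro!: bexI[of _ "\<zero>\<^bsub>H i\<^esub>"] P.cong_mod_refl[OF N] simp: H_eval)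
  next
    fix f g assume "f \<in> coboundaries_mod R n d P i N" "g \<in> coboundaries_mod R n d P i N"
    then obtain h k where "f \<in> carrier (H i)" "g \<in> carrier (H i)"
        "h \<in> ext_coboundaries R n d P i" "k \<in> ext_coboundaries R n d P i"
        "\<forall>v\<in>carrier (F i). cong_mod P N (f v) (h v)" "\<forall>v\<in>carrier (F i). cong_mod P N (g v) (k v)"
      by (auto simp: coboundaries_mod_mem)
    then show "f \<oplus>\<^bsub>H i\<^esub> g \<in> coboundaries_mod R n d P i N"
      unfolding coboundaries_mod_mem using Hi.submoduleE(5)[OF E, of h k] P.cong_mod_add[OF N]
      by (auto intro!: bexI[of _ "h \<oplus>\<^bsub>H i\<^esub> k"] simp: H_eval)
  next
    fix a f assume a: "a \<in> carrier R" "f \<in> coboundaries_mod R n d P i N"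
    then obtain h where "f \<in> carrier (H i)" "h \<in> ext_coboundaries R n d P i"
        "\<forall>v\<in>carrier (F i). cong_mod P N (f v) (h v)"
      by (auto simp: coboundaries_mod_mem)
    then show "a \<odot>\<^bsub>H i\<^esub> f \<in> coboundaries_mod R n d P i N"
      unfolding coboundaries_mod_mem using Hi.submoduleE(4)[OF E, of a h] P.cong_mod_smult[OF N] a
      by (auto intro!: bexI[of _ "a \<odot>\<^bsub>H i\<^esub> h"] simp: H_eval)
  qed (auto simp: coboundaries_mod_mem)
qed

lemma coboundaries_mod_subset:
  assumes N: "submodule N R P" shows "coboundaries_mod R n d P i N \<subseteq> cocycles_mod R n d P i N"
proof
  fix f assume f: "f \<in> coboundaries_mod R n d P i N"
  then obtain h where h: "h \<in> ext_coboundaries R n d P i"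
    "\<forall>v\<in>carrier (F i). cong_mod P N (f v) (h v)" by (auto simp: coboundaries_mod_mem)
  have "f (d i v) \<in> N" if "v \<in> carrier (F (Suc i))" for v
    using h(2)[rule_format, of "d i v"] ext_coboundaries_d[OF h(1) that] that
      P.cong_mod_zero_iff[OF N] by simp
  then show "f \<in> cocycles_mod R n d P i N" using f by (simp add: cocycles_mod_mem coboundaries_mod_mem)
qed

subsection \<open>Dimension shifting\<close>

context
  fixes N x assumes N: "submodule N R P" and x: "x \<in> m" and nzd: "nzd_mod P N x"
begin

abbreviation "N' \<equiv> adjoin_mult P N x"

text \<open>Relational form of the connecting map Ext^i(R/m, P/N') -> Ext^(i+1)(R/m, P/N) of the
  sequence 0 -> P/N -> P/N -> P/N' -> 0 whose first map is x: f composed with d is divisible by x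
  modulo N, and g is the quotient. As a relation it involves no choice of lifts.\<close>

definition connecting :: "nat \<Rightarrow> ((nat \<Rightarrow> 'a) \<Rightarrow> 'b) \<Rightarrow> ((nat \<Rightarrow> 'a) \<Rightarrow> 'b) \<Rightarrow> bool" where
  "connecting i f g \<longleftrightarrow> (\<forall>v\<in>carrier (F (Suc i)). cong_mod P N (f (d i v)) (x \<odot>\<^bsub>P\<^esub> g v))"

lemma x_closed: "x \<in> carrier R" using x m.a_subset by blast

lemma N'_submodule: "submodule N' R P"
  by (rule P.adjoin_mult_submodule[OF N x_closed])

lemma N'_iff: "y \<in> N' \<longleftrightarrow> (\<exists>z\<in>carrier P. cong_mod P N y (x \<odot>\<^bsub>P\<^esub> z))"
  by (rule P.adjoin_mult_iff[OF N x_closed])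

text \<open>Values in N' are multiples of x modulo N; projectivity lets the quotients be chosen
  linearly in v.\<close>

lemma lift_mult:
  assumes f: "module_hom R (F i) P f" and N': "\<And>v. v \<in> carrier (F i) \<Longrightarrow> f v \<in> N'"
  obtains u where "u \<in> carrier (H i)" "\<And>v. v \<in> carrier (F i) \<Longrightarrow> cong_mod P N (f v) (x \<odot>\<^bsub>P\<^esub> u v)"
proof -
  have "\<exists>u. module_hom R (F i) P u \<and> (\<forall>v\<in>carrier (F i). cong_mod P N (f v) (x \<odot>\<^bsub>P\<^esub> u v))"
  proof (rule free_module_hom_choice[OF P], goal_cases)
    case (1 v) then show ?case using N' N'_iff by blast
  next
    case (2 v w p q)
    then show ?case using x_closed
      by (simp add: module_hom_add[OF f] P.smult_r_distr P.cong_mod_add[OF N])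
  next
    case (3 a v p)
    then show ?case using x_closed P.cong_mod_smult[OF N 3(4,1)]
      by (simp add: module_hom_smult[OF f] P.smult_left_commute)
  qed
  then obtain u where u: "module_hom R (F i) P u"
    "\<forall>v\<in>carrier (F i). cong_mod P N (f v) (x \<odot>\<^bsub>P\<^esub> u v)" by blast
  show ?thesis by (rule that[OF H_restrict[OF u(1)]]) (use u(2) in simp)
qed

text \<open>The lift g exists by projectivity. Composed with the next differential, x g becomes f d
  d = 0 modulo N, and x is cancelled as a nonzerodivisor on P/N.\<close>

lemma connecting_total:
  assumes f: "f \<in> cocycles_mod R n d P i N'"
  shows "\<exists>g\<in>cocycles_mod R n d P (Suc i) N. connecting i f g"
proof -
  have fH: "f \<in> carrier (H i)" and fN: "\<And>v. v \<in> carrier (F (Suc i)) \<Longrightarrow> f (d i v) \<in> N'"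
    using f by (auto simp: cocycles_mod_mem)
  obtain g where g: "g \<in> carrier (H (Suc i))"
    "\<And>v. v \<in> carrier (F (Suc i)) \<Longrightarrow> cong_mod P N (f (d i v)) (x \<odot>\<^bsub>P\<^esub> g v)"
    using lift_mult[OF module_hom_compose[OF d_hom H_hom[OF fH]] fN] by blast
  have "g (d (Suc i) w) \<in> N" if w: "w \<in> carrier (F (Suc (Suc i)))" for w
  proof -
    have "cong_mod P N \<zero>\<^bsub>P\<^esub> (x \<odot>\<^bsub>P\<^esub> g (d (Suc i) w))"
      using g(2)[of "d (Suc i) w"] w by (simp add: d_d H_zero[OF fH])
    then have "x \<odot>\<^bsub>P\<^esub> g (d (Suc i) w) \<in> N"
      using P.cong_mod_sym[OF N] P.cong_mod_zero_iff[OF N] by blast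
    then show ?thesis using nzd H_closed[OF g(1)] w unfolding nzd_mod_def by simp
  qed
  then show ?thesis unfolding connecting_def using g
    by (intro bexI[of _ g]) (auto simp: cocycles_mod_mem)
qed

text \<open>Since x annihilates Ext, the connecting map is onto. With the null homotopy s the
  preimage of g is g s, because x g = g d s + g s d and g d has values in N.\<close>

lemma connecting_surj:
  assumes g: "g \<in> cocycles_mod R n d P (Suc i) N"
  shows "\<exists>f\<in>cocycles_mod R n d P i N'. connecting i f g"
proof -
  obtain s where s: "\<And>i. module_hom R (F i) (F (Suc i)) (s i)"
    and s_d: "\<And>i v. v \<in> carrier (F (Suc i)) \<Longrightarrow>
      d (Suc i) (s (Suc i) v) \<oplus>\<^bsub>F (Suc i)\<^esub> s i (d i v) = x \<odot>\<^bsub>F (Suc i)\<^esub> v"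
    by (rule null_homotopy[OF x]) (rule that)
  have gH: "g \<in> carrier (H (Suc i))" and gN: "\<And>v. v \<in> carrier (F (Suc (Suc i))) \<Longrightarrow> g (d (Suc i) v) \<in> N"
    using g by (auto simp: cocycles_mod_mem)
  let ?f = "\<lambda>v\<in>carrier (F i). g (s i v)"
  have f: "?f \<in> carrier (H i)"
    by (rule H_restrict) (rule module_hom_compose[OF s H_hom[OF gH]])
  have cong: "cong_mod P N (?f (d i v)) (x \<odot>\<^bsub>P\<^esub> g v)" if v: "v \<in> carrier (F (Suc i))" for v
  proof -
    have c: "s i (d i v) \<in> carrier (F (Suc i))" "s (Suc i) v \<in> carrier (F (Suc (Suc i)))"
      using v module_hom_closed[OF s] by auto
    have "x \<odot>\<^bsub>P\<^esub> g v = g (d (Suc i) (s (Suc i) v)) \<oplus>\<^bsub>P\<^esub> g (s i (d i v))"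
      using s_d[OF v] c v by (simp add: module_hom_add[OF H_hom[OF gH], symmetric]
        module_hom_smult[OF H_hom[OF gH] x_closed, symmetric])
    moreover have "cong_mod P N (g (d (Suc i) (s (Suc i) v)) \<oplus>\<^bsub>P\<^esub> g (s i (d i v)))
      (\<zero>\<^bsub>P\<^esub> \<oplus>\<^bsub>P\<^esub> g (s i (d i v)))"
      using gN c H_closed[OF gH]
      by (intro P.cong_mod_add[OF N] P.cong_mod_refl[OF N]) (auto simp: P.cong_mod_zero_iff[OF N])
    ultimately show ?thesis using c H_closed[OF gH] v P.cong_mod_sym[OF N] by simp
  qed
  have "?f (d i v) \<in> N'" if v: "v \<in> carrier (F (Suc i))" for v
    unfolding N'_iff using cong[OF v] H_closed[OF gH v] by blast
  then show ?thesis unfolding connecting_def using f cong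
    by (intro bexI[of _ ?f]) (auto simp: cocycles_mod_mem)
qed

text \<open>Subtracting a coboundary h makes f divisible by x, say f - h = x u modulo N. Composition
  with d kills h, and cancelling x exhibits g as u d modulo N.\<close>

lemma connecting_coboundary:
  assumes g: "g \<in> carrier (H (Suc i))" and f: "f \<in> coboundaries_mod R n d P i N'"
    and fg: "connecting i f g"
  shows "g \<in> coboundaries_mod R n d P (Suc i) N"
proof -
  interpret Hi: module R "H i" by (rule module_H)
  obtain h where fH: "f \<in> carrier (H i)" and h: "h \<in> ext_coboundaries R n d P i"
    "\<And>v. v \<in> carrier (F i) \<Longrightarrow> cong_mod P N' (f v) (h v)"
    using f by (auto simp: coboundaries_mod_mem)
  have hH: "h \<in> carrier (H i)" using h(1) by (rule ext_coboundaries_closed)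
  let ?a = "\<ominus>\<^bsub>R\<^esub> \<one>\<^bsub>R\<^esub>"
  let ?k = "f \<oplus>\<^bsub>H i\<^esub> ?a \<odot>\<^bsub>H i\<^esub> h"
  have kH: "?k \<in> carrier (H i)" using fH hH by simp
  have k: "?k v = f v \<ominus>\<^bsub>P\<^esub> h v" if "v \<in> carrier (F i)" for v
    using that H_closed[OF hH that] by (simp add: H_eval P.smult_l_minus P.M.minus_eq)
  have "?k v \<in> N'" if "v \<in> carrier (F i)" for v
    using k[OF that] h(2)[OF that] unfolding cong_mod_def by simp
  then obtain u where u: "u \<in> carrier (H i)"
    "\<And>v. v \<in> carrier (F i) \<Longrightarrow> cong_mod P N (?k v) (x \<odot>\<^bsub>P\<^esub> u v)"
    using lift_mult[OF H_hom[OF kH]] by blast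
  have "cong_mod P N (g v) (u (d i v))" if v: "v \<in> carrier (F (Suc i))" for v
  proof -
    have dv: "d i v \<in> carrier (F i)" using v by simp
    have "?k (d i v) = f (d i v)"
      using k[OF dv] ext_coboundaries_d[OF h(1) v] H_closed[OF fH dv] by simp
    then have "cong_mod P N (x \<odot>\<^bsub>P\<^esub> g v) (x \<odot>\<^bsub>P\<^esub> u (d i v))"
      using u(2)[OF dv] fg v P.cong_mod_sym[OF N] P.cong_mod_trans[OF N]
      unfolding connecting_def by metis
    then show ?thesis
      using P.nzd_mod_cong[OF N x_closed nzd H_closed[OF g v] H_closed[OF u(1) dv]] by blast
  qed
  then show ?thesis unfolding coboundaries_mod_mem
    using g u(1) by (auto simp: ext_diff_def)
qed

text \<open>If g = u d modulo N, then f - x u is a cocycle modulo N, hence a coboundary by the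
  vanishing in degree i; modulo N' the term x u disappears.\<close>

lemma connecting_coboundary_conv:
  assumes f: "f \<in> cocycles_mod R n d P i N'" and g: "g \<in> coboundaries_mod R n d P (Suc i) N"
    and fg: "connecting i f g" and van: "cocycles_mod R n d P i N \<subseteq> coboundaries_mod R n d P i N"
  shows "f \<in> coboundaries_mod R n d P i N'"
proof -
  interpret Hi: module R "H i" by (rule module_H)
  have fH: "f \<in> carrier (H i)" using f by (simp add: cocycles_mod_mem)
  obtain u where u: "u \<in> carrier (H i)"
    "\<And>v. v \<in> carrier (F (Suc i)) \<Longrightarrow> cong_mod P N (g v) (u (d i v))"
    using g by (auto simp: coboundaries_mod_mem ext_diff_def)
  let ?k = "f \<oplus>\<^bsub>H i\<^esub> (\<ominus>\<^bsub>R\<^esub> x) \<odot>\<^bsub>H i\<^esub> u"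
  have kH: "?k \<in> carrier (H i)" using fH u x_closed by simp
  have k: "?k v = f v \<ominus>\<^bsub>P\<^esub> x \<odot>\<^bsub>P\<^esub> u v" if "v \<in> carrier (F i)" for v
    using that H_closed[OF u(1) that] x_closed by (simp add: H_eval P.smult_l_minus P.M.minus_eq)
  have "?k (d i v) \<in> N" if v: "v \<in> carrier (F (Suc i))" for v
  proof -
    have dv: "d i v \<in> carrier (F i)" using v by simp
    have "cong_mod P N (f (d i v)) (x \<odot>\<^bsub>P\<^esub> u (d i v))"
      using fg v P.cong_mod_smult[OF N u(2)[OF v] x_closed] P.cong_mod_trans[OF N]
      unfolding connecting_def by blast
    then show ?thesis using k[OF dv] by (simp add: cong_mod_def)
  qed
  then have "?k \<in> coboundaries_mod R n d P i N" using kH van by (auto simp: cocycles_mod_mem)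
  then obtain h where h: "h \<in> ext_coboundaries R n d P i"
    "\<And>v. v \<in> carrier (F i) \<Longrightarrow> cong_mod P N (?k v) (h v)"
    by (auto simp: coboundaries_mod_mem)
  have "cong_mod P N' (f v) (h v)" if v: "v \<in> carrier (F i)" for v
  proof -
    have c: "f v \<in> carrier P" "u v \<in> carrier P" using H_closed fH u(1) v by auto
    have "f v \<ominus>\<^bsub>P\<^esub> ?k v = x \<odot>\<^bsub>P\<^esub> u v"
      using c x_closed k[OF v] by (simp add: P.M.minus_eq P.M.minus_add P.M.r_neg1 P.M.a_assoc[symmetric] P.M.r_neg)
    then have "cong_mod P N' (f v) (?k v)"
      using c H_closed[OF kH v] P.smult_mem_adjoin_mult[OF N x_closed, of "u v"]
      by (simp add: cong_mod_def)
    moreover have "cong_mod P N' (?k v) (h v)"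
      using h(2)[OF v] P.cong_mod_mono P.adjoin_mult_superset[OF N x_closed] by blast
    ultimately show ?thesis using P.cong_mod_trans[OF N'_submodule] by blast
  qed
  then show ?thesis unfolding coboundaries_mod_mem using fH h(1) by blast
qed

text \<open>In the long exact sequence Ext^i of P/N' sits between Ext^i and Ext^(i+1) of P/N, which
  costs one degree of vanishing.\<close>

lemma ext_vanishes_adjoin:
  assumes "ext_vanishes R n d P (Suc t) N" shows "ext_vanishes R n d P t N'"
  unfolding ext_vanishes_def
proof (intro allI impI subsetI)
  fix i f assume i: "i < t" and f: "f \<in> cocycles_mod R n d P i N'"
  obtain g where "g \<in> cocycles_mod R n d P (Suc i) N" "connecting i f g"
    using connecting_total[OF f] by blast
  moreover have "cocycles_mod R n d P (Suc i) N \<subseteq> coboundaries_mod R n d P (Suc i) N"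
    "cocycles_mod R n d P i N \<subseteq> coboundaries_mod R n d P i N"
    using assms i by (simp_all add: ext_vanishes_def)
  ultimately show "f \<in> coboundaries_mod R n d P i N'"
    using connecting_coboundary_conv[OF f] by blast
qed

text \<open>In positive degree every class is hit by the connecting relation from a vanishing group.
  In degree 0 nothing precedes it; there x times a value of f is a value of f d, which lies in N,
  and x is cancelled.\<close>

lemma ext_vanishes_lift:
  assumes "ext_vanishes R n d P t N'" shows "ext_vanishes R n d P (Suc t) N"
  unfolding ext_vanishes_def
proof (intro allI impI subsetI)
  fix i f assume i: "i < Suc t" and f: "f \<in> cocycles_mod R n d P i N"
  have fH: "f \<in> carrier (H i)" using f by (simp add: cocycles_mod_mem)
  show "f \<in> coboundaries_mod R n d P i N"
  proof (cases i)
    case 0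
    obtain s where s: "\<And>i. module_hom R (F i) (F (Suc i)) (s i)"
      "\<And>v. v \<in> carrier (F 0) \<Longrightarrow> d 0 (s 0 v) = x \<odot>\<^bsub>F 0\<^esub> v"
      by (rule null_homotopy[OF x]) (rule that)
    have "f v \<in> N" if v: "v \<in> carrier (F 0)" for v
    proof -
      have "f (d 0 (s 0 v)) \<in> N"
        using f module_hom_closed[OF s(1) v] 0 by (simp add: cocycles_mod_mem)
      then have "x \<odot>\<^bsub>P\<^esub> f v \<in> N"
        using s(2)[OF v] module_hom_smult[OF H_hom[OF fH] x_closed] v 0 by simp
      then show ?thesis using nzd H_closed[OF fH] v 0 by (simp add: nzd_mod_def)
    qed
    then show ?thesis unfolding coboundaries_mod_mem using 0 fH
      by (auto simp: H_eval P.cong_mod_zero_iff[OF N])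
  next
    case (Suc j)
    obtain g where g: "g \<in> cocycles_mod R n d P j N'" "connecting j g f"
      using connecting_surj[of f j] f Suc by blast
    moreover have "cocycles_mod R n d P j N' \<subseteq> coboundaries_mod R n d P j N'"
      using assms i Suc by (simp add: ext_vanishes_def)
    ultimately show ?thesis
      using connecting_coboundary[of f j g] fH Suc by blast
  qed
qed

text \<open>Vanishing in degree t makes the connecting relation injective on classes and
  annihilation by x makes it onto, so it identifies Ext^t(R/m, P/N') with Ext^(t+1)(R/m,
  P/N).\<close>

lemma sub_len_adjoin:
  assumes van: "ext_vanishes R n d P (Suc t) N"
  shows "sub_len R (H t) (cocycles_mod R n d P t N') (coboundaries_mod R n d P t N') =
    sub_len R (H (Suc t)) (cocycles_mod R n d P (Suc t) N) (coboundaries_mod R n d P (Suc t) N)"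
proof (rule sub_len_correspondence[where Q = "connecting t"], goal_cases)
  case (9 f f' g g')
  then show ?case unfolding connecting_def
    by (auto simp: H_eval cocycles_mod_mem P.smult_r_distr x_closed H_closed P.cong_mod_add[OF N])
next
  case (10 a f g)
  have "x \<odot>\<^bsub>P\<^esub> (a \<odot>\<^bsub>P\<^esub> g v) = a \<odot>\<^bsub>P\<^esub> (x \<odot>\<^bsub>P\<^esub> g v)" if "v \<in> carrier (F (Suc t))" for v
    using 10 that by (intro P.smult_left_commute) (auto simp: x_closed H_closed cocycles_mod_mem)
  then show ?case using 10 unfolding connecting_def
    by (auto simp: H_eval P.cong_mod_smult[OF N])
next
  case (13 f g)
  then show ?case
    using connecting_coboundary[of g t f] connecting_coboundary_conv[of f t g] van
    unfolding ext_vanishes_def by (auto simp: cocycles_mod_mem)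
qed (use connecting_total connecting_surj in
  \<open>auto intro: module_H cocycles_mod_submodule coboundaries_mod_submodule P N N'_submodule
     coboundaries_mod_subset[OF N, THEN subsetD] coboundaries_mod_subset[OF N'_submodule, THEN subsetD]\<close>)

end

subsection \<open>Degree zero\<close>

context
  fixes N assumes N: "submodule N R P"
begin

text \<open>The vector v - \<epsilon>(v) \<open>v\<^sub>0\<close> has augmentation in m, so it is a
  boundary, on which a cocycle takes values in N. A cocycle in degree 0 is thus determined modulo N
  by its value at \<open>v\<^sub>0\<close>.\<close>

lemma degree_zero_value:
  assumes f: "f \<in> cocycles_mod R n d P 0 N" and v: "v \<in> carrier (F 0)"
  shows "cong_mod P N (f v) (\<epsilon> v \<odot>\<^bsub>P\<^esub> f v\<^sub>0)"
proof -
  interpret F0: module R "F 0" by (rule module_F)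
  have fH: "f \<in> carrier (H 0)" using f by (simp add: cocycles_mod_mem)
  let ?w = "v \<ominus>\<^bsub>F 0\<^esub> \<epsilon> v \<odot>\<^bsub>F 0\<^esub> v\<^sub>0"
  have c: "\<epsilon> v \<in> carrier R" "\<epsilon> v\<^sub>0 \<in> carrier R" "?w \<in> carrier (F 0)" using v v0_closed by auto
  have "\<epsilon> ?w = \<epsilon> v \<ominus>\<^bsub>reg_module R\<^esub> \<epsilon> v \<otimes>\<^bsub>R\<^esub> \<epsilon> v\<^sub>0"
    using v v0_closed
    by (subst module_hom_minus[OF module_F module_reg_module[OF R_cring] eps_hom])
       (auto simp: module_hom_smult[OF eps_hom])
  also have "\<dots> = \<epsilon> v \<otimes>\<^bsub>R\<^esub> (\<one>\<^bsub>R\<^esub> \<ominus>\<^bsub>R\<^esub> \<epsilon> v\<^sub>0)"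
    using c by (simp add: reg_module_minus R.r_distr R.minus_eq R.r_minus)
  finally have "\<epsilon> ?w \<in> m" using eps_v0 c(1) by (simp add: m.I_l_closed)
  then obtain u where u: "u \<in> carrier (F (Suc 0))" "?w = d 0 u" using eps_exact[OF c(3)] by blast
  have "f ?w = f v \<ominus>\<^bsub>P\<^esub> \<epsilon> v \<odot>\<^bsub>P\<^esub> f v\<^sub>0"
    using v v0_closed c
    by (subst module_hom_minus[OF module_F P H_hom[OF fH]])
       (auto simp: module_hom_smult[OF H_hom[OF fH]])
  moreover have "f ?w \<in> N" using f u by (simp add: cocycles_mod_mem)
  ultimately show ?thesis using H_closed[OF fH] v v0_closed c by (simp add: cong_mod_def)
qed

lemma degree_zero_coboundary_iff:
  assumes f: "f \<in> cocycles_mod R n d P 0 N"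
  shows "f \<in> coboundaries_mod R n d P 0 N \<longleftrightarrow> f v\<^sub>0 \<in> N"
proof
  have fH: "f \<in> carrier (H 0)" using f by (simp add: cocycles_mod_mem)
  show "f v\<^sub>0 \<in> N" if "f \<in> coboundaries_mod R n d P 0 N"
    using that v0_closed by (auto simp: coboundaries_mod_mem H_eval P.cong_mod_zero_iff[OF N])
  show "f \<in> coboundaries_mod R n d P 0 N" if "f v\<^sub>0 \<in> N"
  proof -
    have "f v \<in> N" if v: "v \<in> carrier (F 0)" for v
      using degree_zero_value[OF f v] P.submoduleE(4)[OF N eps_closed[OF v] \<open>f v\<^sub>0 \<in> N\<close>]
        P.cong_mod_mem_iff[OF N] by blast
    then show ?thesis using fH
      by (auto simp: coboundaries_mod_mem H_eval P.cong_mod_zero_iff[OF N])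
  qed
qed

lemma degree_zero_colon:
  assumes f: "f \<in> cocycles_mod R n d P 0 N"
  shows "f v\<^sub>0 \<in> colon_mod P N m"
proof -
  interpret F0: module R "F 0" by (rule module_F)
  have fH: "f \<in> carrier (H 0)" using f by (simp add: cocycles_mod_mem)
  have "a \<odot>\<^bsub>P\<^esub> f v\<^sub>0 \<in> N" if a: "a \<in> m" for a
  proof -
    have aR: "a \<in> carrier R" using a m.a_subset by blast
    have "\<epsilon> (a \<odot>\<^bsub>F 0\<^esub> v\<^sub>0) \<in> m"
      using a v0_closed module_hom_smult[OF eps_hom aR v0_closed] by (simp add: m.I_r_closed)
    then obtain u where "u \<in> carrier (F (Suc 0))" "a \<odot>\<^bsub>F 0\<^esub> v\<^sub>0 = d 0 u"
      using eps_exact F0.smult_closed[OF aR v0_closed] by blast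
    then have "f (a \<odot>\<^bsub>F 0\<^esub> v\<^sub>0) \<in> N" using f by (simp add: cocycles_mod_mem)
    then show ?thesis using module_hom_smult[OF H_hom[OF fH] aR v0_closed] by simp
  qed
  then show ?thesis using H_closed[OF fH v0_closed] by (simp add: colon_mod_def)
qed

text \<open>The cocycle attached to p sends v to \<epsilon>(v) p: boundaries have augmentation in m,
  and m scales p into N.\<close>

lemma degree_zero_surj:
  assumes p: "p \<in> colon_mod P N m"
  obtains f where "f \<in> cocycles_mod R n d P 0 N" "cong_mod P N (f v\<^sub>0) p"
proof
  let ?f = "\<lambda>v\<in>carrier (F 0). \<epsilon> v \<odot>\<^bsub>P\<^esub> p"
  have pP: "p \<in> carrier P" and mp: "\<And>a. a \<in> m \<Longrightarrow> a \<odot>\<^bsub>P\<^esub> p \<in> N" using p by (auto simp: colon_mod_def)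
  have "?f \<in> carrier (H 0)"
    by (intro H_restrict module_homI)
       (use pP in \<open>auto simp: module_hom_add[OF eps_hom] module_hom_smult[OF eps_hom]
          P.smult_l_distr P.smult_assoc1\<close>)
  moreover have "?f (d 0 v) \<in> N" if "v \<in> carrier (F (Suc 0))" for v
    using that eps_exact[of "d 0 v"] mp by auto
  ultimately show "?f \<in> cocycles_mod R n d P 0 N" by (simp add: cocycles_mod_mem)
  have "p \<ominus>\<^bsub>P\<^esub> \<epsilon> v\<^sub>0 \<odot>\<^bsub>P\<^esub> p = (\<one>\<^bsub>R\<^esub> \<ominus>\<^bsub>R\<^esub> \<epsilon> v\<^sub>0) \<odot>\<^bsub>P\<^esub> p"
    using pP v0_closed by (simp add: R.minus_eq P.M.minus_eq P.smult_l_distr P.smult_l_minus)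
  then have "cong_mod P N p (?f v\<^sub>0)"
    using mp[OF eps_v0] pP v0_closed by (simp add: cong_mod_def)
  then show "cong_mod P N (?f v\<^sub>0) p" by (rule P.cong_mod_sym[OF N])
qed

text \<open>Evaluation at \<open>v\<^sub>0\<close> realises the identification of Hom(R/m, P/N) with
  the socle of P/N.\<close>

lemma sub_len_degree_zero:
  "sub_len R (H 0) (cocycles_mod R n d P 0 N) (coboundaries_mod R n d P 0 N) =
    sub_len R P (colon_mod P N m) N"
proof (rule sub_len_correspondence[where Q = "\<lambda>f p. cong_mod P N (f v\<^sub>0) p"], goal_cases)
  case (9 f f' g g')
  then show ?case using v0_closed by (simp add: H_eval P.cong_mod_add[OF N])
next
  case (10 a f g)
  then show ?case using v0_closed by (simp add: H_eval P.cong_mod_smult[OF N])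
next
  case (11 f)
  then show ?case using degree_zero_colon[of f]
    by (intro bexI[of _ "f v\<^sub>0"] P.cong_mod_refl[OF N]) (auto simp: colon_mod_def)
next
  case (12 p)
  then show ?case using degree_zero_surj by blast
next
  case (13 f p)
  then show ?case using degree_zero_coboundary_iff P.cong_mod_mem_iff[OF N] by blast
qed (use m.a_subset in \<open>auto intro: module_H cocycles_mod_submodule coboundaries_mod_submodule P N
     P.colon_mod_submodule[OF N] P.colon_mod_superset[OF N, THEN subsetD]
     coboundaries_mod_subset[OF N, THEN subsetD]\<close>)

text \<open>Vanishing in degree 0, which \<open>Suc t\<close> guarantees to be included, says that
  P/N has zero socle. This is the input from which prime avoidance finds a nonzerodivisor in
  m.\<close>

lemma ext_vanishes_colon:
  assumes "ext_vanishes R n d P (Suc t) N"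
  shows "colon_mod P N m = N"
proof
  show "N \<subseteq> colon_mod P N m" using P.colon_mod_superset[OF N m.a_subset] .
  show "colon_mod P N m \<subseteq> N"
  proof
    fix p assume "p \<in> colon_mod P N m"
    then obtain f where f: "f \<in> cocycles_mod R n d P 0 N" "cong_mod P N (f v\<^sub>0) p"
      by (rule degree_zero_surj)
    then have "f \<in> coboundaries_mod R n d P 0 N" using assms by (auto simp: ext_vanishes_def)
    then show "p \<in> N" using degree_zero_coboundary_iff f P.cong_mod_mem_iff[OF N] by blast
  qed
qed

end

end

end

subsection \<open>Regular sequences\<close>

text \<open>The quotient by the preceding elements is carried along in N, so the tail of a sequence
  is an instance of the same notion. Unlike \<open>regular_sequence\<close>, it does not ask that
  the final quotient be nonzero.\<close>

fun weakly_regular :: "('a, 'b, 'd) module_scheme \<Rightarrow> 'b set \<Rightarrow> 'a list \<Rightarrow> bool" where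
  "weakly_regular P N [] \<longleftrightarrow> True"
| "weakly_regular P N (x # xs) \<longleftrightarrow> nzd_mod P N x \<and> weakly_regular P (adjoin_mult P N x) xs"

lemma (in module) foldl_adjoin_mult_submodule:
  "\<lbrakk>submodule N R M; set xs \<subseteq> carrier R\<rbrakk> \<Longrightarrow> submodule (foldl (adjoin_mult M) N xs) R M"
  by (induction xs arbitrary: N) (auto intro: adjoin_mult_submodule)

context residue_resolution
begin

text \<open>Each element extends the range of vanishing by one degree, starting from the empty
  range.\<close>

lemma weakly_regular_ext_vanishes:
  assumes P: "module R P"
  shows "\<lbrakk>submodule N R P; set xs \<subseteq> m; weakly_regular P N xs\<rbrakk> \<Longrightarrow> ext_vanishes R n d P (length xs) N"
proof (induction xs arbitrary: N)
  case Nil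
  then show ?case by (simp add: ext_vanishes_def)
next
  case (Cons x xs)
  have x: "x \<in> m" "x \<in> carrier R" using Cons.prems m.a_subset by auto
  then show ?case
    using Cons ext_vanishes_lift[OF P Cons.prems(1) x(1)] module.adjoin_mult_submodule[OF P Cons.prems(1) x(2)]
    by simp
qed

text \<open>Rees' lemma: \<open>Ext\<^sup>t(R/m, P/N) \<cong> Hom(R/m, P/(N + xP))\<close> for a weakly regular sequence \<open>x\<close> of
  length \<open>t\<close> in \<open>m\<close>.\<close>

lemma sub_len_regular_sequence:
  assumes P: "module R P"
  shows "\<lbrakk>submodule N R P; set xs \<subseteq> m; weakly_regular P N xs\<rbrakk> \<Longrightarrow>
    sub_len R (ext_cochains R n P (length xs)) (cocycles_mod R n d P (length xs) N)
        (coboundaries_mod R n d P (length xs) N) =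
      sub_len R P (colon_mod P (foldl (adjoin_mult P) N xs) m) (foldl (adjoin_mult P) N xs)"
proof (induction xs arbitrary: N)
  case Nil
  then show ?case using sub_len_degree_zero[OF P] by simp
next
  case (Cons x xs)
  have x: "x \<in> m" "x \<in> carrier R" using Cons.prems m.a_subset by auto
  have van: "ext_vanishes R n d P (Suc (length xs)) N"
    using weakly_regular_ext_vanishes[OF P Cons.prems] by simp
  show ?case
    using Cons sub_len_adjoin[OF P Cons.prems(1) x(1) _ van] module.adjoin_mult_submodule[OF P Cons.prems(1) x(2)]
    by simp
qed

end

section \<open>Noetherian modules\<close>

text \<open>The maximal condition transfers directly along images and preimages, and to the ideals
  of the idealization viewed as R-submodules; finite generation is derived from it.\<close>

definition noetherian_module :: "('a, 'c) ring_scheme \<Rightarrow> ('a, 'b, 'd) module_scheme \<Rightarrow> bool" where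
  "noetherian_module R P \<longleftrightarrow>
     (\<forall>\<C>. \<C> \<noteq> {} \<longrightarrow> (\<forall>N\<in>\<C>. submodule N R P) \<longrightarrow> (\<exists>N\<in>\<C>. \<forall>N'\<in>\<C>. N \<subseteq> N' \<longrightarrow> N' = N))"

lemma noetherian_moduleD:
  assumes "noetherian_module R P" "\<C> \<noteq> {}" "\<And>N. N \<in> \<C> \<Longrightarrow> submodule N R P"
  shows "\<exists>N. N \<in> \<C> \<and> (\<forall>N'. N' \<in> \<C> \<longrightarrow> N \<subseteq> N' \<longrightarrow> N' = N)"
  using assms unfolding noetherian_module_def by metis

text \<open>A nonempty chain of ideals in a noetherian ring contains its own union, which is the
  upper bound that Zorn's lemma asks for.\<close>

lemma noetherian_reg_module:
  assumes "cring R" "noetherian_ring R"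
  shows "noetherian_module R (reg_module R)"
  unfolding noetherian_module_def
proof (intro allI impI)
  fix \<C> :: "'a set set"
  assume ne: "\<C> \<noteq> {}" and sub: "\<forall>N\<in>\<C>. submodule N R (reg_module R)"
  show "\<exists>N\<in>\<C>. \<forall>N'\<in>\<C>. N \<subseteq> N' \<longrightarrow> N' = N"
  proof (rule subset_Zorn)
    fix D assume D: "subset.chain \<C> D"
    show "\<exists>U\<in>\<C>. \<forall>X\<in>D. X \<subseteq> U"
    proof (cases "D = {}")
      case False
      have "\<C> \<subseteq> {I. ideal I R}" using sub submodule_reg_module_iff[OF assms(1)] by blast
      then have "subset.chain {I. ideal I R} D"
        using D unfolding pred_on.chain_def by blast
      then have "\<Union>D \<in> D" using noetherian_ring.ideal_chain_is_trivial[OF assms(2) False] by blast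
      then have "\<Union>D \<in> \<C>" using D unfolding pred_on.chain_def by blast
      then show ?thesis by blast
    qed (use ne in blast)
  qed
qed

text \<open>Among the members with maximal image in Q one with maximal trace on A is chosen. A
  larger member has the same image and the same trace, and nested submodules with equal image and
  trace coincide.\<close>

lemma noetherian_module_extension:
  assumes A: "module R A" and P: "module R P" and Q: "module R Q"
    and nA: "noetherian_module R A" and nQ: "noetherian_module R Q"
    and f: "module_hom R A P f" and g: "module_hom R P Q g"
    and ker: "\<And>x. \<lbrakk>x \<in> carrier P; g x = \<zero>\<^bsub>Q\<^esub>\<rbrakk> \<Longrightarrow> x \<in> f ` carrier A"
  shows "noetherian_module R P"
  unfolding noetherian_module_def
proof (intro allI impI)
  interpret P: module R P by fact
  interpret Q: module R Q by fact
  fix \<C> assume ne: "\<C> \<noteq> {}" and sub: "\<forall>N\<in>\<C>. submodule N R P"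
  have "\<exists>D. D \<in> (\<lambda>N. g ` N) ` \<C> \<and> (\<forall>D'. D' \<in> (\<lambda>N. g ` N) ` \<C> \<longrightarrow> D \<subseteq> D' \<longrightarrow> D' = D)"
    by (rule noetherian_moduleD[OF nQ]) (use ne sub module_hom_image[OF P Q g] in auto)
  then obtain D where D: "D \<in> (\<lambda>N. g ` N) ` \<C>" "\<And>D'. \<lbrakk>D' \<in> (\<lambda>N. g ` N) ` \<C>; D \<subseteq> D'\<rbrakk> \<Longrightarrow> D' = D"
    by (elim exE conjE) (rule that, assumption, blast)
  let ?\<D> = "{N \<in> \<C>. g ` N = D}"
  let ?v = "\<lambda>N. {a \<in> carrier A. f a \<in> N}"
  have "\<exists>E. E \<in> ?v ` ?\<D> \<and> (\<forall>E'. E' \<in> ?v ` ?\<D> \<longrightarrow> E \<subseteq> E' \<longrightarrow> E' = E)"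
    by (rule noetherian_moduleD[OF nA]) (use D(1) sub module_hom_vimage[OF A P f] in auto)
  then obtain E where E: "E \<in> ?v ` ?\<D>" "\<And>E'. \<lbrakk>E' \<in> ?v ` ?\<D>; E \<subseteq> E'\<rbrakk> \<Longrightarrow> E' = E"
    by (elim exE conjE) (rule that, assumption, blast)
  then obtain N where N: "N \<in> \<C>" "g ` N = D" "E = ?v N" by blast
  have "N' = N" if N': "N' \<in> \<C>" "N \<subseteq> N'" for N'
  proof
    have gN': "g ` N' = D" using D(2)[of "g ` N'"] N N' by blast
    then have v: "?v N' = ?v N" using E(2)[of "?v N'"] N N' by blast
    have sN: "submodule N R P" and sN': "submodule N' R P" using sub N N' by auto
    show "N' \<subseteq> N"
    proof
      fix x assume x: "x \<in> N'"
      then obtain y where y: "y \<in> N" "g x = g y" using gN' N(2) by blast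
      have c: "x \<in> carrier P" "y \<in> carrier P" "y \<in> N'"
        using x y N'(2) P.submoduleE(1)[OF sN'] by auto
      have "g (x \<ominus>\<^bsub>P\<^esub> y) = \<zero>\<^bsub>Q\<^esub>"
        using module_hom_minus[OF P Q g c(1,2)] module_hom_closed[OF g c(2)] y(2)
        by (simp add: Q.M.minus_eq Q.M.r_neg)
      then obtain a where a: "a \<in> carrier A" "x \<ominus>\<^bsub>P\<^esub> y = f a" using ker[of "x \<ominus>\<^bsub>P\<^esub> y"] c by auto
      then have "f a \<in> N'" using P.submodule_minus[OF sN' x c(3)] by simp
      then have "f a \<in> N" using a v by blast
      then have "cong_mod P N x y" using a c by (simp add: cong_mod_def)
      then show "x \<in> N" using P.cong_mod_mem_iff[OF sN] y by blast
    qed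
  qed (use N' in blast)
  then show "\<exists>N\<in>\<C>. \<forall>N'\<in>\<C>. N \<subseteq> N' \<longrightarrow> N' = N" using N by blast
qed

lemma noetherian_module_image:
  assumes P: "module R P" and Q: "module R Q" and nP: "noetherian_module R P"
    and g: "module_hom R P Q g" and surj: "g ` carrier P = carrier Q"
  shows "noetherian_module R Q"
  unfolding noetherian_module_def
proof (intro allI impI)
  fix \<C> assume ne: "\<C> \<noteq> {}" and sub: "\<forall>N\<in>\<C>. submodule N R Q"
  let ?v = "\<lambda>N. {x \<in> carrier P. g x \<in> N}"
  have "\<exists>E. E \<in> ?v ` \<C> \<and> (\<forall>E'. E' \<in> ?v ` \<C> \<longrightarrow> E \<subseteq> E' \<longrightarrow> E' = E)"
    by (rule noetherian_moduleD[OF nP]) (use ne sub module_hom_vimage[OF P Q g] in auto)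
  then obtain E where E: "E \<in> ?v ` \<C>" "\<And>E'. \<lbrakk>E' \<in> ?v ` \<C>; E \<subseteq> E'\<rbrakk> \<Longrightarrow> E' = E"
    by (elim exE conjE) (rule that, assumption, blast)
  have img: "g ` ?v N = N" if "N \<in> \<C>" for N
  proof -
    have "N \<subseteq> g ` carrier P" using module.submoduleE(1)[OF Q] sub that surj by simp
    then show ?thesis by auto
  qed
  obtain N where N: "N \<in> \<C>" "E = ?v N" using E(1) by blast
  have "N' = N" if "N' \<in> \<C>" "N \<subseteq> N'" for N'
  proof -
    have "?v N' = ?v N" using E(2)[of "?v N'"] N that by blast
    then show ?thesis using img[OF N(1)] img[OF that(1)] by metis
  qed
  then show "\<exists>N\<in>\<C>. \<forall>N'\<in>\<C>. N \<subseteq> N' \<longrightarrow> N' = N" using N by blast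
qed

text \<open>The extension 0 -> R^n -> R^(n+1) -> R -> 0 is given by the identity on functions and by
  the last coordinate.\<close>

lemma noetherian_free_module:
  assumes R: "cring R" and nR: "noetherian_module R (reg_module R)"
  shows "noetherian_module R (free_module R n)"
proof (induction n)
  case 0
  interpret F: module R "free_module R 0" by (rule module_free_module) fact
  have z: "carrier (free_module R 0) = {\<zero>\<^bsub>free_module R 0\<^esub>}" by (auto simp: free_module_simps)
  have "N = {\<zero>\<^bsub>free_module R 0\<^esub>}" if "submodule N R (free_module R 0)" for N
    using F.submoduleE(1)[OF that] F.submodule_zero[OF that] unfolding z by blast
  then show ?case unfolding noetherian_module_def by (metis ex_in_conv)
next
  case (Suc n)
  interpret cring R by fact
  have "module_hom R (free_module R n) (free_module R (Suc n)) (\<lambda>v. v)"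
    by (rule module_homI) (auto simp: free_module_simps less_Suc_eq)
  moreover have "module_hom R (free_module R (Suc n)) (reg_module R) (\<lambda>v. v n)"
    by (rule module_homI) (auto simp: free_module_simps)
  moreover have "v \<in> (\<lambda>v. v) ` carrier (free_module R n)"
    if "v \<in> carrier (free_module R (Suc n))" "v n = \<zero>\<^bsub>reg_module R\<^esub>" for v
  proof -
    have "v i = \<zero>\<^bsub>R\<^esub>" if "n \<le> i" for i
      using that \<open>v n = \<zero>\<^bsub>reg_module R\<^esub>\<close> \<open>v \<in> carrier (free_module R (Suc n))\<close>
      by (cases "i = n") (auto simp: free_module_simps)
    then show ?thesis using that by (auto simp: free_module_simps)
  qed
  ultimately show ?case
    using noetherian_module_extension[OF module_free_module module_free_module module_reg_module Suc nR]
      R by blast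
qed

subsection \<open>Finite generation\<close>

context module
begin

lemma module_span_submodule:
  assumes "S \<subseteq> carrier M" shows "submodule (module_span R M S) R M"
proof (rule submoduleI')
  show "module_span R M S \<subseteq> carrier M"
    using carrier_is_submodule assms by (auto simp: module_span_def)
qed (auto simp: module_span_def intro: submoduleE(4,5))

lemma module_span_superset: "S \<subseteq> module_span R M S"
  by (auto simp: module_span_def)

lemma module_span_minimal: "\<lbrakk>submodule N R M; S \<subseteq> N\<rbrakk> \<Longrightarrow> module_span R M S \<subseteq> N"
  by (auto simp: module_span_def)

text \<open>A maximal one among the spans of finite subsets of S absorbs every further element of S.
  That the generators are taken from S matters in \<open>exists_nonzerodivisor\<close>, where they
  index annihilators.\<close>

lemma noetherian_finite_span:
  assumes n: "noetherian_module R M" and S: "S \<subseteq> carrier M"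
  obtains T where "finite T" "T \<subseteq> S" "module_span R M T = module_span R M S"
proof -
  let ?\<C> = "module_span R M ` {T. T \<subseteq> S \<and> finite T}"
  have "\<exists>N. N \<in> ?\<C> \<and> (\<forall>N'. N' \<in> ?\<C> \<longrightarrow> N \<subseteq> N' \<longrightarrow> N' = N)"
    by (rule noetherian_moduleD[OF n]) (use S module_span_submodule in auto)
  then obtain N where N: "N \<in> ?\<C>" "\<And>N'. \<lbrakk>N' \<in> ?\<C>; N \<subseteq> N'\<rbrakk> \<Longrightarrow> N' = N"
    by (elim exE conjE) (rule that, assumption, blast)
  then obtain T where T: "T \<subseteq> S" "finite T" "N = module_span R M T" by blast
  have "s \<in> N" if s: "s \<in> S" for s
  proof -
    let ?N = "module_span R M (insert s T)"
    have sub: "submodule ?N R M" using s S T by (intro module_span_submodule) auto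
    have "N \<subseteq> ?N"
      unfolding T(3) using module_span_superset[of "insert s T"] by (intro module_span_minimal[OF sub]) auto
    then have "?N = N" using N(2)[of ?N] s T by auto
    then show ?thesis using module_span_superset[of "insert s T"] by auto
  qed
  then have "module_span R M S \<subseteq> N"
    using T S by (intro module_span_minimal) (auto intro: module_span_submodule)
  moreover have "N \<subseteq> module_span R M S"
    unfolding T(3) using T S module_span_superset[of S]
    by (intro module_span_minimal) (auto intro: module_span_submodule)
  ultimately show ?thesis using that T by blast
qed

lemma finite_span_free_image:
  assumes T: "finite T" "T \<subseteq> carrier M"
  obtains k f where "module_hom R (free_module R k) M f"
    "f ` carrier (free_module R k) = module_span R M T"
proof -
  obtain p :: "nat \<Rightarrow> _" and k where p: "T = p ` {..<k}"
    using finite_imp_nat_seg_image_inj_on[OF T(1)] by (metis lessThan_def)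
  obtain f where f: "module_hom R (free_module R k) M f" "\<And>j. j < k \<Longrightarrow> f (free_unit R j) = p j"
    using free_module_hom_exists[OF module_axioms, of k p] p T(2) by blast
  interpret F: module R "free_module R k" by (rule module_free_module) (rule R.cring_axioms)
  note unit = free_unit_closed[OF R.cring_axioms, of _ k]
  have "{v \<in> carrier (free_module R k). f v \<in> module_span R M T} = carrier (free_module R k)"
  proof (rule free_module_induct[OF R.cring_axioms])
    show "submodule {v \<in> carrier (free_module R k). f v \<in> module_span R M T} R (free_module R k)"
      using module_hom_vimage[OF F.module_axioms module_axioms f(1)] module_span_submodule T by blast
    show "free_unit R j \<in> {v \<in> carrier (free_module R k). f v \<in> module_span R M T}" if "j < k" for j
      using that f(2) unit module_span_superset[of T] p by auto
  qed
  then have "f ` carrier (free_module R k) \<subseteq> module_span R M T" by blast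
  moreover have "module_span R M T \<subseteq> f ` carrier (free_module R k)"
  proof (rule module_span_minimal)
    show "submodule (f ` carrier (free_module R k)) R M"
      using module_hom_image[OF F.module_axioms module_axioms f(1) F.carrier_is_submodule] .
    show "T \<subseteq> f ` carrier (free_module R k)"
      unfolding p using f(2) unit by (metis image_subsetI imageI lessThan_iff)
  qed
  ultimately show ?thesis using that f(1) by blast
qed

lemma noetherian_submodule_free_image:
  assumes "noetherian_module R M" and N: "submodule N R M"
  obtains k f where "module_hom R (free_module R k) M f" "f ` carrier (free_module R k) = N"
proof -
  note NM = submoduleE(1)[OF N]
  obtain T where T: "finite T" "T \<subseteq> N" "module_span R M T = module_span R M N"
    by (rule noetherian_finite_span[OF assms(1) NM])
  have "module_span R M N = N"
    using module_span_minimal[OF N] module_span_superset[of N] by blast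
  moreover have TM: "T \<subseteq> carrier M" using T(2) NM by blast
  obtain k f where "module_hom R (free_module R k) M f"
    "f ` carrier (free_module R k) = module_span R M T"
    by (rule finite_span_free_image[OF T(1) TM])
  ultimately show ?thesis using T(3) by (intro that[of k f]) simp_all
qed

lemma fin_gen_noetherian:
  assumes "noetherian_module R (reg_module R)" "fin_gen_module R M"
  shows "noetherian_module R M"
proof -
  obtain T where "T \<subseteq> carrier M" "finite T" "module_span R M T = carrier M"
    using assms(2) by (auto simp: fin_gen_module_def)
  then obtain k f where f: "module_hom R (free_module R k) M f"
    "f ` carrier (free_module R k) = carrier M"
    by (metis finite_span_free_image)
  show ?thesis
    by (rule noetherian_module_image[OF module_free_module[OF R.cring_axioms] module_axioms
        noetherian_free_module[OF R.cring_axioms assms(1)] f])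
qed

end

text \<open>Finitely generated free modules are noetherian, so each kernel is again the image of a
  free module of finite rank; the resolution is an iterated dependent choice of such covers.\<close>

lemma free_resolution_exists:
  assumes R: "cring R" and nR: "noetherian_module R (reg_module R)" and A: "module R A"
    and e: "module_hom R (free_module R k) A e" "e ` carrier (free_module R k) = carrier A"
  shows "\<exists>n d e. free_resolution R A n d e"
proof -
  \<comment> \<open>A state of the recursion holds both ranks and the differential between them,
    since the next free module has to cover the kernel of that differential.\<close>
  define P :: "nat \<Rightarrow> nat \<times> nat \<times> ((nat \<Rightarrow> 'a) \<Rightarrow> nat \<Rightarrow> 'a) \<Rightarrow> bool" where
    "P i = (\<lambda>(p, q, \<delta>). module_hom R (free_module R q) (free_module R p) \<delta> \<and>
      (i = 0 \<longrightarrow> p = k \<and> \<delta> ` carrier (free_module R q) = a_kernel (free_module R k) A e))" for i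
  define Q :: "nat \<Rightarrow> nat \<times> nat \<times> ((nat \<Rightarrow> 'a) \<Rightarrow> nat \<Rightarrow> 'a) \<Rightarrow> nat \<times> nat \<times> ((nat \<Rightarrow> 'a) \<Rightarrow> nat \<Rightarrow> 'a) \<Rightarrow> bool" where
    "Q i = (\<lambda>(p, q, \<delta>) (p', q', \<delta>'). p' = q \<and>
      \<delta>' ` carrier (free_module R q') = a_kernel (free_module R q) (free_module R p) \<delta>)" for i
  have lift: "\<exists>q \<delta>'. module_hom R (free_module R q) (free_module R p) \<delta>' \<and>
      \<delta>' ` carrier (free_module R q) = a_kernel (free_module R p) B \<delta>"
    if "module R B" "module_hom R (free_module R p) B \<delta>" for p \<delta> and B :: "('a, 'z, 'y) module_scheme"
  proof -
    interpret Fp: module R "free_module R p" by (rule module_free_module[OF R])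
    interpret B: module R B by fact
    have "submodule (a_kernel (free_module R p) B \<delta>) R (free_module R p)"
      using module_hom_vimage[OF Fp.module_axioms that B.zero_submodule] by (simp add: a_kernel_def')
    then show ?thesis
      using Fp.noetherian_submodule_free_image[OF noetherian_free_module[OF R nR]] by metis
  qed
  have "\<exists>s. \<forall>i. P i (s i) \<and> Q i (s i) (s (Suc i))"
  proof (rule dependent_nat_choice)
    show "\<exists>s. P 0 s" using lift[OF A e(1)] by (auto simp: P_def)
    show "\<exists>s'. P (Suc i) s' \<and> Q i s s'" if "P i s" for i s
      using that lift[OF module_free_module[OF R]] by (cases s) (fastforce simp: P_def Q_def)
  qed
  then obtain s where s: "\<And>i. P i (s i)" "\<And>i. Q i (s i) (s (Suc i))" by blast
  define n where "n i = fst (s i)" for i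
  define d where "d i = snd (snd (s i))" for i
  have s_eq: "s i = (n i, n (Suc i), d i)" for i
    using s(2)[of i] by (auto simp: n_def d_def Q_def split: prod.splits)
  have "free_resolution R A n d e"
    unfolding free_resolution_def
  proof (intro conjI allI)
    show "d 0 ` carrier (free_module R (n 1)) = a_kernel (free_module R (n 0)) A e"
      "module_hom R (free_module R (n 0)) A e" "e ` carrier (free_module R (n 0)) = carrier A"
      using s(1)[of 0] e unfolding s_eq P_def by auto
    show "module_hom R (free_module R (n (Suc i))) (free_module R (n i)) (d i)" for i
      using s(1)[of i] unfolding s_eq P_def by auto
    show "d (Suc i) ` carrier (free_module R (n (Suc (Suc i)))) =
      a_kernel (free_module R (n (Suc i))) (free_module R (n i)) (d i)" for i
      using s(2)[of i] unfolding s_eq Q_def by auto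
  qed
  then show ?thesis by blast
qed

subsection \<open>Direct products\<close>

text \<open>It has two uses: a nonzerodivisor on a product is one on each factor, and ideals of the
  idealization are submodules of the product of R and M.\<close>

definition prod_module ::
    "('a, 'b, 'd) module_scheme \<Rightarrow> ('a, 'e, 'f) module_scheme \<Rightarrow> ('a, 'b \<times> 'e) module" where
  "prod_module P Q =
     \<lparr>carrier = carrier P \<times> carrier Q, monoid.mult = undefined, one = undefined,
      ring.zero = (\<zero>\<^bsub>P\<^esub>, \<zero>\<^bsub>Q\<^esub>), add = (\<lambda>(a, x) (b, y). (a \<oplus>\<^bsub>P\<^esub> b, x \<oplus>\<^bsub>Q\<^esub> y)),
      smult = (\<lambda>r (a, x). (r \<odot>\<^bsub>P\<^esub> a, r \<odot>\<^bsub>Q\<^esub> x))\<rparr>"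

lemma prod_module_simps [simp]:
  "carrier (prod_module P Q) = carrier P \<times> carrier Q"
  "\<zero>\<^bsub>prod_module P Q\<^esub> = (\<zero>\<^bsub>P\<^esub>, \<zero>\<^bsub>Q\<^esub>)"
  "(a, x) \<oplus>\<^bsub>prod_module P Q\<^esub> (b, y) = (a \<oplus>\<^bsub>P\<^esub> b, x \<oplus>\<^bsub>Q\<^esub> y)"
  "r \<odot>\<^bsub>prod_module P Q\<^esub> (a, x) = (r \<odot>\<^bsub>P\<^esub> a, r \<odot>\<^bsub>Q\<^esub> x)"
  by (simp_all add: prod_module_def)

lemma module_prod_module:
  assumes P: "module R P" and Q: "module R Q"
  shows "module R (prod_module P Q)"
proof -
  interpret P: module R P by fact
  interpret Q: module R Q by fact
  show ?thesis
  proof (rule moduleI)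
    show "abelian_group (prod_module P Q)"
    proof (rule abelian_groupI, goal_cases)
      case (6 x)
      then show ?case
        by (intro bexI[of _ "(\<ominus>\<^bsub>P\<^esub> fst x, \<ominus>\<^bsub>Q\<^esub> snd x)"]) (auto simp: P.M.l_neg Q.M.l_neg)
    qed (auto simp: P.M.a_ac Q.M.a_ac)
  qed (auto simp: P.R.cring_axioms P.smult_l_distr P.smult_r_distr P.smult_assoc1
        Q.smult_l_distr Q.smult_r_distr Q.smult_assoc1)
qed

lemma noetherian_prod_module:
  assumes P: "module R P" and Q: "module R Q" and "noetherian_module R P" "noetherian_module R Q"
  shows "noetherian_module R (prod_module P Q)"
proof -
  interpret P: module R P by fact
  interpret Q: module R Q by fact
  have "module_hom R (prod_module P Q) Q snd"
    by (rule module_homI) auto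
  moreover have "module_hom R P (prod_module P Q) (\<lambda>x. (x, \<zero>\<^bsub>Q\<^esub>))"
    by (rule module_homI) auto
  moreover have "x \<in> (\<lambda>x. (x, \<zero>\<^bsub>Q\<^esub>)) ` carrier P"
    if "x \<in> carrier (prod_module P Q)" "snd x = \<zero>\<^bsub>Q\<^esub>" for x
    using that by auto
  ultimately show ?thesis
    by (intro noetherian_module_extension[OF P module_prod_module[OF P Q] Q assms(3,4)])
qed

lemma submodule_Times:
  assumes P: "module R P" and Q: "module R Q" and N: "submodule N R P" and L: "submodule L R Q"
  shows "submodule (N \<times> L) R (prod_module P Q)"
proof -
  interpret P: module R P by fact
  interpret Q: module R Q by fact
  interpret PQ: module R "prod_module P Q" by (rule module_prod_module) fact+
  show ?thesis
    by (rule PQ.submoduleI') (use P.submoduleE[OF N] Q.submoduleE[OF L] N L in auto)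
qed

section \<open>Existence of nonzerodivisors\<close>

text \<open>An element of each ideal outside Q is multiplied onto the product so far; primality of Q
  keeps the product outside Q.\<close>

lemma (in cring) prime_product_avoidance:
  assumes fin: "finite \<T>" and Q: "\<And>a b. \<lbrakk>a \<in> carrier R; b \<in> carrier R; a \<otimes> b \<in> Q\<rbrakk> \<Longrightarrow> a \<in> Q \<or> b \<in> Q"
    and \<T>: "\<And>A. A \<in> \<T> \<Longrightarrow> ideal A R \<and> \<not> A \<subseteq> Q" and I: "ideal I R" "\<not> I \<subseteq> Q"
  shows "\<exists>w\<in>I. w \<notin> Q \<and> (\<forall>A\<in>\<T>. w \<in> A)"
  using fin \<T>
proof (induction \<T> rule: finite_induct)
  case empty
  then show ?case using I by blast
next
  case (insert A \<T>)
  then obtain w where w: "w \<in> I" "w \<notin> Q" "\<forall>A\<in>\<T>. w \<in> A" by auto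
  obtain a where a: "a \<in> A" "a \<notin> Q" using insert.prems[of A] by blast
  have c: "w \<in> carrier R" "a \<in> carrier R"
    using w(1) ideal.Icarr[OF I(1)] ideal.Icarr[of A R a] a(1) insert.prems[of A] by auto
  have "a \<otimes> w \<notin> Q" using Q[OF c(2,1)] a w by auto
  moreover have "a \<otimes> w \<in> I" using ideal.I_l_closed[OF I(1) w(1) c(2)] .
  moreover have "a \<otimes> w \<in> A" using ideal.I_r_closed[of A R a w] insert.prems[of A] a c by auto
  moreover have "a \<otimes> w \<in> B" if "B \<in> \<T>" for B
    using ideal.I_l_closed[of B R w a] insert.prems[of B] that w c by auto
  ultimately show ?case by blast
qed

text \<open>If z avoids the other primes but lies in Q, it is corrected by some w in I that lies in
  all the others and avoids Q; then z + w avoids all of them. Pairwise incomparability is what makes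
  such a w exist.\<close>

lemma (in cring) prime_avoidance:
  assumes fin: "finite \<T>"
    and prime: "\<And>Q a b. \<lbrakk>Q \<in> \<T>; a \<in> carrier R; b \<in> carrier R; a \<otimes> b \<in> Q\<rbrakk> \<Longrightarrow> a \<in> Q \<or> b \<in> Q"
    and ideal: "\<And>Q. Q \<in> \<T> \<Longrightarrow> ideal Q R" and incomp: "\<And>A Q. \<lbrakk>A \<in> \<T>; Q \<in> \<T>; A \<subseteq> Q\<rbrakk> \<Longrightarrow> A = Q"
    and I: "ideal I R" "\<And>Q. Q \<in> \<T> \<Longrightarrow> \<not> I \<subseteq> Q"
  shows "\<exists>z\<in>I. \<forall>Q\<in>\<T>. z \<notin> Q"
  using assms
proof (induction \<T> rule: finite_induct)
  case empty
  then show ?case using additive_subgroup.zero_closed[OF ideal.axioms(1)[OF I(1)]] by auto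
next
  case (insert Q \<T>)
  have "\<exists>z\<in>I. \<forall>Q\<in>\<T>. z \<notin> Q"
  proof (rule insert.IH)
    show "a \<in> B \<or> b \<in> B" if "B \<in> \<T>" "a \<in> carrier R" "b \<in> carrier R" "a \<otimes> b \<in> B" for B a b
      using insert.prems(1)[of B a b] that by simp
    show "A = B" if "A \<in> \<T>" "B \<in> \<T>" "A \<subseteq> B" for A B
      using insert.prems(3)[of A B] that by simp
  qed (use insert.prems(2,4,5) in auto)
  then obtain z where z: "z \<in> I" "\<forall>Q\<in>\<T>. z \<notin> Q" by blast
  show ?case
  proof (cases "z \<in> Q")
    case False
    then show ?thesis using z by blast
  next
    case True
    have "\<exists>w\<in>I. w \<notin> Q \<and> (\<forall>A\<in>\<T>. w \<in> A)"
    proof (rule prime_product_avoidance[OF insert.hyps(1)])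
      show "a \<in> Q \<or> b \<in> Q" if "a \<in> carrier R" "b \<in> carrier R" "a \<otimes> b \<in> Q" for a b
        using insert.prems(1)[of Q a b] that by simp
      show "ideal A R \<and> \<not> A \<subseteq> Q" if "A \<in> \<T>" for A
        using insert.prems(2)[of A] insert.prems(3)[of A Q] insert.hyps(2) that by auto
      show "\<not> I \<subseteq> Q" using insert.prems(5)[of Q] by simp
    qed (rule insert.prems(4))
    then obtain w where w: "w \<in> I" "w \<notin> Q" "\<forall>A\<in>\<T>. w \<in> A" by blast
    have c: "z \<in> carrier R" "w \<in> carrier R" using z w ideal.Icarr[OF insert.prems(4)] by auto
    have sub: "a \<ominus> b \<in> A" if "ideal A R" "a \<in> A" "b \<in> A" for A a b
      using that module.submodule_minus[OF module_reg_module[OF is_cring], of A a b]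
        submodule_reg_module_iff[OF is_cring] by (simp add: reg_module_minus)
    have "(z \<oplus> w) \<ominus> w = z" using c by (simp add: minus_eq a_assoc r_neg)
    moreover have "(z \<oplus> w) \<ominus> z = w" using c by (simp add: minus_eq a_comm[of z w] a_assoc r_neg)
    ultimately have "z \<oplus> w \<notin> Q" "\<forall>A\<in>\<T>. z \<oplus> w \<notin> A"
      using sub[of Q "z \<oplus> w" z] sub[of _ "z \<oplus> w" w] True w z insert.prems(2) by auto
    moreover have "z \<oplus> w \<in> I"
      using additive_subgroup.a_closed[OF ideal.axioms(1)[OF insert.prems(4)]] z w by blast
    ultimately show ?thesis by blast
  qed
qed

text \<open>The maximal elements among the annihilators of elements of \<open>P/N\<close> are prime ideals, there are
  finitely many of them, and their union is the set of zero divisors.\<close>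

lemma (in module) exists_nonzerodivisor:
  assumes nR: "noetherian_module R (reg_module R)" and nM: "noetherian_module R M"
    and N: "submodule N R M" and I: "ideal I R" and colon: "colon_mod M N I = N"
  shows "\<exists>z\<in>I. nzd_mod M N z"
proof -
  define ann where "ann p = {a \<in> carrier R. a \<odot>\<^bsub>M\<^esub> p \<in> N}" for p
  define \<A> where "\<A> = ann ` (carrier M - N)"
  define \<Q> where "\<Q> = {Q \<in> \<A>. \<forall>A\<in>\<A>. Q \<subseteq> A \<longrightarrow> A = Q}"
  note Nc = submoduleE[OF N]
  note reg = module_reg_module[OF R.cring_axioms]
  have ann_sub: "submodule (ann p) R (reg_module R)" if "p \<in> carrier M" for p
    using that N Nc
    by (intro module.submoduleI'[OF reg]) (auto simp: ann_def smult_l_distr smult_assoc1)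
  then have ideal: "ideal Q R" if "Q \<in> \<A>" for Q
    using that submodule_reg_module_iff[OF R.cring_axioms] by (auto simp: \<A>_def)
  have prime: "a \<in> Q \<or> b \<in> Q" if Q: "Q \<in> \<Q>" and ab: "a \<in> carrier R" "b \<in> carrier R" "a \<otimes>\<^bsub>R\<^esub> b \<in> Q" for Q a b
  proof (rule ccontr)
    assume n: "\<not> (a \<in> Q \<or> b \<in> Q)"
    obtain p where p: "p \<in> carrier M" "p \<notin> N" "Q = ann p" using Q by (auto simp: \<Q>_def \<A>_def)
    \<comment> \<open>The annihilator of bp contains that of p, so maximality makes them equal; but
      a annihilates bp.\<close>
    have "b \<odot>\<^bsub>M\<^esub> p \<notin> N" using n p ab by (auto simp: ann_def)
    then have "ann (b \<odot>\<^bsub>M\<^esub> p) \<in> \<A>" using p ab by (auto simp: \<A>_def)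
    moreover have "Q \<subseteq> ann (b \<odot>\<^bsub>M\<^esub> p)"
      using p ab Nc(4) by (auto simp: ann_def smult_left_commute[of _ b])
    ultimately have "ann (b \<odot>\<^bsub>M\<^esub> p) = Q" using Q by (auto simp: \<Q>_def)
    moreover have "a \<in> ann (b \<odot>\<^bsub>M\<^esub> p)" using p ab by (auto simp: ann_def smult_assoc1)
    ultimately show False using n by blast
  qed
  have incomp: "A = Q" if "A \<in> \<Q>" "Q \<in> \<Q>" "A \<subseteq> Q" for A Q
    using that by (auto simp: \<Q>_def)
  have max: "\<exists>Q\<in>\<Q>. A \<subseteq> Q" if A: "A \<in> \<A>" for A
  proof -
    have "\<exists>Q. Q \<in> {B \<in> \<A>. A \<subseteq> B} \<and> (\<forall>Q'. Q' \<in> {B \<in> \<A>. A \<subseteq> B} \<longrightarrow> Q \<subseteq> Q' \<longrightarrow> Q' = Q)"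
      by (rule noetherian_moduleD[OF nR]) (use A ann_sub in \<open>auto simp: \<A>_def\<close>)
    then obtain Q where Q: "Q \<in> {B \<in> \<A>. A \<subseteq> B}" "\<And>B. \<lbrakk>B \<in> {B \<in> \<A>. A \<subseteq> B}; Q \<subseteq> B\<rbrakk> \<Longrightarrow> B = Q"
      by (elim exE conjE) (rule that, assumption, blast)
    then have "Q \<in> \<Q>" unfolding \<Q>_def by blast
    then show ?thesis using Q(1) by blast
  qed
  have "\<forall>Q\<in>\<Q>. \<exists>p. p \<in> carrier M - N \<and> ann p = Q" by (auto simp: \<Q>_def \<A>_def)
  then obtain p where p: "\<And>Q. Q \<in> \<Q> \<Longrightarrow> p Q \<in> carrier M - N \<and> ann (p Q) = Q" by metis
  have pM: "p ` \<Q> \<subseteq> carrier M" using p by blast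
  obtain T where T: "finite T" "T \<subseteq> p ` \<Q>" "module_span R M T = module_span R M (p ` \<Q>)"
    by (rule noetherian_finite_span[OF nM pM])
  \<comment> \<open>Finiteness: the chosen elements \<open>p Q\<close> are spanned by the finitely
    many in T. If Q were not the annihilator of a member of T, some w outside Q would carry T into
    N, hence also \<open>p Q\<close>, contradicting that Q is the annihilator of
    \<open>p Q\<close>.\<close>
  have "Q \<in> ann ` T" if Q: "Q \<in> \<Q>" for Q
  proof (rule ccontr)
    assume Qn: "Q \<notin> ann ` T"
    have T\<Q>: "ann ` T \<subseteq> \<Q>" using T(2) p by auto
    have "\<exists>w\<in>carrier R. w \<notin> Q \<and> (\<forall>A\<in>ann ` T. w \<in> A)"
    proof (rule R.prime_product_avoidance[OF _ prime[OF Q]])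
      show "ideal A R \<and> \<not> A \<subseteq> Q" if "A \<in> ann ` T" for A
        using that T\<Q> Qn incomp[of A Q] Q ideal[of A] by (auto simp: \<Q>_def)
      show "\<not> carrier R \<subseteq> Q"
      proof
        assume "carrier R \<subseteq> Q"
        then have "\<one>\<^bsub>R\<^esub> \<in> ann (p Q)" using p[OF Q] by auto
        then show False using p[OF Q] by (auto simp: ann_def)
      qed
    qed (use T(1) R.oneideal in auto)
    then obtain w where w: "w \<in> carrier R" "w \<notin> Q" "\<forall>A\<in>ann ` T. w \<in> A" by blast
    have "submodule {x \<in> carrier M. w \<odot>\<^bsub>M\<^esub> x \<in> N} R M"
      using N Nc w(1)
      by (intro submoduleI') (auto simp: smult_r_distr smult_left_commute[of w])
    moreover have "T \<subseteq> {x \<in> carrier M. w \<odot>\<^bsub>M\<^esub> x \<in> N}"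
      using w(3) T(2) pM by (auto simp: ann_def)
    ultimately have "module_span R M T \<subseteq> {x \<in> carrier M. w \<odot>\<^bsub>M\<^esub> x \<in> N}"
      by (rule module_span_minimal)
    moreover have "p Q \<in> module_span R M T"
      using T(3) module_span_superset[of "p ` \<Q>"] Q by auto
    ultimately have "w \<in> ann (p Q)" using w(1) by (auto simp: ann_def)
    then show False using p[OF Q] w(2) by blast
  qed
  then have fin: "finite \<Q>" using T(1) by (meson finite_imageI finite_subset subsetI)
  have "\<exists>z\<in>I. \<forall>Q\<in>\<Q>. z \<notin> Q"
  proof (rule R.prime_avoidance[OF fin prime _ incomp I])
    \<comment> \<open>Were I inside Q, the element \<open>p Q\<close> outside N would be carried
      into N by I, against \<open>colon\<close>.\<close>
    show "\<not> I \<subseteq> Q" if Q: "Q \<in> \<Q>" for Q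
    proof
      assume "I \<subseteq> Q"
      then have "p Q \<in> colon_mod M N I" using p[OF Q] by (auto simp: colon_mod_def ann_def)
      then show False using colon p[OF Q] by blast
    qed
  qed (use ideal in \<open>auto simp: \<Q>_def\<close>)
  then obtain z where z: "z \<in> I" "\<forall>Q\<in>\<Q>. z \<notin> Q" by blast
  have "x \<in> N" if x: "x \<in> carrier M" "z \<odot>\<^bsub>M\<^esub> x \<in> N" for x
  proof (rule ccontr)
    assume "x \<notin> N"
    then have "ann x \<in> \<A>" "z \<in> ann x" using x z(1) ideal.Icarr[OF I] by (auto simp: \<A>_def ann_def)
    then show False using max z(2) by blast
  qed
  then show ?thesis using z(1) by (auto simp: nzd_mod_def)
qed

text \<open>A nonzerodivisor on the product of the two quotients is one on each. Both have zero
  socle as long as vanishing reaches degree 0, and the product inherits this; passing modulo z costs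
  both one degree, so t steps are possible.\<close>

lemma (in residue_resolution) common_regular_sequence:
  assumes P: "module R P" and Q: "module R Q" and nR: "noetherian_module R (reg_module R)"
    and nP: "noetherian_module R P" and nQ: "noetherian_module R Q"
  shows "\<lbrakk>submodule N R P; submodule L R Q; ext_vanishes R n d P t N; ext_vanishes R n d Q t L\<rbrakk> \<Longrightarrow>
    \<exists>xs. length xs = t \<and> set xs \<subseteq> m \<and> weakly_regular P N xs \<and> weakly_regular Q L xs"
proof (induction t arbitrary: N L)
  case (Suc t)
  interpret P: module R P by fact
  interpret Q: module R Q by fact
  interpret PQ: module R "prod_module P Q" by (rule module_prod_module) fact+
  note N = Suc.prems(1) and L = Suc.prems(2)
  have NL: "submodule (N \<times> L) R (prod_module P Q)" using submodule_Times[OF P Q N L] .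
  have "colon_mod (prod_module P Q) (N \<times> L) m = colon_mod P N m \<times> colon_mod Q L m"
    by (auto simp: colon_mod_def)
  then have "colon_mod (prod_module P Q) (N \<times> L) m = N \<times> L"
    using ext_vanishes_colon[OF P N Suc.prems(3)] ext_vanishes_colon[OF Q L Suc.prems(4)] by simp
  then obtain z where z: "z \<in> m" "nzd_mod (prod_module P Q) (N \<times> L) z"
    using PQ.exists_nonzerodivisor[OF nR noetherian_prod_module[OF P Q nP nQ] NL m_ideal] by blast
  have zR: "z \<in> carrier R" using z m.a_subset by blast
  have zP: "nzd_mod P N z" and zQ: "nzd_mod Q L z"
    unfolding nzd_mod_def
  proof safe
    have zz: "(x, y) \<in> N \<times> L" if "x \<in> carrier P" "y \<in> carrier Q" "z \<odot>\<^bsub>P\<^esub> x \<in> N" "z \<odot>\<^bsub>Q\<^esub> y \<in> L" for x y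
      using z(2) that unfolding nzd_mod_def by simp
    show "x \<in> N" if "x \<in> carrier P" "z \<odot>\<^bsub>P\<^esub> x \<in> N" for x
      using zz[OF that(1) Q.M.zero_closed that(2)] zR Q.submodule_zero[OF L] by simp
    show "x \<in> L" if "x \<in> carrier Q" "z \<odot>\<^bsub>Q\<^esub> x \<in> L" for x
      using zz[OF P.M.zero_closed that(1) _ that(2)] zR P.submodule_zero[OF N] by simp
  qed
  obtain xs where "length xs = t" "set xs \<subseteq> m" "weakly_regular P (adjoin_mult P N z) xs"
    "weakly_regular Q (adjoin_mult Q L z) xs"
    using Suc.IH[OF P.adjoin_mult_submodule[OF N zR] Q.adjoin_mult_submodule[OF L zR]
      ext_vanishes_adjoin[OF P N z(1) zP Suc.prems(3)] ext_vanishes_adjoin[OF Q L z(1) zQ Suc.prems(4)]]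
    by blast
  then show ?case using z(1) zP zQ by (intro exI[of _ "z # xs"]) auto
qed simp

section \<open>The Cohen-Macaulay type as the length of a socle\<close>

lemma local_ring_max_ideal:
  assumes "local_ring R"
  shows "cring R" "maximalideal (max_ideal R) R" "ideal (max_ideal R) R"
    and "max_ideal R \<subseteq> carrier R" "\<one>\<^bsub>R\<^esub> \<notin> max_ideal R"
proof -
  show R: "cring R" using assms by (simp add: local_ring_def)
  have "\<exists>!I. maximalideal I R" using assms by (simp add: local_ring_def)
  then show m: "maximalideal (max_ideal R) R" unfolding max_ideal_def by (rule theI')
  then show i: "ideal (max_ideal R) R" by (rule maximalideal.axioms(1))
  show "max_ideal R \<subseteq> carrier R" using ideal.Icarr[OF i] by blast
  show "\<one>\<^bsub>R\<^esub> \<notin> max_ideal R"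
    using ideal.one_imp_carrier[OF i] maximalideal.I_notcarr[OF m] by metis
qed

text \<open>The augmentation onto R/I is lifted through R by projectivity of the first free module;
  \<open>v\<^sub>0\<close> is a preimage of the class of 1 under the original augmentation.\<close>

lemma residue_resolution_of_free_resolution:
  assumes R: "cring R" and I: "ideal I R"
    and res: "free_resolution R (quot_module (reg_module R) I) n d e"
  obtains \<epsilon> v\<^sub>0 where "residue_resolution R I n d \<epsilon> v\<^sub>0"
proof -
  interpret reg: module R "reg_module R" by (rule module_reg_module) fact
  interpret I: ideal I R by fact
  have sub: "submodule I R (reg_module R)" using I submodule_reg_module_iff[OF R] by simp
  let ?k = "quot_module (reg_module R) I"
  note q = reg.quot_module_simps[OF sub]
  have e: "module_hom R (free_module R (n 0)) ?k e" "e ` carrier (free_module R (n 0)) = carrier ?k"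
    and d: "\<And>i. module_hom R (free_module R (n (Suc i))) (free_module R (n i)) (d i)"
    and d0: "d 0 ` carrier (free_module R (n 1)) = a_kernel (free_module R (n 0)) ?k e"
    and dS: "\<And>i. d (Suc i) ` carrier (free_module R (n (Suc (Suc i)))) =
      a_kernel (free_module R (n (Suc i))) (free_module R (n i)) (d i)"
    using res by (auto simp: free_resolution_def)
  have "\<exists>\<epsilon>. module_hom R (free_module R (n 0)) (reg_module R) \<epsilon> \<and>
    (\<forall>v\<in>carrier (free_module R (n 0)). e v = I +>\<^bsub>reg_module R\<^esub> \<epsilon> v)"
  proof (rule free_module_hom_choice[OF reg.module_axioms], goal_cases)
    case (1 v)
    then show ?case using module_hom_closed[OF e(1) 1] by (auto simp: q(1))
  next
    case (2 v w a b)
    then show ?case using q(3)[of a b] by (simp add: module_hom_add[OF e(1)])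
  next
    case (3 a v b)
    then show ?case using q(4)[of a b] by (simp add: module_hom_smult[OF e(1)])
  qed
  then obtain \<epsilon> where \<epsilon>: "module_hom R (free_module R (n 0)) (reg_module R) \<epsilon>"
    "\<And>v. v \<in> carrier (free_module R (n 0)) \<Longrightarrow> e v = I +>\<^bsub>reg_module R\<^esub> \<epsilon> v" by blast
  note \<epsilon>c = module_hom_closed[OF \<epsilon>(1)]
  have "I +>\<^bsub>reg_module R\<^esub> \<one>\<^bsub>R\<^esub> \<in> e ` carrier (free_module R (n 0))"
    unfolding e(2) q(1) by simp
  then obtain v\<^sub>0 where v0: "v\<^sub>0 \<in> carrier (free_module R (n 0))" "e v\<^sub>0 = I +>\<^bsub>reg_module R\<^esub> \<one>\<^bsub>R\<^esub>" by force
  have "residue_resolution R I n d \<epsilon> v\<^sub>0"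
  proof (rule residue_resolution.intro, goal_cases)
    case (4 i v)
    then show ?case unfolding dS by (simp add: a_kernel_def')
  next
    case (6 v)
    have "\<epsilon> v \<in> I \<longleftrightarrow> e v = I"
      using \<epsilon>(2)[OF 6] reg.coset_eq_submodule_iff[OF sub \<epsilon>c[OF 6]] by simp
    then show ?case using 6 d0 by (simp add: a_kernel_def' q(2))
  next
    case 8
    have "cong_mod (reg_module R) I \<one>\<^bsub>R\<^esub> (\<epsilon> v\<^sub>0)"
      using reg.coset_eq_iff[OF sub, of "\<one>\<^bsub>R\<^esub>" "\<epsilon> v\<^sub>0"] \<epsilon>(2)[OF v0(1)] v0(2) \<epsilon>c[OF v0(1)] by simp
    then show ?case by (simp add: cong_mod_def reg_module_minus)
  qed (use R I d \<epsilon> v0 in auto)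
  then show ?thesis by (rule that)
qed

lemma residue_field_free_resolution:
  assumes R: "local_ring R" and nR: "noetherian_module R (reg_module R)"
  shows "\<exists>n d e. free_resolution R (residue_field R) n d e"
proof -
  note m = local_ring_max_ideal[OF R]
  interpret reg: module R "reg_module R" by (rule module_reg_module) fact
  have sub: "submodule (max_ideal R) R (reg_module R)" using m submodule_reg_module_iff by blast
  interpret k: module R "residue_field R"
    unfolding residue_field_def by (rule reg.module_quot_module[OF sub])
  have "noetherian_module R (residue_field R)"
  proof (rule noetherian_module_image[OF reg.module_axioms k.module_axioms nR])
    show "module_hom R (reg_module R) (residue_field R) (\<lambda>x. max_ideal R +>\<^bsub>reg_module R\<^esub> x)"
      "(\<lambda>x. max_ideal R +>\<^bsub>reg_module R\<^esub> x) ` carrier (reg_module R) = carrier (residue_field R)"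
      unfolding residue_field_def using reg.quot_module_hom[OF sub] reg.quot_module_simps(1)[OF sub]
      by auto
  qed
  then obtain j e where "module_hom R (free_module R j) (residue_field R) e"
    "e ` carrier (free_module R j) = carrier (residue_field R)"
    by (rule k.noetherian_submodule_free_image[OF _ k.carrier_is_submodule])
  then show ?thesis by (rule free_resolution_exists[OF m(1) nR k.module_axioms])
qed

text \<open>For the zero submodule the relative cocycles, and likewise the coboundaries below, are
  those from which \<open>Ext_module\<close> is formed.\<close>

lemma (in residue_resolution) ext_cocycles_eq:
  assumes P: "module R P"
  shows "ext_cocycles R n d P i = cocycles_mod R n d P i {\<zero>\<^bsub>P\<^esub>}"
proof -
  have "ext_diff R n d i f = \<zero>\<^bsub>ext_cochains R n P (Suc i)\<^esub> \<longleftrightarrow>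
    (\<forall>v\<in>carrier (F (Suc i)). f (d i v) = \<zero>\<^bsub>P\<^esub>)" for f
    by (auto simp: ext_diff_def ext_cochains_def Hom_module_def fun_eq_iff)
  then show ?thesis by (auto simp: ext_cocycles_def a_kernel_def' cocycles_mod_def)
qed

lemma (in residue_resolution) ext_coboundaries_eq:
  assumes P: "module R P"
  shows "ext_coboundaries R n d P i = coboundaries_mod R n d P i {\<zero>\<^bsub>P\<^esub>}"
proof -
  interpret P: module R P by fact
  have cong: "cong_mod P {\<zero>\<^bsub>P\<^esub>} x y \<longleftrightarrow> x = y" if c: "x \<in> carrier P" "y \<in> carrier P" for x y
  proof
    assume "cong_mod P {\<zero>\<^bsub>P\<^esub>} x y"
    then have "(x \<ominus>\<^bsub>P\<^esub> y) \<oplus>\<^bsub>P\<^esub> y = y" using c by (simp add: cong_mod_def)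
    then show "x = y" using c by (simp add: P.M.minus_eq P.M.a_assoc P.M.l_neg)
  qed (use c P.cong_mod_refl[OF P.zero_submodule] in auto)
  have "f \<in> coboundaries_mod R n d P i {\<zero>\<^bsub>P\<^esub>} \<longleftrightarrow> f \<in> ext_coboundaries R n d P i" for f
  proof
    assume "f \<in> coboundaries_mod R n d P i {\<zero>\<^bsub>P\<^esub>}"
    then obtain h where h: "f \<in> carrier (ext_cochains R n P i)" "h \<in> ext_coboundaries R n d P i"
      "\<And>v. v \<in> carrier (F i) \<Longrightarrow> cong_mod P {\<zero>\<^bsub>P\<^esub>} (f v) (h v)"
      by (auto simp: coboundaries_mod_mem[OF P])
    have "f = h"
      using h(3) by (intro H_ext[OF P h(1) ext_coboundaries_closed[OF P h(2)]])
        (simp add: cong H_closed[OF P h(1)] H_closed[OF P ext_coboundaries_closed[OF P h(2)]])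
    then show "f \<in> ext_coboundaries R n d P i" using h(2) by simp
  next
    assume f: "f \<in> ext_coboundaries R n d P i"
    then show "f \<in> coboundaries_mod R n d P i {\<zero>\<^bsub>P\<^esub>}"
      unfolding coboundaries_mod_mem[OF P]
      using ext_coboundaries_closed[OF P f] H_closed[OF P ext_coboundaries_closed[OF P f]]
      by (auto intro!: bexI[of _ f] simp: cong)
  qed
  then show ?thesis by blast
qed

text \<open>Rees' lemma holds for whichever resolution \<open>SOME\<close> picks, and it replaces
  the length of Ext by a socle length in which the resolution no longer occurs.\<close>

lemma CM_type_eq_socle_length:
  assumes R: "local_ring R" and nR: "noetherian_module R (reg_module R)" and P: "module R P"
    and xs: "set xs \<subseteq> max_ideal R" "weakly_regular P {\<zero>\<^bsub>P\<^esub>} xs" "length xs = the_enat (krull_dim R)"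
  defines "J \<equiv> foldl (adjoin_mult P) {\<zero>\<^bsub>P\<^esub>} xs"
  shows "CM_type R P = sub_len R P (colon_mod P J (max_ideal R)) J"
proof -
  note m = local_ring_max_ideal[OF R]
  interpret P: module R P by fact
  define t where "t = the_enat (krull_dim R)"
  obtain n d e where some: "(SOME (n, d, e). free_resolution R (residue_field R) n d e) = (n, d, e)"
    by (metis prod_cases3)
  have "free_resolution R (residue_field R) n d e"
    using someI_ex[of "\<lambda>(n, d, e). free_resolution R (residue_field R) n d e"]
      residue_field_free_resolution[OF R nR] unfolding some by auto
  then obtain \<epsilon> v\<^sub>0 where "residue_resolution R (max_ideal R) n d \<epsilon> v\<^sub>0"
    using residue_resolution_of_free_resolution[OF m(1,3)] unfolding residue_field_def by metis
  then interpret residue_resolution R "max_ideal R" n d \<epsilon> v\<^sub>0 .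
  interpret Ht: module R "ext_cochains R n P t" by (rule module_H) fact
  note N = P.zero_submodule
  have "CM_type R P = module_length R (quot_module
      ((ext_cochains R n P t)\<lparr>carrier := cocycles_mod R n d P t {\<zero>\<^bsub>P\<^esub>}\<rparr>) (coboundaries_mod R n d P t {\<zero>\<^bsub>P\<^esub>}))"
    unfolding CM_type_def Ext_module_def some t_def[symmetric]
    by (simp add: ext_cocycles_eq[OF P] ext_coboundaries_eq[OF P])
  also have "\<dots> = sub_len R (ext_cochains R n P t) (cocycles_mod R n d P t {\<zero>\<^bsub>P\<^esub>})
      (coboundaries_mod R n d P t {\<zero>\<^bsub>P\<^esub>})"
    by (intro Ht.module_length_subquotient cocycles_mod_submodule coboundaries_mod_submodule
        coboundaries_mod_subset P N)
  also have "\<dots> = sub_len R P (colon_mod P J (max_ideal R)) J"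
    using sub_len_regular_sequence[OF P N xs(1,2)] xs(3) by (simp add: J_def t_def)
  finally show ?thesis .
qed

subsection \<open>Depth and regular sequences\<close>

context module
begin

text \<open>Links the iterated quotients to the submodules in the definition of
  \<open>regular_sequence\<close>. The induction runs from the right because \<open>foldl\<close>
  adjoins the last element outermost.\<close>

lemma foldl_adjoin_mult_eq_set_smult:
  "set xs \<subseteq> carrier R \<Longrightarrow> foldl (adjoin_mult M) {\<zero>\<^bsub>M\<^esub>} xs = set_smult R M (set xs)"
proof (induction xs rule: rev_induct)
  case Nil
  have "module_span R M {} \<subseteq> {\<zero>\<^bsub>M\<^esub>}" by (rule module_span_minimal[OF zero_submodule]) simp
  moreover have "\<zero>\<^bsub>M\<^esub> \<in> module_span R M {}" by (rule submodule_zero, rule module_span_submodule) simp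
  ultimately show ?case by (auto simp: set_smult_def)
next
  case (snoc x xs)
  let ?G = "\<lambda>S. {a \<odot>\<^bsub>M\<^esub> y | a y. a \<in> S \<and> y \<in> carrier M}"
  let ?N = "set_smult R M (set xs)" and ?N' = "set_smult R M (set (xs @ [x]))"
  have x: "x \<in> carrier R" and xs: "set xs \<subseteq> carrier R" using snoc.prems by auto
  have N: "submodule ?N R M" and N': "submodule ?N' R M"
    unfolding set_smult_def using snoc.prems by (auto intro!: module_span_submodule)
  have gen: "a \<odot>\<^bsub>M\<^esub> y \<in> set_smult R M S" if "a \<in> S" "y \<in> carrier M" for a y S
    unfolding set_smult_def using that module_span_superset[of "?G S"] by blast
  have NN': "?N \<subseteq> ?N'"
    unfolding set_smult_def[of R M "set xs"] using gen by (intro module_span_minimal[OF N']) auto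
  have "adjoin_mult M ?N x = ?N'"
  proof
    show "adjoin_mult M ?N x \<subseteq> ?N'"
    proof
      fix z assume "z \<in> adjoin_mult M ?N x"
      then obtain y u where "y \<in> ?N" "u \<in> carrier M" "z = y \<oplus>\<^bsub>M\<^esub> x \<odot>\<^bsub>M\<^esub> u"
        by (auto simp: adjoin_mult_def)
      then show "z \<in> ?N'" using NN' gen[of x "set (xs @ [x])" u] submoduleE(5)[OF N'] by auto
    qed
    show "?N' \<subseteq> adjoin_mult M ?N x"
      unfolding set_smult_def[of R M "set (xs @ [x])"]
    proof (rule module_span_minimal[OF adjoin_mult_submodule[OF N x]], safe)
      fix a y assume a: "a \<in> set (xs @ [x])" and y: "y \<in> carrier M"
      show "a \<odot>\<^bsub>M\<^esub> y \<in> adjoin_mult M ?N x"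
      proof (cases "a = x")
        case True
        then show ?thesis using smult_mem_adjoin_mult[OF N x y] by simp
      next
        case False
        then have "a \<odot>\<^bsub>M\<^esub> y \<in> ?N" using a y by (intro gen) auto
        then show ?thesis using adjoin_mult_superset[OF N x] by blast
      qed
    qed
  qed
  then show ?case using snoc.IH[OF xs] by simp
qed

end

lemma weakly_regular_iff:
  "weakly_regular P N xs \<longleftrightarrow>
    (\<forall>i<length xs. nzd_mod P (foldl (adjoin_mult P) N (take i xs)) (xs ! i))"
proof (induction xs arbitrary: N)
  case (Cons x xs)
  show ?case
    by (auto simp: Cons.IH less_Suc_eq_0_disj)
qed simp

lemma (in module) regular_sequence_weakly_regular:
  assumes "regular_sequence R M xs"
  shows "weakly_regular M {\<zero>\<^bsub>M\<^esub>} xs"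
  unfolding weakly_regular_iff
proof (intro allI impI)
  fix i assume i: "i < length xs"
  have xs: "set xs \<subseteq> carrier R" using assms by (simp add: regular_sequence_def)
  then have t: "set (take i xs) \<subseteq> carrier R" using set_take_subset[of i xs] by blast
  have "submodule (set_smult R M (set (take i xs))) R M"
    unfolding set_smult_def using t by (intro module_span_submodule) auto
  moreover have "nonzerodivisor_on (quot_module M (set_smult R M (set (take i xs)))) (xs ! i)"
    using assms i by (simp add: regular_sequence_def)
  ultimately show "nzd_mod M (foldl (adjoin_mult M) {\<zero>\<^bsub>M\<^esub>} (take i xs)) (xs ! i)"
    using nonzerodivisor_on_quot_module xs i foldl_adjoin_mult_eq_set_smult[OF t]
    by (metis nth_mem subsetD)
qed

text \<open>Depth is a supremum, so it yields a regular sequence longer than t - 1, which is cut to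
  length t; initial segments stay weakly regular.\<close>

lemma depth_weakly_regular:
  assumes P: "module R P" and depth: "depth R P = krull_dim R" and nz: "carrier P \<noteq> {\<zero>\<^bsub>P\<^esub>}"
  obtains xs where "length xs = the_enat (krull_dim R)" "set xs \<subseteq> max_ideal R"
    "weakly_regular P {\<zero>\<^bsub>P\<^esub>} xs"
proof -
  interpret P: module R P by fact
  define t where "t = the_enat (krull_dim R)"
  show ?thesis
  proof (cases t)
    case 0
    then show ?thesis using that[of "[]"] by (simp add: t_def)
  next
    case (Suc s)
    \<comment> \<open>For a finite dimension this reads t - 1 < t; below infinity lies every natural
      number.\<close>
    have "enat s < krull_dim R"
      using Suc unfolding t_def by (cases "krull_dim R") auto
    then have "enat s < Sup {enat (length xs) | xs. set xs \<subseteq> max_ideal R \<and> regular_sequence R P xs}"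
      using depth nz by (simp add: depth_def)
    then obtain xs where xs: "enat s < enat (length xs)" "set xs \<subseteq> max_ideal R" "regular_sequence R P xs"
      unfolding less_Sup_iff by blast
    have w: "weakly_regular P {\<zero>\<^bsub>P\<^esub>} xs" by (rule P.regular_sequence_weakly_regular[OF xs(3)])
    show ?thesis
    proof (rule that[of "take t xs"])
      show "set (take t xs) \<subseteq> max_ideal R" using xs(2) set_take_subset[of t xs] by blast
      show "length (take t xs) = the_enat (krull_dim R)" using xs(1) Suc by (simp add: t_def)
      show "weakly_regular P {\<zero>\<^bsub>P\<^esub>} (take t xs)"
        using w unfolding weakly_regular_iff by (simp add: min_def)
    qed
  qed
qed

text \<open>A weakly regular sequence of full length gives the vanishing. The zero module, whose
  depth is infinite by convention, is treated apart: all its cochains vanish.\<close>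

lemma depth_ext_vanishes:
  assumes res: "residue_resolution R (max_ideal R) n d \<epsilon> v\<^sub>0" and P: "module R P"
    and depth: "depth R P = krull_dim R"
  shows "ext_vanishes R n d P (the_enat (krull_dim R)) {\<zero>\<^bsub>P\<^esub>}"
proof -
  interpret residue_resolution R "max_ideal R" n d \<epsilon> v\<^sub>0 by fact
  interpret P: module R P by fact
  note N = P.zero_submodule
  show ?thesis
  proof (cases "carrier P = {\<zero>\<^bsub>P\<^esub>}")
    case True
    have "f \<in> coboundaries_mod R n d P i {\<zero>\<^bsub>P\<^esub>}" if "f \<in> cocycles_mod R n d P i {\<zero>\<^bsub>P\<^esub>}" for f i
    proof -
      have f: "f \<in> carrier (ext_cochains R n P i)" using that by (simp add: cocycles_mod_def)
      have "f v = \<zero>\<^bsub>P\<^esub>" if "v \<in> carrier (F i)" for v using H_closed[OF P f that] True by simp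
      then show ?thesis
        unfolding coboundaries_mod_mem[OF P] using f
          module.submodule_zero[OF module_H[OF P] ext_coboundaries_submodule[OF P]]
        by (intro conjI bexI[of _ "\<zero>\<^bsub>ext_cochains R n P i\<^esub>"])
           (auto simp: H_eval[OF P] P.cong_mod_refl[OF N])
    qed
    then show ?thesis by (auto simp: ext_vanishes_def)
  next
    case False
    then show ?thesis
      using depth_weakly_regular[OF P depth] weakly_regular_ext_vanishes[OF P N] by metis
  qed
qed

section \<open>The idealization\<close>

lemma idealization_simps [simp]:
  "carrier (idealization R M) = carrier R \<times> carrier M"
  "\<zero>\<^bsub>idealization R M\<^esub> = (\<zero>\<^bsub>R\<^esub>, \<zero>\<^bsub>M\<^esub>)"
  "\<one>\<^bsub>idealization R M\<^esub> = (\<one>\<^bsub>R\<^esub>, \<zero>\<^bsub>M\<^esub>)"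
  "(a, x) \<oplus>\<^bsub>idealization R M\<^esub> (b, y) = (a \<oplus>\<^bsub>R\<^esub> b, x \<oplus>\<^bsub>M\<^esub> y)"
  "(a, x) \<otimes>\<^bsub>idealization R M\<^esub> (b, y) = (a \<otimes>\<^bsub>R\<^esub> b, a \<odot>\<^bsub>M\<^esub> y \<oplus>\<^bsub>M\<^esub> b \<odot>\<^bsub>M\<^esub> x)"
  by (simp_all add: idealization_def)

context module
begin

context
begin

private abbreviation "S \<equiv> idealization R M"

lemma cring_idealization: "cring S"
proof (rule cringI)
  show "abelian_group S"
  proof (rule abelian_groupI, goal_cases)
    case (6 x)
    then show ?case
      by (intro bexI[of _ "(\<ominus> fst x, \<ominus>\<^bsub>M\<^esub> snd x)"]) (auto simp: R.l_neg M.l_neg)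
  qed (auto simp: R.a_ac M.a_ac)
  show "comm_monoid S"
    by (rule comm_monoidI)
      (auto simp: R.m_ac smult_r_distr smult_assoc1 smult_left_commute M.a_ac)
qed (auto simp: R.l_distr smult_l_distr smult_r_distr M.a_ac)

lemma module_reg_idealization: "module S (reg_module S)"
  by (rule module_reg_module) (rule cring_idealization)

text \<open>Since (r, z)(a, x) = (ra, rx + az), stability under S amounts to stability under the
  scalars (r, 0) and under multiplication by the elements (0, z).\<close>

lemma submodule_idealization_iff:
  "submodule N S (reg_module S) \<longleftrightarrow>
    submodule N R (prod_module (reg_module R) M) \<and> (\<forall>(a, x)\<in>N. \<forall>z\<in>carrier M. (\<zero>, a \<odot>\<^bsub>M\<^esub> z) \<in> N)"
proof -
  interpret S: module S "reg_module S" by (rule module_reg_idealization)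
  interpret P: module R "prod_module (reg_module R) M"
    by (rule module_prod_module[OF module_reg_module[OF R.cring_axioms] module_axioms])
  show ?thesis
  proof (intro iffI conjI)
    assume N: "submodule N S (reg_module S)"
    have sub: "N \<subseteq> carrier R \<times> carrier M" using S.submoduleE(1)[OF N] by simp
    show "submodule N R (prod_module (reg_module R) M)"
    proof (rule P.submoduleI')
      show "u \<oplus>\<^bsub>prod_module (reg_module R) M\<^esub> v \<in> N" if "u \<in> N" "v \<in> N" for u v
        using S.submoduleE(5)[OF N that] by (cases u; cases v) simp
      show "r \<odot>\<^bsub>prod_module (reg_module R) M\<^esub> u \<in> N" if "r \<in> carrier R" "u \<in> N" for r u
        using S.submoduleE(4)[OF N, of "(r, \<zero>\<^bsub>M\<^esub>)" u] that sub by (cases u) auto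
    qed (use sub S.submodule_zero[OF N] in auto)
    show "\<forall>(a, x)\<in>N. \<forall>z\<in>carrier M. (\<zero>, a \<odot>\<^bsub>M\<^esub> z) \<in> N"
      using S.submoduleE(4)[OF N, of "(\<zero>, _)"] sub by fastforce
  next
    assume *: "submodule N R (prod_module (reg_module R) M) \<and> (\<forall>(a, x)\<in>N. \<forall>z\<in>carrier M. (\<zero>, a \<odot>\<^bsub>M\<^esub> z) \<in> N)"
    then have N: "submodule N R (prod_module (reg_module R) M)" by blast
    have sub: "N \<subseteq> carrier R \<times> carrier M" using P.submoduleE(1)[OF N] by simp
    show "submodule N S (reg_module S)"
    proof (rule S.submoduleI')
      show "u \<oplus>\<^bsub>reg_module S\<^esub> v \<in> N" if "u \<in> N" "v \<in> N" for u v
        using P.submoduleE(5)[OF N that] by (cases u; cases v) simp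
      show "u \<odot>\<^bsub>reg_module S\<^esub> v \<in> N" if u: "u \<in> carrier S" and v: "v \<in> N" for u v
      proof -
        obtain r z a x where e: "u = (r, z)" "v = (a, x)" by (cases u; cases v)
        then have c: "r \<in> carrier R" "z \<in> carrier M" "a \<in> carrier R" "x \<in> carrier M"
          using u v sub by auto
        have "r \<odot>\<^bsub>prod_module (reg_module R) M\<^esub> (a, x) \<in> N" "(\<zero>, a \<odot>\<^bsub>M\<^esub> z) \<in> N"
          using P.submoduleE(4)[OF N c(1)] v * c(2) unfolding e by auto
        then show ?thesis
          using P.submoduleE(5)[OF N, of "(r \<otimes> a, r \<odot>\<^bsub>M\<^esub> x)" "(\<zero>, a \<odot>\<^bsub>M\<^esub> z)"] c e by simp
      qed
    qed (use sub P.submodule_zero[OF N] in auto)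
  qed
qed

lemma submodule_idealization_Times:
  assumes U: "submodule U R (reg_module R)" and W: "submodule W R M"
    and UW: "\<And>a z. \<lbrakk>a \<in> U; z \<in> carrier M\<rbrakk> \<Longrightarrow> a \<odot>\<^bsub>M\<^esub> z \<in> W"
  shows "submodule (U \<times> W) S (reg_module S)"
proof -
  note reg = module_reg_module[OF R.cring_axioms]
  show ?thesis
    unfolding submodule_idealization_iff
    using submodule_Times[OF reg module_axioms U W] module.submodule_zero[OF reg U] UW by auto
qed

text \<open>Ideals of S are in particular R-submodules of R x M, which is noetherian over R.\<close>

lemma noetherian_idealization:
  assumes "noetherian_module R (reg_module R)" "noetherian_module R M"
  shows "noetherian_module S (reg_module S)"
  unfolding noetherian_module_def[of S]
proof (intro allI impI)
  fix \<C> assume "\<C> \<noteq> {}" "\<forall>N\<in>\<C>. submodule N S (reg_module S)"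
  then have "\<exists>N. N \<in> \<C> \<and> (\<forall>N'. N' \<in> \<C> \<longrightarrow> N \<subseteq> N' \<longrightarrow> N' = N)"
    by (intro noetherian_moduleD[OF noetherian_prod_module[OF
          module_reg_module[OF R.cring_axioms] module_axioms assms]])
      (auto simp: submodule_idealization_iff)
  then show "\<exists>N\<in>\<C>. \<forall>N'\<in>\<C>. N \<subseteq> N' \<longrightarrow> N' = N" by blast
qed

subsection \<open>Prime and maximal ideals\<close>

lemma ideal_idealization_Times:
  assumes "ideal I R" shows "ideal (I \<times> carrier M) S"
proof -
  have "submodule (I \<times> carrier M) S (reg_module S)"
    using assms submodule_reg_module_iff[OF R.cring_axioms] carrier_is_submodule ideal.Icarr[OF assms]
    by (intro submodule_idealization_Times) auto
  then show ?thesis using submodule_reg_module_iff[OF cring_idealization] by blast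
qed

lemma ideal_fst_idealization:
  assumes I: "ideal I S" shows "ideal (fst ` I) R"
proof -
  note reg = module_reg_module[OF R.cring_axioms]
  have "submodule I R (prod_module (reg_module R) M)"
    using I submodule_reg_module_iff[OF cring_idealization] submodule_idealization_iff by blast
  moreover have "module_hom R (prod_module (reg_module R) M) (reg_module R) fst"
    by (rule module_homI) auto
  ultimately have "submodule (fst ` I) R (reg_module R)"
    using module_hom_image[OF module_prod_module[OF reg module_axioms] reg] by blast
  then show ?thesis using submodule_reg_module_iff[OF R.cring_axioms] by blast
qed

text \<open>Two elements with the same first component differ by an element of 0 x M.\<close>

lemma ideal_idealization_eq_Times:
  assumes I: "ideal I S" and M: "{\<zero>} \<times> carrier M \<subseteq> I"
  shows "I = fst ` I \<times> carrier M"
proof -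
  have sub: "I \<subseteq> carrier R \<times> carrier M" using ideal.Icarr[OF I] by auto
  have "(a, y) \<in> I" if ax: "(a, x) \<in> I" and y: "y \<in> carrier M" for a x y
  proof -
    have c: "a \<in> carrier R" "x \<in> carrier M" using ax sub by auto
    have "(\<zero>, y \<ominus>\<^bsub>M\<^esub> x) \<in> I" using M c y by auto
    then have "(a, x) \<oplus>\<^bsub>S\<^esub> (\<zero>, y \<ominus>\<^bsub>M\<^esub> x) \<in> I"
      by (rule additive_subgroup.a_closed[OF ideal.axioms(1)[OF I] ax])
    then show ?thesis using c y by (simp add: M.minus_eq M.a_comm[of y] M.r_neg2)
  qed
  then show ?thesis using sub by force
qed

text \<open>The ideal \<open>0 \<times> M\<close> squares to zero, so it lies in every prime ideal.\<close>

lemma primeideal_idealization_iff: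
  "primeideal Q S \<longleftrightarrow> (\<exists>P. primeideal P R \<and> Q = P \<times> carrier M)"
proof
  assume Q: "primeideal Q S"
  then have I: "ideal Q S" by (rule primeideal.axioms(1))
  have "(\<zero>, x) \<in> Q" if "x \<in> carrier M" for x
  proof -
    have "(\<zero>, x) \<otimes>\<^bsub>S\<^esub> (\<zero>, x) \<in> Q"
      using that additive_subgroup.zero_closed[OF ideal.axioms(1)[OF I]] by simp
    then show ?thesis using primeideal.I_prime[OF Q, of "(\<zero>, x)" "(\<zero>, x)"] that by auto
  qed
  then have eq: "Q = fst ` Q \<times> carrier M" by (intro ideal_idealization_eq_Times[OF I]) auto
  have "primeideal (fst ` Q) R"
  proof (rule primeidealI[OF ideal_fst_idealization[OF I] R.cring_axioms])
    show "carrier R \<noteq> fst ` Q"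
    proof
      assume "carrier R = fst ` Q"
      then have "carrier S = Q" by (subst eq) simp
      then show False using primeideal.I_notcarr[OF Q] by simp
    qed
    fix a b assume ab: "a \<in> carrier R" "b \<in> carrier R" "a \<otimes> b \<in> fst ` Q"
    then have "(a, \<zero>\<^bsub>M\<^esub>) \<otimes>\<^bsub>S\<^esub> (b, \<zero>\<^bsub>M\<^esub>) \<in> Q" by (subst eq) simp
    then have "(a, \<zero>\<^bsub>M\<^esub>) \<in> Q \<or> (b, \<zero>\<^bsub>M\<^esub>) \<in> Q"
      using primeideal.I_prime[OF Q, of "(a, \<zero>\<^bsub>M\<^esub>)" "(b, \<zero>\<^bsub>M\<^esub>)"] ab by simp
    then show "a \<in> fst ` Q \<or> b \<in> fst ` Q" by force
  qed
  then show "\<exists>P. primeideal P R \<and> Q = P \<times> carrier M" using eq by blast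
next
  assume "\<exists>P. primeideal P R \<and> Q = P \<times> carrier M"
  then obtain P where P: "primeideal P R" "Q = P \<times> carrier M" by blast
  have sub: "P \<subseteq> carrier R" using ideal.Icarr[OF primeideal.axioms(1)[OF P(1)]] by blast
  show "primeideal Q S"
    unfolding P(2)
  proof (rule primeidealI[OF ideal_idealization_Times[OF primeideal.axioms(1)[OF P(1)]] cring_idealization])
    show "carrier S \<noteq> P \<times> carrier M"
      using primeideal.I_notcarr[OF P(1)] M.zero_closed by auto
    fix u v assume "u \<in> carrier S" "v \<in> carrier S" "u \<otimes>\<^bsub>S\<^esub> v \<in> P \<times> carrier M"
    then show "u \<in> P \<times> carrier M \<or> v \<in> P \<times> carrier M"
      using primeideal.I_prime[OF P(1)] by (cases u; cases v) auto
  qed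
qed

text \<open>Maximal ideals are prime, hence of the form P x M, and every ideal above such a product
  is again a product with M.\<close>

lemma maximalideal_idealization_iff:
  "maximalideal Q S \<longleftrightarrow> (\<exists>P. maximalideal P R \<and> Q = P \<times> carrier M)"
proof
  assume Q: "maximalideal Q S"
  interpret S: cring S by (rule cring_idealization)
  obtain P where P: "primeideal P R" "Q = P \<times> carrier M"
    using S.maximalideal_prime[OF Q] primeideal_idealization_iff by blast
  have "maximalideal P R"
  proof (rule maximalidealI[OF primeideal.axioms(1)[OF P(1)]])
    show "carrier R \<noteq> P" using primeideal.I_notcarr[OF P(1)] .
    fix J assume J: "ideal J R" "P \<subseteq> J" "J \<subseteq> carrier R"
    then have "J \<times> carrier M = Q \<or> J \<times> carrier M = carrier S"
      using maximalideal.I_maximal[OF Q ideal_idealization_Times[OF J(1)]] P(2) by auto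
    then show "J = P \<or> J = carrier R" using P(2) M.zero_closed by (auto simp: times_eq_iff)
  qed
  then show "\<exists>P. maximalideal P R \<and> Q = P \<times> carrier M" using P(2) by blast
next
  assume "\<exists>P. maximalideal P R \<and> Q = P \<times> carrier M"
  then obtain P where P: "maximalideal P R" "Q = P \<times> carrier M" by blast
  have I: "ideal P R" by (rule maximalideal.axioms(1)[OF P(1)])
  show "maximalideal Q S"
    unfolding P(2)
  proof (rule maximalidealI[OF ideal_idealization_Times[OF I]])
    show "carrier S \<noteq> P \<times> carrier M"
      using maximalideal.I_notcarr[OF P(1)] M.zero_closed by auto
    fix J assume J: "ideal J S" "P \<times> carrier M \<subseteq> J" "J \<subseteq> carrier S"
    have "{\<zero>} \<times> carrier M \<subseteq> J"
      using J(2) additive_subgroup.zero_closed[OF ideal.axioms(1)[OF I]] by auto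
    then have eq: "J = fst ` J \<times> carrier M" by (rule ideal_idealization_eq_Times[OF J(1)])
    have "P \<subseteq> fst ` J"
    proof
      fix a assume "a \<in> P"
      then have "(a, \<zero>\<^bsub>M\<^esub>) \<in> J" using J(2) by auto
      then show "a \<in> fst ` J" by force
    qed
    moreover have "fst ` J \<subseteq> carrier R" using J(3) by auto
    ultimately have "fst ` J = P \<or> fst ` J = carrier R"
      by (rule maximalideal.I_maximal[OF P(1) ideal_fst_idealization[OF J(1)]])
    then show "J = P \<times> carrier M \<or> J = carrier S" using eq by auto
  qed
qed

lemma local_idealization:
  assumes "local_ring R"
  shows "local_ring S" "max_ideal S = max_ideal R \<times> carrier M"
proof -
  have ex1: "\<exists>!I. maximalideal I R" using assms by (simp add: local_ring_def)
  then have max: "I = max_ideal R" if "maximalideal I R" for I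
    using that local_ring_max_ideal(2)[OF assms] by blast
  have m: "maximalideal (max_ideal R \<times> carrier M) S"
    using local_ring_max_ideal(2)[OF assms] maximalideal_idealization_iff by blast
  moreover have uniq: "Q = max_ideal R \<times> carrier M" if "maximalideal Q S" for Q
    using that max unfolding maximalideal_idealization_iff by metis
  ultimately show "local_ring S" using cring_idealization unfolding local_ring_def by metis
  show "max_ideal S = max_ideal R \<times> carrier M"
    unfolding max_ideal_def[of S] using m uniq by (rule the_equality)
qed

lemma krull_dim_eq_chain_len: "krull_dim T = chain_len {P. primeideal P T}"
  by (simp add: krull_dim_def chain_len_def)

text \<open>Projection to R and product with M are strictly monotone on primes, in opposite
  directions.\<close>

lemma krull_dim_idealization: "krull_dim S = krull_dim R"
  unfolding krull_dim_eq_chain_len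
proof (rule antisym)
  have ne: "carrier M \<noteq> {}" using M.zero_closed by blast
  show "chain_len {P. primeideal P S} \<le> chain_len {P. primeideal P R}"
  proof (rule chain_len_mono[where \<Phi> = "\<lambda>Q. fst ` Q"])
    show "fst ` Q \<in> {P. primeideal P R}" if "Q \<in> {P. primeideal P S}" for Q
      using that by (auto simp: primeideal_idealization_iff ne)
    show "fst ` P \<subset> fst ` Q" if "P \<in> {P. primeideal P S}" "Q \<in> {P. primeideal P S}" "P \<subset> Q" for P Q
      using that by (auto simp: primeideal_idealization_iff ne)
  qed
  show "chain_len {P. primeideal P R} \<le> chain_len {P. primeideal P S}"
  proof (rule chain_len_mono[where \<Phi> = "\<lambda>Q. Q \<times> carrier M"])
    show "P \<times> carrier M \<subset> Q \<times> carrier M" if "P \<subset> Q" for P Q :: "'a set"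
      using that ne by blast
  qed (auto simp: primeideal_idealization_iff)
qed

subsection \<open>Regular sequences and socle\<close>

text \<open>The element (x, 0) acts on R x M as x in each component.\<close>

lemma adjoin_mult_idealization:
  assumes x: "x \<in> carrier R" and N: "N \<subseteq> carrier R" and L: "L \<subseteq> carrier M"
  shows "adjoin_mult (reg_module S) (N \<times> L) (x, \<zero>\<^bsub>M\<^esub>) =
    adjoin_mult (reg_module R) N x \<times> adjoin_mult M L x"
  using assms by (force simp: adjoin_mult_def)

lemma weakly_regular_idealization:
  assumes "set xs \<subseteq> carrier R" "submodule N R (reg_module R)" "submodule L R M"
    and "weakly_regular (reg_module R) N xs" "weakly_regular M L xs"
  shows "weakly_regular (reg_module S) (N \<times> L) (map (\<lambda>x. (x, \<zero>\<^bsub>M\<^esub>)) xs) \<and>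
    foldl (adjoin_mult (reg_module S)) (N \<times> L) (map (\<lambda>x. (x, \<zero>\<^bsub>M\<^esub>)) xs) =
      foldl (adjoin_mult (reg_module R)) N xs \<times> foldl (adjoin_mult M) L xs"
  using assms
proof (induction xs arbitrary: N L)
  case (Cons x xs)
  interpret reg: module R "reg_module R" by (rule module_reg_module) (rule R.cring_axioms)
  have x: "x \<in> carrier R" using Cons.prems by simp
  have sub: "N \<subseteq> carrier R" "L \<subseteq> carrier M"
    using reg.submoduleE(1)[OF Cons.prems(2)] submoduleE(1)[OF Cons.prems(3)] by auto
  have "nzd_mod (reg_module S) (N \<times> L) (x, \<zero>\<^bsub>M\<^esub>)"
    using Cons.prems x by (auto simp: nzd_mod_def)
  then show ?case
    using Cons.IH[of "adjoin_mult (reg_module R) N x" "adjoin_mult M L x"] Cons.prems x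
      adjoin_mult_idealization[OF x sub] reg.adjoin_mult_submodule[OF Cons.prems(2) x]
      adjoin_mult_submodule[OF Cons.prems(3) x]
    by simp
qed simp

text \<open>An intermediate ideal C is measured by its projection to R and its intersection with 0 x
  M. Conversely A x B is an ideal of S because elements of A, lying in U, carry M into L and hence
  into B.\<close>

lemma sub_len_idealization:
  assumes U: "submodule U R (reg_module R)" and J: "submodule J R (reg_module R)" "J \<subseteq> U"
    and W: "submodule W R M" and L: "submodule L R M" "L \<subseteq> W"
    and UL: "\<And>a z. \<lbrakk>a \<in> U; z \<in> carrier M\<rbrakk> \<Longrightarrow> a \<odot>\<^bsub>M\<^esub> z \<in> L"
  shows "sub_len S (reg_module S) (U \<times> W) (J \<times> L) = sub_len R (reg_module R) U J + sub_len R M W L"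
proof -
  note reg = module_reg_module[OF R.cring_axioms]
  interpret reg: module R "reg_module R" by (rule reg)
  interpret P: module R "prod_module (reg_module R) M" by (rule module_prod_module[OF reg module_axioms])
  let ?\<C> = "{N. submodule N S (reg_module S) \<and> J \<times> L \<subseteq> N \<and> N \<subseteq> U \<times> W}"
  let ?\<A> = "{N. submodule N R (reg_module R) \<and> J \<subseteq> N \<and> N \<subseteq> U}"
  let ?\<B> = "{N. submodule N R M \<and> L \<subseteq> N \<and> N \<subseteq> W}"
  let ?p = "\<lambda>C. fst ` C" and ?q = "\<lambda>C. {y \<in> carrier M. (\<zero>, y) \<in> C}"
  have hom1: "module_hom R (prod_module (reg_module R) M) (reg_module R) fst"
    and hom2: "module_hom R M (prod_module (reg_module R) M) (\<lambda>y. (\<zero>, y))"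
    by (rule module_homI; auto)+
  have subP: "submodule C R (prod_module (reg_module R) M)" if "C \<in> ?\<C>" for C
    using that submodule_idealization_iff by blast
  show ?thesis
    unfolding sub_len_def
  proof (rule chain_len_add[where p = ?p and q = ?q and J = "\<lambda>A B. A \<times> B"])
    show "?\<A> \<noteq> {}" "?\<B> \<noteq> {}" using J L by auto
    show "?p C \<in> ?\<A>" if C: "C \<in> ?\<C>" for C
    proof -
      have "J \<subseteq> fst ` C"
      proof
        fix a assume "a \<in> J"
        then have "(a, \<zero>\<^bsub>M\<^esub>) \<in> C" using C submodule_zero[OF L(1)] by blast
        then show "a \<in> fst ` C" by force
      qed
      then show ?thesis
        using C module_hom_image[OF P.module_axioms reg hom1 subP[OF C]] by auto
    qed
    show "?q C \<in> ?\<B>" if C: "C \<in> ?\<C>" for C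
    proof -
      have "L \<subseteq> ?q C" using C submoduleE(1)[OF L(1)] reg.submodule_zero[OF J(1)] by auto
      then show ?thesis
        using C module_hom_vimage[OF module_axioms P.module_axioms hom2 subP[OF C]] by auto
    qed
    show "?p C \<subseteq> ?p D \<and> ?q C \<subseteq> ?q D \<and> (?p C \<noteq> ?p D \<or> ?q C \<noteq> ?q D)"
      if C: "C \<in> ?\<C>" "D \<in> ?\<C>" "C \<subset> D" for C D
    proof (intro conjI)
      show "?p C \<noteq> ?p D \<or> ?q C \<noteq> ?q D"
      proof (rule ccontr)
        assume "\<not> (?p C \<noteq> ?p D \<or> ?q C \<noteq> ?q D)"
        then have eq: "?p C = ?p D" "?q C = ?q D" by auto
        \<comment> \<open>For (a, x) in D there is some (a, y) in C; the difference (0, x - y) lies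
          in D, hence in C because the intersections with 0 x M agree.\<close>
        have "D \<subseteq> C"
        proof
          fix u assume u: "u \<in> D"
          obtain a x where ax: "u = (a, x)" by (cases u)
          then have "a \<in> ?p C" using u eq(1) by force
          then obtain y where y: "(a, y) \<in> C" by auto
          have c: "a \<in> carrier R" "x \<in> carrier M" "y \<in> carrier M"
            using u y ax P.submoduleE(1)[OF subP[OF C(1)]] P.submoduleE(1)[OF subP[OF C(2)]] by auto
          have "(a, y) \<in> D" using y C(3) by blast
          then have "(\<ominus> \<one>) \<odot>\<^bsub>prod_module (reg_module R) M\<^esub> (a, y) \<in> D"
            by (intro P.submoduleE(4)[OF subP[OF C(2)]]) auto
          then have "(a, x) \<oplus>\<^bsub>prod_module (reg_module R) M\<^esub> (\<ominus> \<one>) \<odot>\<^bsub>prod_module (reg_module R) M\<^esub> (a, y) \<in> D"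
            using u ax P.submoduleE(5)[OF subP[OF C(2)]] by blast
          then have "(\<zero>, x \<ominus>\<^bsub>M\<^esub> y) \<in> D"
            using c by (simp add: smult_l_minus M.minus_eq R.l_minus R.r_neg)
          then have "(\<zero>, x \<ominus>\<^bsub>M\<^esub> y) \<in> C" using eq(2) c by blast
          then have "(a, y) \<oplus>\<^bsub>prod_module (reg_module R) M\<^esub> (\<zero>, x \<ominus>\<^bsub>M\<^esub> y) \<in> C"
            using y P.submoduleE(5)[OF subP[OF C(1)]] by blast
          then show "u \<in> C" using ax c by (simp add: M.minus_eq M.a_comm[of x] M.r_neg2)
        qed
        then show False using C(3) by blast
      qed
    qed (use C(3) in auto)
    show "A \<times> B \<in> ?\<C>" if AB: "A \<in> ?\<A>" "B \<in> ?\<B>" for A B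
    proof -
      have "a \<odot>\<^bsub>M\<^esub> z \<in> B" if "a \<in> A" "z \<in> carrier M" for a z
        using UL[of a z] that AB by blast
      then have "submodule (A \<times> B) S (reg_module S)"
        using AB by (intro submodule_idealization_Times) auto
      then show ?thesis using AB by blast
    qed
    show "A \<times> B \<subset> A' \<times> B" if "A \<in> ?\<A>" "A' \<in> ?\<A>" "B \<in> ?\<B>" "A \<subset> A'" for A A' B
      using that submodule_zero[of B] by blast
    show "A \<times> B \<subset> A \<times> B'" if "A \<in> ?\<A>" "B \<in> ?\<B>" "B' \<in> ?\<B>" "B \<subset> B'" for A B B'
      using that reg.submodule_zero[of A] by blast
  qed
qed

text \<open>In (b, z)(a, x) = (ba, bx + az) the choice b = 0 isolates az and z = 0 isolates bx. The
  condition that a carries M into L thus comes from the part 0 x M of the maximal ideal.\<close>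

lemma colon_idealization:
  assumes J: "submodule J R (reg_module R)" and L: "submodule L R M"
    and I: "I \<subseteq> carrier R" "\<zero> \<in> I"
  shows "colon_mod (reg_module S) (J \<times> L) (I \<times> carrier M) =
    {a \<in> colon_mod (reg_module R) J I. \<forall>z\<in>carrier M. a \<odot>\<^bsub>M\<^esub> z \<in> L} \<times> colon_mod M L I"
proof -
  interpret reg: module R "reg_module R" by (rule module_reg_module) (rule R.cring_axioms)
  have "(\<forall>b\<in>I. \<forall>z\<in>carrier M. b \<otimes> a \<in> J \<and> b \<odot>\<^bsub>M\<^esub> x \<oplus>\<^bsub>M\<^esub> a \<odot>\<^bsub>M\<^esub> z \<in> L) \<longleftrightarrow>
    (\<forall>b\<in>I. b \<otimes> a \<in> J) \<and> (\<forall>z\<in>carrier M. a \<odot>\<^bsub>M\<^esub> z \<in> L) \<and> (\<forall>b\<in>I. b \<odot>\<^bsub>M\<^esub> x \<in> L)" (is "?l \<longleftrightarrow> ?r")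
    if c: "a \<in> carrier R" "x \<in> carrier M" for a x
  proof
    assume l: ?l
    have "a \<odot>\<^bsub>M\<^esub> z \<in> L" if "z \<in> carrier M" for z
      using l I(2) that c by (auto dest!: bspec[of I _ \<zero>])
    moreover have "b \<odot>\<^bsub>M\<^esub> x \<in> L" if "b \<in> I" for b
    proof -
      have "b \<odot>\<^bsub>M\<^esub> x \<oplus>\<^bsub>M\<^esub> a \<odot>\<^bsub>M\<^esub> \<zero>\<^bsub>M\<^esub> \<in> L" using l that by blast
      then show ?thesis using that I(1) c by (auto simp: subset_iff)
    qed
    ultimately show ?r using l M.zero_closed by blast
  next
    assume ?r then show ?l using submoduleE(5)[OF L] by blast
  qed
  note eq = this
  show ?thesis
  proof (rule Set.set_eqI)
    fix u :: "'a \<times> 'c"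
    obtain a x where u: "u = (a, x)" by (cases u)
    show "u \<in> colon_mod (reg_module S) (J \<times> L) (I \<times> carrier M) \<longleftrightarrow>
      u \<in> {a \<in> colon_mod (reg_module R) J I. \<forall>z\<in>carrier M. a \<odot>\<^bsub>M\<^esub> z \<in> L} \<times> colon_mod M L I"
      using eq[of a x] unfolding u by (simp add: colon_mod_def) blast
  qed
qed

end

end

section \<open>Regular sequences and short exact sequences\<close>

text \<open>The snake lemma for multiplication by \<open>x\<close>: if \<open>x\<close> is regular on the two right-hand modules of
  \<open>0 \<rightarrow> M/N\<^sub>M \<rightarrow> F/N\<^sub>F \<rightarrow> X/N\<^sub>X \<rightarrow> 0\<close>, it is regular on the left one, and the sequence stays exact
  modulo \<open>x\<close>. Exactness is encoded by the two hypotheses on the submodules.\<close>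

lemma short_exact_adjoin_mult:
  assumes M: "module R M" and F: "module R F" and X: "module R X" and ex: "short_exact R M f F g X"
    and N\<^sub>M: "submodule N\<^sub>M R M" and N\<^sub>F: "submodule N\<^sub>F R F" and N\<^sub>X: "submodule N\<^sub>X R X"
    and pre: "\<And>z. z \<in> carrier M \<Longrightarrow> f z \<in> N\<^sub>F \<longleftrightarrow> z \<in> N\<^sub>M" and img: "g ` N\<^sub>F = N\<^sub>X"
    and x: "x \<in> carrier R" and reg: "nzd_mod F N\<^sub>F x" "nzd_mod X N\<^sub>X x"
  shows "nzd_mod M N\<^sub>M x"
    and "\<And>z. z \<in> carrier M \<Longrightarrow> f z \<in> adjoin_mult F N\<^sub>F x \<longleftrightarrow> z \<in> adjoin_mult M N\<^sub>M x"
    and "g ` adjoin_mult F N\<^sub>F x = adjoin_mult X N\<^sub>X x"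
proof -
  interpret M: module R M by fact
  interpret F: module R F by fact
  interpret X: module R X by fact
  have f: "module_hom R M F f" and g: "module_hom R F X g"
    and ker: "f ` carrier M = a_kernel F X g" and surj: "g ` carrier F = carrier X"
    using ex by (auto simp: short_exact_def)
  note fc = module_hom_closed[OF f] and gc = module_hom_closed[OF g]
  have gf: "g (f z) = \<zero>\<^bsub>X\<^esub>" if "z \<in> carrier M" for z
  proof -
    have "f z \<in> a_kernel F X g" using that ker by blast
    then show ?thesis by (simp add: a_kernel_def')
  qed
  note N\<^sub>Fc = F.submoduleE(1)[OF N\<^sub>F]
  show "nzd_mod M N\<^sub>M x"
    unfolding nzd_mod_def
  proof (intro ballI impI)
    fix z assume z: "z \<in> carrier M" "x \<odot>\<^bsub>M\<^esub> z \<in> N\<^sub>M"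
    then have "f (x \<odot>\<^bsub>M\<^esub> z) \<in> N\<^sub>F" using pre[of "x \<odot>\<^bsub>M\<^esub> z"] x by simp
    then have "f z \<in> N\<^sub>F" using reg(1) fc z(1) module_hom_smult[OF f x z(1)] by (simp add: nzd_mod_def)
    then show "z \<in> N\<^sub>M" using pre[OF z(1)] by simp
  qed
  show "g ` adjoin_mult F N\<^sub>F x = adjoin_mult X N\<^sub>X x"
  proof
    show "g ` adjoin_mult F N\<^sub>F x \<subseteq> adjoin_mult X N\<^sub>X x"
    proof
      fix u assume "u \<in> g ` adjoin_mult F N\<^sub>F x"
      then obtain y w where yw: "w \<in> carrier F" "y \<in> N\<^sub>F" "u = g (y \<oplus>\<^bsub>F\<^esub> x \<odot>\<^bsub>F\<^esub> w)"
        by (auto simp: adjoin_mult_def)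
      then have "u = g y \<oplus>\<^bsub>X\<^esub> x \<odot>\<^bsub>X\<^esub> g w"
        using N\<^sub>Fc x by (auto simp: module_hom_add[OF g] module_hom_smult[OF g])
      then show "u \<in> adjoin_mult X N\<^sub>X x"
        using yw img gc unfolding adjoin_mult_def by blast
    qed
    show "adjoin_mult X N\<^sub>X x \<subseteq> g ` adjoin_mult F N\<^sub>F x"
    proof
      fix u assume "u \<in> adjoin_mult X N\<^sub>X x"
      then obtain y w where yw: "w \<in> carrier X" "y \<in> N\<^sub>X" "u = y \<oplus>\<^bsub>X\<^esub> x \<odot>\<^bsub>X\<^esub> w"
        by (auto simp: adjoin_mult_def)
      obtain y' w' where yw': "w' \<in> carrier F" "w = g w'" "y' \<in> N\<^sub>F" "y = g y'"
        using yw img surj by blast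
      then have "u = g (y' \<oplus>\<^bsub>F\<^esub> x \<odot>\<^bsub>F\<^esub> w')"
        using yw(3) N\<^sub>Fc x by (auto simp: module_hom_add[OF g] module_hom_smult[OF g])
      then show "u \<in> g ` adjoin_mult F N\<^sub>F x" using yw' unfolding adjoin_mult_def by blast
    qed
  qed
  show "f z \<in> adjoin_mult F N\<^sub>F x \<longleftrightarrow> z \<in> adjoin_mult M N\<^sub>M x" if z: "z \<in> carrier M" for z
  proof
    assume "z \<in> adjoin_mult M N\<^sub>M x"
    then obtain y w where yw: "w \<in> carrier M" "y \<in> N\<^sub>M" "z = y \<oplus>\<^bsub>M\<^esub> x \<odot>\<^bsub>M\<^esub> w"
      by (auto simp: adjoin_mult_def)
    have y: "y \<in> carrier M" using yw(2) M.submoduleE(1)[OF N\<^sub>M] by blast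
    have "f z = f y \<oplus>\<^bsub>F\<^esub> x \<odot>\<^bsub>F\<^esub> f w"
      using yw(1,3) y x by (simp add: module_hom_add[OF f] module_hom_smult[OF f])
    moreover have "f y \<in> N\<^sub>F" using pre[OF y] yw(2) by simp
    ultimately show "f z \<in> adjoin_mult F N\<^sub>F x" using fc[OF yw(1)] unfolding adjoin_mult_def by blast
  next
    assume "f z \<in> adjoin_mult F N\<^sub>F x"
    then obtain y w where yw: "w \<in> carrier F" "y \<in> N\<^sub>F" "f z = y \<oplus>\<^bsub>F\<^esub> x \<odot>\<^bsub>F\<^esub> w"
      by (auto simp: adjoin_mult_def)
    have y: "y \<in> carrier F" using yw(2) N\<^sub>Fc by blast
    \<comment> \<open>Applying g to f(z) = y + x w shows that x g(w) lies in
      \<open>N\<^sub>X\<close>, so g(w) does too. Subtracting from w a suitable u in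
      \<open>N\<^sub>F\<close> puts it into the kernel of g, which is the image of M.\<close>
    have "\<zero>\<^bsub>X\<^esub> = g y \<oplus>\<^bsub>X\<^esub> x \<odot>\<^bsub>X\<^esub> g w"
      using gf[OF z] yw y x by (simp add: module_hom_add[OF g] module_hom_smult[OF g])
    moreover have gy: "g y \<in> N\<^sub>X" using img yw(2) by blast
    ultimately have "x \<odot>\<^bsub>X\<^esub> g w \<in> N\<^sub>X"
      using X.submodule_cancel_left[OF N\<^sub>X gy, of "x \<odot>\<^bsub>X\<^esub> g w"] X.submodule_zero[OF N\<^sub>X] x gc[OF yw(1)]
      by simp
    then have "g w \<in> N\<^sub>X" using reg(2) gc[OF yw(1)] by (simp add: nzd_mod_def)
    then obtain u where u: "u \<in> N\<^sub>F" "g w = g u" using img by blast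
    have uc: "u \<in> carrier F" using u N\<^sub>Fc by blast
    have "g (w \<ominus>\<^bsub>F\<^esub> u) = \<zero>\<^bsub>X\<^esub>"
      using module_hom_minus[OF F X g yw(1) uc] u(2) gc[OF uc] by (simp add: X.M.minus_eq X.M.r_neg)
    then have "w \<ominus>\<^bsub>F\<^esub> u \<in> a_kernel F X g" using yw(1) uc by (simp add: a_kernel_def')
    then obtain z' where z': "z' \<in> carrier M" "f z' = w \<ominus>\<^bsub>F\<^esub> u" using ker by (metis imageE)
    have "cong_mod F N\<^sub>F (f z) (\<zero>\<^bsub>F\<^esub> \<oplus>\<^bsub>F\<^esub> x \<odot>\<^bsub>F\<^esub> w)"
      unfolding yw(3) using yw y x
      by (intro F.cong_mod_add[OF N\<^sub>F] F.cong_mod_refl[OF N\<^sub>F]) (auto simp: F.cong_mod_zero_iff[OF N\<^sub>F])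
    then have "cong_mod F N\<^sub>F (f z) (x \<odot>\<^bsub>F\<^esub> w)" using x yw(1) by simp
    moreover have "cong_mod F N\<^sub>F (x \<odot>\<^bsub>F\<^esub> w) (x \<odot>\<^bsub>F\<^esub> f z')"
    proof (rule F.cong_mod_smult[OF N\<^sub>F _ x])
      have "w \<ominus>\<^bsub>F\<^esub> (w \<ominus>\<^bsub>F\<^esub> u) = u"
        using yw(1) uc by (simp add: F.M.minus_eq F.M.minus_add F.M.r_neg1 F.M.a_assoc[symmetric] F.M.r_neg)
      then show "cong_mod F N\<^sub>F w (f z')" using z' yw(1) uc u(1) by (simp add: cong_mod_def)
    qed
    ultimately have "cong_mod F N\<^sub>F (f z) (f (x \<odot>\<^bsub>M\<^esub> z'))"
      using F.cong_mod_trans[OF N\<^sub>F] module_hom_smult[OF f x z'(1)] by simp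
    \<comment> \<open>With w replaced by f(z') modulo \<open>N\<^sub>F\<close>, the congruence is
      between images of elements of M, and \<open>pre\<close> brings it back to M.\<close>
    then have "f (z \<ominus>\<^bsub>M\<^esub> x \<odot>\<^bsub>M\<^esub> z') \<in> N\<^sub>F"
      using module_hom_minus[OF M F f z, of "x \<odot>\<^bsub>M\<^esub> z'"] x z' by (simp add: cong_mod_def)
    then have "cong_mod M N\<^sub>M z (x \<odot>\<^bsub>M\<^esub> z')"
      using pre[of "z \<ominus>\<^bsub>M\<^esub> x \<odot>\<^bsub>M\<^esub> z'"] x z z' by (simp add: cong_mod_def)
    then show "z \<in> adjoin_mult M N\<^sub>M x" unfolding M.adjoin_mult_iff[OF N\<^sub>M x] using z' by blast
  qed
qed

text \<open>One step of the snake argument reproduces its two compatibility conditions. Started from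
  zero submodules, the second conclusion is xF \<inter> M = xM.\<close>

lemma short_exact_weakly_regular:
  assumes M: "module R M" and F: "module R F" and X: "module R X" and ex: "short_exact R M f F g X"
    and "submodule N\<^sub>M R M" "submodule N\<^sub>F R F" "submodule N\<^sub>X R X"
    and "\<And>z. z \<in> carrier M \<Longrightarrow> f z \<in> N\<^sub>F \<longleftrightarrow> z \<in> N\<^sub>M" "g ` N\<^sub>F = N\<^sub>X"
    and "set xs \<subseteq> carrier R" "weakly_regular F N\<^sub>F xs" "weakly_regular X N\<^sub>X xs"
  shows "weakly_regular M N\<^sub>M xs \<and>
    (\<forall>z\<in>carrier M. f z \<in> foldl (adjoin_mult F) N\<^sub>F xs \<longleftrightarrow> z \<in> foldl (adjoin_mult M) N\<^sub>M xs)"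
  using assms(5-)
proof (induction xs arbitrary: N\<^sub>M N\<^sub>F N\<^sub>X)
  case (Cons x xs)
  have x: "x \<in> carrier R" "set xs \<subseteq> carrier R" and reg: "nzd_mod F N\<^sub>F x" "nzd_mod X N\<^sub>X x"
    using Cons.prems by auto
  note step = short_exact_adjoin_mult[OF M F X ex Cons.prems(1-5) x(1) reg]
  show ?case
    using Cons.IH[of "adjoin_mult M N\<^sub>M x" "adjoin_mult F N\<^sub>F x" "adjoin_mult X N\<^sub>X x", OF _ _ _ step(2,3) x(2)]
      module.adjoin_mult_submodule[OF M Cons.prems(1) x(1)]
      module.adjoin_mult_submodule[OF F Cons.prems(2) x(1)]
      module.adjoin_mult_submodule[OF X Cons.prems(3) x(1)] step(1) Cons.prems(7,8)
    by simp
qed simp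

section \<open>Regular sequences on free modules, coordinate by coordinate\<close>

lemma adjoin_mult_free_module:
  assumes R: "cring R" and J: "submodule J R (reg_module R)" and x: "x \<in> carrier R"
  shows "adjoin_mult (free_module R n) {v \<in> carrier (free_module R n). \<forall>i<n. v i \<in> J} x =
    {v \<in> carrier (free_module R n). \<forall>i<n. v i \<in> adjoin_mult (reg_module R) J x}" (is "?A = ?B")
proof
  interpret cring R by fact
  interpret F: module R "free_module R n" by (rule module_free_module) fact
  have Jc: "J \<subseteq> carrier R" using module.submoduleE(1)[OF module_reg_module[OF R] J] by simp
  show "?A \<subseteq> ?B"
  proof
    fix v assume "v \<in> ?A"
    then obtain y w where yw: "w \<in> carrier (free_module R n)" "y \<in> carrier (free_module R n)"
      "\<forall>i<n. y i \<in> J" "v = y \<oplus>\<^bsub>free_module R n\<^esub> x \<odot>\<^bsub>free_module R n\<^esub> w"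
      by (auto simp: adjoin_mult_def)
    have "v \<in> carrier (free_module R n)" using yw x by simp
    moreover have "v i \<in> adjoin_mult (reg_module R) J x" if "i < n" for i
      using that yw unfolding adjoin_mult_def by (auto simp: free_module_simps)
    ultimately show "v \<in> ?B" by blast
  qed
  show "?B \<subseteq> ?A"
  proof
    fix v assume v: "v \<in> ?B"
    have "\<forall>i. \<exists>y w. i < n \<longrightarrow> y \<in> J \<and> w \<in> carrier R \<and> v i = y \<oplus>\<^bsub>R\<^esub> x \<otimes>\<^bsub>R\<^esub> w"
      using v by (auto simp: adjoin_mult_def)
    then obtain y w where yw: "\<And>i. i < n \<Longrightarrow> y i \<in> J \<and> w i \<in> carrier R \<and> v i = y i \<oplus>\<^bsub>R\<^esub> x \<otimes>\<^bsub>R\<^esub> w i"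
      by metis
    define y' where "y' i = (if i < n then y i else \<zero>\<^bsub>R\<^esub>)" for i
    define w' where "w' i = (if i < n then w i else \<zero>\<^bsub>R\<^esub>)" for i
    have "v = y' \<oplus>\<^bsub>free_module R n\<^esub> x \<odot>\<^bsub>free_module R n\<^esub> w'"
      using v yw x by (auto simp: free_module_simps y'_def w'_def fun_eq_iff)
    moreover have "w' \<in> carrier (free_module R n)" "y' \<in> {v \<in> carrier (free_module R n). \<forall>i<n. v i \<in> J}"
      using yw Jc by (auto simp: free_module_simps y'_def w'_def)
    ultimately show "v \<in> ?A" unfolding adjoin_mult_def by blast
  qed
qed

lemma weakly_regular_free_module:
  assumes R: "cring R"
  shows "\<lbrakk>submodule J R (reg_module R); set xs \<subseteq> carrier R; weakly_regular (reg_module R) J xs\<rbrakk> \<Longrightarrow>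
    weakly_regular (free_module R n) {v \<in> carrier (free_module R n). \<forall>i<n. v i \<in> J} xs \<and>
    foldl (adjoin_mult (free_module R n)) {v \<in> carrier (free_module R n). \<forall>i<n. v i \<in> J} xs =
      {v \<in> carrier (free_module R n). \<forall>i<n. v i \<in> foldl (adjoin_mult (reg_module R)) J xs}"
proof (induction xs arbitrary: J)
  case (Cons x xs)
  have x: "x \<in> carrier R" using Cons.prems by simp
  have "nzd_mod (free_module R n) {v \<in> carrier (free_module R n). \<forall>i<n. v i \<in> J} x"
    using Cons.prems(3) by (auto simp: nzd_mod_def free_module_simps)
  then show ?case
    using Cons.IH[of "adjoin_mult (reg_module R) J x"] Cons.prems
      adjoin_mult_free_module[OF R Cons.prems(1) x]
      module.adjoin_mult_submodule[OF module_reg_module[OF R] Cons.prems(1) x]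
    by simp
qed simp

section \<open>Free direct summands\<close>

text \<open>If u generated a proper ideal, the noetherian condition would give an ideal maximal
  among the proper ones containing it; by locality that is \<open>max_ideal R\<close>, which misses
  u.\<close>

lemma local_ring_unit:
  assumes R: "local_ring R" and nR: "noetherian_module R (reg_module R)"
    and u: "u \<in> carrier R" "u \<notin> max_ideal R"
  obtains b where "b \<in> carrier R" "b \<otimes>\<^bsub>R\<^esub> u = \<one>\<^bsub>R\<^esub>"
proof -
  interpret cring R using R by (simp add: local_ring_def)
  note iff = submodule_reg_module_iff[OF is_cring]
  let ?P = "PIdl\<^bsub>R\<^esub> u"
  let ?\<C> = "{I. ideal I R \<and> ?P \<subseteq> I \<and> I \<noteq> carrier R}"
  have "?P = carrier R"
  proof (rule ccontr)
    assume "?P \<noteq> carrier R"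
    then have "?\<C> \<noteq> {}" using cgenideal_ideal[OF u(1)] by blast
    then have "\<exists>I. I \<in> ?\<C> \<and> (\<forall>I'. I' \<in> ?\<C> \<longrightarrow> I \<subseteq> I' \<longrightarrow> I' = I)"
      by (rule noetherian_moduleD[OF nR]) (simp add: iff)
    then obtain I where "I \<in> ?\<C>" and max: "\<forall>I'. I' \<in> ?\<C> \<longrightarrow> I \<subseteq> I' \<longrightarrow> I' = I"
      by (elim exE conjE) (rule that)
    then have I: "ideal I R" "?P \<subseteq> I" "I \<noteq> carrier R" by auto
    have "maximalideal I R"
    proof (rule maximalidealI[OF I(1)])
      show "J = I \<or> J = carrier R" if "ideal J R" "I \<subseteq> J" "J \<subseteq> carrier R" for J
        using max[rule_format, of J] that I(2) by auto
    qed (use I(3) in simp)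
    then have "I = max_ideal R"
      using R local_ring_max_ideal(2)[OF R] by (auto simp: local_ring_def)
    then show False using I(2) cgenideal_self[OF u(1)] u(2) by blast
  qed
  then have "\<one>\<^bsub>R\<^esub> \<in> ?P" by simp
  then show ?thesis using that unfolding cgenideal_def by auto
qed

text \<open>The map sending r to r z splits h, so M is the direct sum of R z, a copy of R, and the
  kernel of h.\<close>

lemma reg_direct_summand_of_hom:
  assumes M: "module R M" and h: "module_hom R M (reg_module R) h"
    and z: "z \<in> carrier M" "h z = \<one>\<^bsub>R\<^esub>"
  shows "direct_summand R (reg_module R) M"
proof -
  interpret M: module R M by fact
  interpret reg: module R "reg_module R" by (rule module_reg_module) (rule M.R.cring_axioms)
  let ?f = "\<lambda>r. r \<odot>\<^bsub>M\<^esub> z"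
  have f: "module_hom R (reg_module R) M ?f"
    by (rule module_homI) (use z in \<open>auto simp: M.smult_l_distr M.smult_assoc1\<close>)
  have hf: "h (?f r) = r" if "r \<in> carrier R" for r
    using module_hom_smult[OF h that z(1)] z(2) that by simp
  let ?A = "?f ` carrier R" and ?B = "{x \<in> carrier M. h x \<in> {\<zero>\<^bsub>R\<^esub>}}"
  have A: "submodule ?A R M"
    using module_hom_image[OF reg.module_axioms M f reg.carrier_is_submodule] by simp
  have B: "submodule ?B R M"
    using module_hom_vimage[OF M reg.module_axioms h reg.zero_submodule] by simp
  have "x \<in> ?A <+>\<^bsub>M\<^esub> ?B" if x: "x \<in> carrier M" for x
  proof -
    have hx: "h x \<in> carrier R" using module_hom_closed[OF h x] by simp
    have "h (x \<ominus>\<^bsub>M\<^esub> ?f (h x)) = h x \<ominus>\<^bsub>R\<^esub> h x"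
      using module_hom_minus[OF M reg.module_axioms h x, of "?f (h x)"] hf[OF hx] hx z
      by (simp add: reg_module_minus)
    then have "x \<ominus>\<^bsub>M\<^esub> ?f (h x) \<in> ?B" using x hx z by (simp add: M.R.minus_eq M.R.r_neg)
    moreover have "x = ?f (h x) \<oplus>\<^bsub>M\<^esub> (x \<ominus>\<^bsub>M\<^esub> ?f (h x))"
      using x hx z by (simp add: M.M.minus_eq M.M.a_comm[of x] M.M.r_neg1 M.M.r_neg2)
    ultimately show ?thesis using hx unfolding set_add_def' by blast
  qed
  then have "?A <+>\<^bsub>M\<^esub> ?B = carrier M"
    using M.submoduleE(1)[OF A] M.submoduleE(1)[OF B] by (auto simp: set_add_def')
  moreover have "?A \<inter> ?B = {\<zero>\<^bsub>M\<^esub>}"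
    using hf z M.submodule_zero[OF A] M.submodule_zero[OF B] by auto
  moreover have "module_iso R (reg_module R) (M\<lparr>carrier := ?A\<rparr>)"
  proof -
    have "module_hom R (reg_module R) (M\<lparr>carrier := ?A\<rparr>) ?f"
      using f by (auto simp: module_hom_def)
    moreover have "bij_betw ?f (carrier R) ?A"
      using hf by (intro bij_betw_imageI inj_on_inverseI[where g = h]) auto
    ultimately show ?thesis unfolding module_iso_def by auto
  qed
  ultimately show ?thesis unfolding direct_summand_def using A B by blast
qed

text \<open>A coordinate of f with a unit value at z takes the value 1 at a multiple of z, and such
  a linear form splits off a copy of R.\<close>

lemma hom_free_max_ideal_of_not_summand:
  assumes R: "local_ring R" and nR: "noetherian_module R (reg_module R)" and M: "module R M"
    and f: "module_hom R M (free_module R n) f" and ns: "\<not> direct_summand R (reg_module R) M"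
    and z: "z \<in> carrier M"
  shows "f z i \<in> max_ideal R"
proof (rule ccontr)
  interpret M: module R M by fact
  assume u: "f z i \<notin> max_ideal R"
  have fc: "f w i \<in> carrier R" if "w \<in> carrier M" for w
    using free_module_nth_closed[OF M.R.cring_axioms module_hom_closed[OF f that]] .
  have h: "module_hom R M (reg_module R) (\<lambda>w. f w i)"
    by (rule module_homI) (auto simp: fc module_hom_add[OF f] module_hom_smult[OF f] free_module_simps)
  obtain b where b: "b \<in> carrier R" "b \<otimes>\<^bsub>R\<^esub> f z i = \<one>\<^bsub>R\<^esub>"
    by (rule local_ring_unit[OF R nR fc[OF z] u])
  have "direct_summand R (reg_module R) M"
    using b z by (intro reg_direct_summand_of_hom[OF M h, of "b \<odot>\<^bsub>M\<^esub> z"])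
      (auto simp: module_hom_smult[OF f] free_module_simps)
  then show False using ns by blast
qed

text \<open>With M = h(R) + B and J the ideal generated by the sequence, JM is contained in h(J) +
  B. Applying a to h(1) puts h(a) into h(J) + B, and directness of the sum forces a into J.\<close>

lemma direct_summand_faithful_mod:
  assumes M: "module R M" and ds: "direct_summand R (reg_module R) M" and xs: "set xs \<subseteq> carrier R"
    and a: "a \<in> carrier R" "\<And>z. z \<in> carrier M \<Longrightarrow> a \<odot>\<^bsub>M\<^esub> z \<in> foldl (adjoin_mult M) {\<zero>\<^bsub>M\<^esub>} xs"
  shows "a \<in> foldl (adjoin_mult (reg_module R)) {\<zero>\<^bsub>R\<^esub>} xs"
proof -
  interpret M: module R M by fact
  interpret reg: module R "reg_module R" by (rule module_reg_module) (rule M.R.cring_axioms)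
  obtain A B h where A: "submodule A R M" and B: "submodule B R M"
    and sum: "A <+>\<^bsub>M\<^esub> B = carrier M" and int: "A \<inter> B = {\<zero>\<^bsub>M\<^esub>}"
    and h: "module_hom R (reg_module R) (M\<lparr>carrier := A\<rparr>) h" and bij: "bij_betw h (carrier R) A"
    using ds by (auto simp: direct_summand_def module_iso_def)
  have hA: "h ` carrier R = A" using bij by (simp add: bij_betw_def)
  have Ac: "A \<subseteq> carrier M" and Bc: "B \<subseteq> carrier M" using M.submoduleE(1) A B by auto
  have hc: "h r \<in> carrier M" if "r \<in> carrier R" for r using hA Ac that by blast
  have hadd: "h (r \<oplus>\<^bsub>R\<^esub> s) = h r \<oplus>\<^bsub>M\<^esub> h s" and hmult: "h (r \<otimes>\<^bsub>R\<^esub> s) = r \<odot>\<^bsub>M\<^esub> h s"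
    if "r \<in> carrier R" "s \<in> carrier R" for r s
    using module_hom_add[OF h] module_hom_smult[OF h] that by auto
  \<comment> \<open>The complement B is kept whole: h(J) + B is an upper bound for JM, and it
    already meets A in h(J) alone.\<close>
  define T where "T J = {h r \<oplus>\<^bsub>M\<^esub> b | r b. r \<in> J \<and> b \<in> B}" for J
  have T: "foldl (adjoin_mult M) L xs \<subseteq> T (foldl (adjoin_mult (reg_module R)) J xs)"
    if "submodule J R (reg_module R)" "L \<subseteq> T J" "set xs \<subseteq> carrier R" for L J
    using that
  proof (induction xs arbitrary: L J)
    case (Cons x xs)
    have x: "x \<in> carrier R" and J: "J \<subseteq> carrier R" using Cons.prems reg.submoduleE(1) by auto
    have "adjoin_mult M L x \<subseteq> T (adjoin_mult (reg_module R) J x)"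
    proof
      fix z assume "z \<in> adjoin_mult M L x"
      then obtain y w where yw: "w \<in> carrier M" "y \<in> L" "z = y \<oplus>\<^bsub>M\<^esub> x \<odot>\<^bsub>M\<^esub> w"
        by (auto simp: adjoin_mult_def)
      obtain r b where rb: "r \<in> J" "b \<in> B" "y = h r \<oplus>\<^bsub>M\<^esub> b"
        using yw(2) Cons.prems(2) by (auto simp: T_def)
      have "w \<in> A <+>\<^bsub>M\<^esub> B" using yw(1) sum by simp
      then obtain w' b' where "w' \<in> A" "b' \<in> B" "w = w' \<oplus>\<^bsub>M\<^esub> b'" by (auto simp: set_add_def')
      then obtain s where sb: "s \<in> carrier R" "b' \<in> B" "w = h s \<oplus>\<^bsub>M\<^esub> b'" using hA by blast
      have c: "r \<in> carrier R" "b \<in> carrier M" "b' \<in> carrier M" using rb sb J Bc by auto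
      have "z = (h r \<oplus>\<^bsub>M\<^esub> x \<odot>\<^bsub>M\<^esub> h s) \<oplus>\<^bsub>M\<^esub> (b \<oplus>\<^bsub>M\<^esub> x \<odot>\<^bsub>M\<^esub> b')"
        unfolding yw(3) rb(3) sb(3) using c hc sb(1) x
        by (simp add: M.smult_r_distr M.M.a_ac)
      also have "h r \<oplus>\<^bsub>M\<^esub> x \<odot>\<^bsub>M\<^esub> h s = h (r \<oplus>\<^bsub>R\<^esub> x \<otimes>\<^bsub>R\<^esub> s)"
        using c sb(1) x by (simp add: hadd hmult)
      finally have "z = h (r \<oplus>\<^bsub>R\<^esub> x \<otimes>\<^bsub>R\<^esub> s) \<oplus>\<^bsub>M\<^esub> (b \<oplus>\<^bsub>M\<^esub> x \<odot>\<^bsub>M\<^esub> b')" .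
      moreover have "b \<oplus>\<^bsub>M\<^esub> x \<odot>\<^bsub>M\<^esub> b' \<in> B"
        using rb(2) sb(2) x M.submoduleE(4,5)[OF B] by blast
      moreover have "r \<oplus>\<^bsub>R\<^esub> x \<otimes>\<^bsub>R\<^esub> s \<in> adjoin_mult (reg_module R) J x"
        using rb(1) sb(1) by (auto simp: adjoin_mult_def)
      ultimately show "z \<in> T (adjoin_mult (reg_module R) J x)" unfolding T_def by blast
    qed
    then show ?case
      using Cons.IH[OF reg.adjoin_mult_submodule[OF Cons.prems(1) x]] Cons.prems(3) by simp
  qed simp
  let ?J = "foldl (adjoin_mult (reg_module R)) {\<zero>\<^bsub>R\<^esub>} xs"
  have Z: "submodule {\<zero>\<^bsub>R\<^esub>} R (reg_module R)" using reg.zero_submodule by simp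
  have Jc: "?J \<subseteq> carrier R"
    using reg.submoduleE(1)[OF reg.foldl_adjoin_mult_submodule[OF Z xs]] by simp
  have h0: "h \<zero>\<^bsub>R\<^esub> = \<zero>\<^bsub>M\<^esub>"
    using hmult[of "\<zero>\<^bsub>R\<^esub>" "\<zero>\<^bsub>R\<^esub>"] hc[of "\<zero>\<^bsub>R\<^esub>"] by simp
  have "{\<zero>\<^bsub>M\<^esub>} \<subseteq> T {\<zero>\<^bsub>R\<^esub>}"
    using M.submodule_zero[OF B] h0 by (auto simp: T_def intro!: exI[of _ "\<zero>\<^bsub>M\<^esub>"])
  then have "foldl (adjoin_mult M) {\<zero>\<^bsub>M\<^esub>} xs \<subseteq> T ?J" using T[OF Z _ xs] by blast
  moreover have "a \<odot>\<^bsub>M\<^esub> h \<one>\<^bsub>R\<^esub> = h a" using hmult[of a "\<one>\<^bsub>R\<^esub>"] a(1) by simp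
  ultimately have "h a \<in> T ?J" using a(2)[of "h \<one>\<^bsub>R\<^esub>"] hc[of "\<one>\<^bsub>R\<^esub>"] by auto
  then obtain r b where rb: "r \<in> ?J" "b \<in> B" "h a = h r \<oplus>\<^bsub>M\<^esub> b" by (auto simp: T_def)
  have c: "r \<in> carrier R" "b \<in> carrier M" using rb Jc Bc by auto
  have "h r \<in> A" "h a \<in> A" using hA c a(1) by auto
  then have "b \<in> A" using M.submodule_cancel_left[OF A, of "h r" b] c rb(3) by simp
  then have "b = \<zero>\<^bsub>M\<^esub>" using int rb(2) by blast
  then have "h a = h r" using rb(3) hc[OF c(1)] by simp
  then have "a = r" using bij a(1) c(1) by (auto simp: bij_betw_def inj_on_def)
  then show ?thesis using rb(1) by simp
qed

section \<open>The type of the idealization\<close>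

lemma (in module) foldl_adjoin_mult_smult:
  assumes "set xs \<subseteq> carrier R" "submodule J R (reg_module R)"
    and "\<And>a z. \<lbrakk>a \<in> J; z \<in> carrier M\<rbrakk> \<Longrightarrow> a \<odot>\<^bsub>M\<^esub> z \<in> L"
    and "a \<in> foldl (adjoin_mult (reg_module R)) J xs" "z \<in> carrier M"
  shows "a \<odot>\<^bsub>M\<^esub> z \<in> foldl (adjoin_mult M) L xs"
  using assms
proof (induction xs arbitrary: J L)
  case (Cons x xs)
  interpret reg: module R "reg_module R" by (rule module_reg_module) (rule R.cring_axioms)
  have x: "x \<in> carrier R" and J: "J \<subseteq> carrier R"
    using Cons.prems reg.submoduleE(1)[OF Cons.prems(2)] by auto
  have "a \<odot>\<^bsub>M\<^esub> z \<in> adjoin_mult M L x"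
    if a: "a \<in> adjoin_mult (reg_module R) J x" and z: "z \<in> carrier M" for a z
  proof -
    obtain r s where rs: "r \<in> J" "s \<in> carrier R" "a = r \<oplus> x \<otimes> s"
      using a by (auto simp: adjoin_mult_def)
    then have "a \<odot>\<^bsub>M\<^esub> z = r \<odot>\<^bsub>M\<^esub> z \<oplus>\<^bsub>M\<^esub> x \<odot>\<^bsub>M\<^esub> (s \<odot>\<^bsub>M\<^esub> z)"
      using x z J by (auto simp: smult_l_distr smult_assoc1)
    then show ?thesis using Cons.prems(3)[OF rs(1) z] rs(2) z unfolding adjoin_mult_def by blast
  qed
  then show ?case
    using Cons.IH[OF _ reg.adjoin_mult_submodule[OF Cons.prems(2) x]] Cons.prems by simp
qed simp

lemma sub_len_self: "submodule N R M \<Longrightarrow> sub_len R M N N = 0"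
proof -
  assume "submodule N R M"
  then have "{C. submodule C R M \<and> N \<subseteq> C \<and> C \<subseteq> N} = {N}" by auto
  moreover have "\<not> enat (Suc 0) \<le> chain_len {N}"
    by (subst enat_le_chain_len) auto
  ultimately show ?thesis
    unfolding sub_len_def by (metis One_nat_def ileI1 not_gr_zero one_eSuc one_enat_def)
qed

theorem theorem1p3:
  fixes R :: "('a, 'c) ring_scheme" and M :: "('a, 'b, 'd) module_scheme"
  assumes "CM_local_ring R"
    and "Omega_CM R M"
  shows "CM_type_ring (idealization R M) =
    (if direct_summand R (reg_module R) M then CM_type R M
     else CM_type_ring R + CM_type R M)"
proof -
  define t where "t = the_enat (krull_dim R)"
  have loc: "local_ring R" and noeth: "noetherian_ring R"
    and depthR: "depth R (reg_module R) = krull_dim R"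
    using assms(1) by (auto simp: CM_local_ring_def)
  note m = local_ring_max_ideal[OF loc]
  obtain k f g and X :: "('a, (nat \<Rightarrow> 'a) set) module" where "MCM R M" "MCM R X"
    and ex: "short_exact R M f (free_module R k) g X"
    using assms(2) by (auto simp: Omega_CM_def)
  then have M: "module R M" "fin_gen_module R M"
    and X: "module R X" "fin_gen_module R X" "depth R X = krull_dim R"
    by (auto simp: MCM_def)
  interpret M: module R M by fact
  interpret reg: module R "reg_module R" by (rule module_reg_module) (rule m(1))
  interpret F: module R "free_module R k" by (rule module_free_module) (rule m(1))
  interpret X: module R X by fact
  have nR: "noetherian_module R (reg_module R)" using noetherian_reg_module[OF m(1) noeth] .
  have nM: "noetherian_module R M" and nX: "noetherian_module R X"
    using M.fin_gen_noetherian[OF nR M(2)] X.fin_gen_noetherian[OF nR X(2)] .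
  have f: "module_hom R M (free_module R k) f" and inj: "inj_on f (carrier M)"
    and g: "module_hom R (free_module R k) X g"
    using ex by (auto simp: short_exact_def)

  obtain n d e where "free_resolution R (residue_field R) n d e"
    using residue_field_free_resolution[OF loc nR] by blast
  then obtain \<epsilon> v\<^sub>0 where res: "residue_resolution R (max_ideal R) n d \<epsilon> v\<^sub>0"
    unfolding residue_field_def by (rule residue_resolution_of_free_resolution[OF m(1,3)])
  have Z: "submodule {\<zero>\<^bsub>R\<^esub>} R (reg_module R)" using reg.zero_submodule by simp
  have "ext_vanishes R n d (reg_module R) t {\<zero>\<^bsub>R\<^esub>}"
    using depth_ext_vanishes[OF res reg.module_axioms depthR] by (simp add: t_def)
  then obtain xs where xs: "length xs = t" "set xs \<subseteq> max_ideal R"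
    and regR: "weakly_regular (reg_module R) {\<zero>\<^bsub>R\<^esub>} xs" and regX: "weakly_regular X {\<zero>\<^bsub>X\<^esub>} xs"
    using residue_resolution.common_regular_sequence[OF res reg.module_axioms X(1) nR nR nX Z
        X.zero_submodule _ depth_ext_vanishes[OF res X(1,3), folded t_def]] by blast
  have xsR: "set xs \<subseteq> carrier R" using xs(2) m(4) by blast

  define J where "J = foldl (adjoin_mult (reg_module R)) {\<zero>\<^bsub>R\<^esub>} xs"
  define L where "L = foldl (adjoin_mult M) {\<zero>\<^bsub>M\<^esub>} xs"
  have J: "submodule J R (reg_module R)"
    unfolding J_def by (rule reg.foldl_adjoin_mult_submodule[OF Z xsR])
  have L: "submodule L R M"
    unfolding L_def by (rule M.foldl_adjoin_mult_submodule[OF M.zero_submodule xsR])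
  \<comment> \<open>The statement on free modules concerns vectors with all coordinates in a given
    ideal; for the zero ideal these form the zero submodule.\<close>
  have zeroF: "{v \<in> carrier (free_module R k). \<forall>i<k. v i \<in> {\<zero>\<^bsub>R\<^esub>}} = {\<zero>\<^bsub>free_module R k\<^esub>}"
    by (auto simp: free_module_simps fun_eq_iff not_less)
       (metis not_less)
  have regF: "weakly_regular (free_module R k) {\<zero>\<^bsub>free_module R k\<^esub>} xs"
    and foldF: "foldl (adjoin_mult (free_module R k)) {\<zero>\<^bsub>free_module R k\<^esub>} xs =
      {v \<in> carrier (free_module R k). \<forall>i<k. v i \<in> J}"
    using weakly_regular_free_module[OF m(1) Z xsR regR, of k] unfolding zeroF J_def by auto
  have f0: "f \<zero>\<^bsub>M\<^esub> = \<zero>\<^bsub>free_module R k\<^esub>" and g0: "g \<zero>\<^bsub>free_module R k\<^esub> = \<zero>\<^bsub>X\<^esub>"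
    using module_hom_zero[OF M(1) F.module_axioms f] module_hom_zero[OF F.module_axioms X(1) g] .
  have "weakly_regular M {\<zero>\<^bsub>M\<^esub>} xs \<and> (\<forall>z\<in>carrier M.
      f z \<in> foldl (adjoin_mult (free_module R k)) {\<zero>\<^bsub>free_module R k\<^esub>} xs \<longleftrightarrow> z \<in> L)"
    unfolding L_def
  proof (rule short_exact_weakly_regular[OF M(1) F.module_axioms X(1) ex M.zero_submodule
        F.zero_submodule X.zero_submodule _ _ xsR regF regX])
    show "f z \<in> {\<zero>\<^bsub>free_module R k\<^esub>} \<longleftrightarrow> z \<in> {\<zero>\<^bsub>M\<^esub>}" if "z \<in> carrier M" for z
      using f0 inj_onD[OF inj, of z "\<zero>\<^bsub>M\<^esub>"] that by auto
  qed (simp add: g0)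
  then have regM: "weakly_regular M {\<zero>\<^bsub>M\<^esub>} xs"
    and preL: "\<And>z. z \<in> carrier M \<Longrightarrow> (\<forall>i<k. f z i \<in> J) \<longleftrightarrow> z \<in> L"
    using module_hom_closed[OF f] unfolding foldF by auto

  let ?S = "idealization R M"
  define U where "U = {a \<in> colon_mod (reg_module R) J (max_ideal R). \<forall>z\<in>carrier M. a \<odot>\<^bsub>M\<^esub> z \<in> L}"
  define W where "W = colon_mod M L (max_ideal R)"
  have JL: "a \<odot>\<^bsub>M\<^esub> z \<in> L" if "a \<in> J" "z \<in> carrier M" for a z
    using M.foldl_adjoin_mult_smult[OF xsR Z _ that[unfolded J_def], of "{\<zero>\<^bsub>M\<^esub>}"]
    by (simp add: L_def)
  have colonJ: "submodule (colon_mod (reg_module R) J (max_ideal R)) R (reg_module R)"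
    by (rule reg.colon_mod_submodule[OF J m(4)])
  have U: "submodule U R (reg_module R)"
  proof (rule reg.submoduleI')
    show "a \<oplus>\<^bsub>reg_module R\<^esub> b \<in> U" if "a \<in> U" "b \<in> U" for a b
      using that reg.submoduleE(1,5)[OF colonJ] M.submoduleE(5)[OF L]
      by (auto simp: U_def M.smult_l_distr subset_iff)
    show "a \<odot>\<^bsub>reg_module R\<^esub> b \<in> U" if "a \<in> carrier R" "b \<in> U" for a b
      using that reg.submoduleE(1,4)[OF colonJ] M.submoduleE(4)[OF L]
      by (auto simp: U_def M.smult_assoc1 subset_iff)
  qed (use reg.submoduleE(1)[OF colonJ] reg.submodule_zero[OF colonJ] M.submodule_zero[OF L] in
        \<open>auto simp: U_def\<close>)
  have JU: "J \<subseteq> U" using reg.colon_mod_superset[OF J m(4)] JL by (auto simp: U_def)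
  have W: "submodule W R M" "L \<subseteq> W"
    unfolding W_def using M.colon_mod_submodule[OF L m(4)] M.colon_mod_superset[OF L m(4)] .

  have typeM: "CM_type R M = sub_len R M W L"
    unfolding W_def L_def
    by (rule CM_type_eq_socle_length[OF loc nR M(1) xs(2) regM]) (simp add: xs(1) t_def)
  have typeR: "CM_type_ring R = sub_len R (reg_module R) (colon_mod (reg_module R) J (max_ideal R)) J"
    unfolding CM_type_ring_def J_def
    using CM_type_eq_socle_length[OF loc nR reg.module_axioms xs(2)] regR xs(1) by (simp add: t_def)
  have typeS: "CM_type_ring ?S = sub_len R (reg_module R) U J + CM_type R M"
  proof -
    let ?ys = "map (\<lambda>x. (x, \<zero>\<^bsub>M\<^esub>)) xs"
    have ys: "weakly_regular (reg_module ?S) {\<zero>\<^bsub>reg_module ?S\<^esub>} ?ys"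
      "foldl (adjoin_mult (reg_module ?S)) {\<zero>\<^bsub>reg_module ?S\<^esub>} ?ys = J \<times> L"
      using M.weakly_regular_idealization[OF xsR Z M.zero_submodule regR regM]
      by (simp_all add: J_def L_def)
    \<comment> \<open>The mapped sequence has the length prescribed over S because S and R have the
      same dimension.\<close>
    have "CM_type_ring ?S = sub_len ?S (reg_module ?S)
        (colon_mod (reg_module ?S) (J \<times> L) (max_ideal R \<times> carrier M)) (J \<times> L)"
      using CM_type_eq_socle_length[OF M.local_idealization(1)[OF loc]
          M.noetherian_idealization[OF nR nM] M.module_reg_idealization _ ys(1)] xs ys(2)
      unfolding CM_type_ring_def M.local_idealization(2)[OF loc] M.krull_dim_idealization
      by (auto simp: t_def subset_iff)
    also have "colon_mod (reg_module ?S) (J \<times> L) (max_ideal R \<times> carrier M) = U \<times> W"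
      unfolding U_def W_def
      using additive_subgroup.zero_closed[OF ideal.axioms(1)[OF m(3)]]
      by (intro M.colon_idealization[OF J L m(4)])
    also have "sub_len ?S (reg_module ?S) (U \<times> W) (J \<times> L) =
        sub_len R (reg_module R) U J + sub_len R M W L"
      by (rule M.sub_len_idealization[OF U J JU W(1) L W(2)]) (simp add: U_def)
    finally show ?thesis by (simp add: typeM)
  qed
  show ?thesis
  proof (cases "direct_summand R (reg_module R) M")
    case True
    have "U \<subseteq> J"
    proof
      fix a assume "a \<in> U"
      then have "a \<in> carrier R" "\<And>z. z \<in> carrier M \<Longrightarrow> a \<odot>\<^bsub>M\<^esub> z \<in> L"
        by (auto simp: U_def colon_mod_def)
      then show "a \<in> J"
        using direct_summand_faithful_mod[OF M(1) True xsR] by (simp add: J_def L_def)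
    qed
    then have "U = J" using JU by blast
    then show ?thesis using True typeS sub_len_self[OF J] by simp
  next
    case False
    have "a \<odot>\<^bsub>M\<^esub> z \<in> L" if a: "a \<in> colon_mod (reg_module R) J (max_ideal R)" and z: "z \<in> carrier M" for a z
    proof -
      have aR: "a \<in> carrier R" using a by (simp add: colon_mod_def)
      have "f (a \<odot>\<^bsub>M\<^esub> z) i \<in> J" for i
      proof -
        \<comment> \<open>A coordinate of f(z) lies in m and is therefore multiplied into J by a, so
          that f(az) has all coordinates in J.\<close>
        have fm: "f z i \<in> max_ideal R"
          by (rule hom_free_max_ideal_of_not_summand[OF loc nR M(1) f False z])
        then have "f z i \<otimes>\<^bsub>R\<^esub> a \<in> J" using a by (simp add: colon_mod_def)
        then show ?thesis
          using module_hom_smult[OF f aR z] aR fm m(4) by (simp add: free_module_simps M.R.m_comm subset_iff)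
      qed
      then show ?thesis using preL[of "a \<odot>\<^bsub>M\<^esub> z"] aR z by simp
    qed
    then have "U = colon_mod (reg_module R) J (max_ideal R)" by (auto simp: U_def)
    then show ?thesis using False typeS typeR by simp
  qed
qed

end
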